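(* Let $\varepsilon>0$ be fixed. For $x$ large, let $a_1<a_2<\cdots$ be the $x^{\varepsilon}$-smooth numbers in increasing order. Then $$\sum_{\substack{a_n\le x\\ a_{n+1}-a_n\ge x^{1/3+\varepsilon}}}(a_{n+1}-a_n)^2\ll_{\varepsilon} x^{1+\varepsilon}.$$
   Context: For a positive real number $y$, a positive integer $n$ is called $y$-smooth if all prime factors $p\mid n$ satisfy $p\le y$ (so $1$ is $y$-smooth). The sequence $(a_n)$ is the infinite sequence of all $x^{\varepsilon}$-smooth positive integers, and depends on $x$ and $\varepsilon$. The notation $A\ll_{\varepsilon}B$ means that there are constants $C(\varepsilon)>0$ and $x_0(\varepsilon)$, depending only on $\varepsilon$, such that $|A|\le C(\varepsilon)B$ for all real $x\ge x_0(\varepsilon)$. *)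

theory Defs
  imports Complex_Main "HOL-Library.Infinite_Set" "HOL-Computational_Algebra.Primes"
begin

definition smooth :: "real \<Rightarrow> nat \<Rightarrow> bool" where
  "smooth y n \<longleftrightarrow> n > 0 \<and> (\<forall>p. prime p \<and> p dvd n \<longrightarrow> real p \<le> y)"

(* The index starts at 0, so smooth_seq y n is a_{n+1} in the usual numbering and
   smooth_seq y 0 = 1. For y < 2 the only y-smooth number is 1 and the later values
   carry no meaning; for y \<ge> 2 the sequence is strictly increasing and runs through
   all y-smooth numbers, as shown below. *)
definition smooth_seq :: "real \<Rightarrow> nat \<Rightarrow> nat" where
  "smooth_seq y = enumerate {n. smooth y n}"

lemma infinite_smooth:
  assumes "y \<ge> 2"
  shows "infinite {n. smooth y n}"
proof -
  have "smooth y (2 ^ k)" for k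
  proof -
    have "real p \<le> y" if "prime p" "p dvd 2 ^ k" for p :: nat
    proof -
      from that have "p dvd 2" by (metis prime_dvd_power)
      then have "p \<le> 2" by (simp add: dvd_imp_le)
      then show ?thesis using assms by linarith
    qed
    then show ?thesis by (simp add: smooth_def)
  qed
  then have "range (\<lambda>k. 2 ^ k :: nat) \<subseteq> {n. smooth y n}" by auto
  moreover have "infinite (range (\<lambda>k. 2 ^ k :: nat))"
    by (rule range_inj_infinite) (simp add: inj_on_def)
  ultimately show ?thesis by (rule infinite_super)
qed

lemma strict_mono_smooth_seq: "y \<ge> 2 \<Longrightarrow> strict_mono (smooth_seq y)"
  unfolding smooth_seq_def by (rule strict_mono_enumerate) (rule infinite_smooth)

lemma range_smooth_seq: "y \<ge> 2 \<Longrightarrow> range (smooth_seq y) = {n. smooth y n}"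
  unfolding smooth_seq_def by (rule range_enumerate) (rule infinite_smooth)

end

theory Submission
  imports Defs "HOL-Probability.Probability" "HOL-Real_Asymp.Real_Asymp"
    "HOL-Combinatorics.Multiset_Permutations"
begin

text \<open>
  Let \<open>\<tau>\<close> be the logarithm of the midpoint of a gap that starts near \<open>X\<close> and has length about
  \<open>X D\<close>. Then no smooth \<open>n\<close> satisfies \<open>\<bar>ln n - \<tau>\<bar> < D\<close> (up to a constant factor in \<open>D\<close>), and the
  points \<open>\<tau>\<close> of distinct gaps are at least \<open>D\<close> apart. Summing over dyadic ranges for the position and the
  length of the gap, it suffices to show that the number \<open>R\<close> of such points satisfies
  \<open>R X D\<^sup>2 \<le> x powr (\<epsilon>/2)\<close> whenever \<open>X\<^sup>2 D\<^sup>3\<close> exceeds a small power of \<open>x\<close>; the last condition is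
  where the exponent \<open>1/3\<close> comes from (\<open>separated_points_far_from_smooth\<close>).

  The smooth numbers used are the products of one integer \<open>l\<close> and of \<open>m + j\<close> primes from a dyadic interval,
  all of them below a small fixed power of \<open>x\<close>. They are counted near the points \<open>\<tau>\<close> with a Gaussian
  weight of a width \<open>h < D\<close>, and the count is compared with the one for a much larger
  width \<open>H\<close>. The first count is negligible by assumption. The second one is as large as expected, because
  \<open>l\<close> runs through all integers of a long interval. By Fourier inversion their difference is an
  integral over \<open>t\<close> of \<open>L(t) P(t)\<^sup>m P(t)\<^sup>j G(t)\<close>, where \<open>L\<close>, \<open>P\<close> and \<open>G\<close> are the sums of \<open>l\<close> to the power
  \<open>i t\<close>, of \<open>p\<close> to the power \<open>i t\<close> and of \<open>exp (- i t \<tau>)\<close>, against a Gaussian measure of width \<open>1/h\<close> and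
  a factor that is small for small \<open>t\<close> (\<open>detection_inequality\<close>). For the other \<open>t\<close>, van der Corput's
  method saves a power of \<open>x\<close> in \<open>L(t)\<close> (\<open>sum_cis_log_power_saving\<close>). So the sum over \<open>l\<close> pays for all
  logarithms and constants, and after the Cauchy-Schwarz inequality it remains to have sharp
  bounds for the mean squares of \<open>P\<^sup>m\<close> and of \<open>P\<^sup>j G\<close>.

  The first one is routine once \<open>P\<^sup>m\<close> has length \<open>1/h\<close>. The second one is the heart of the proof
  (\<open>weighted_prime_power_moment\<close>). It counts pairs of products \<open>a\<close>, \<open>b\<close> of \<open>j\<close> primes and pairs of points
  with \<open>a/b\<close> within a factor \<open>exp h\<close> of \<open>exp (\<tau> - \<tau>')\<close>. Pairs with coprime \<open>a\<close>, \<open>b\<close> give reduced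
  fractions, which are well spaced; so they contribute \<open>O(R\<^sup>2 (1 + h N\<^sup>2))\<close>, where \<open>N\<close> is the length of
  \<open>P\<^sup>j\<close>. If \<open>a\<close> and \<open>b\<close> share a prime, it can be cancelled, which bounds the remaining pairs by
  \<open>j\<^sup>2 \<bar>Q\<bar>\<close> times the same moment with \<open>j - 1\<close> in place of \<open>j\<close>, where \<open>Q\<close> is the set of primes. Both
  moments are integrals of powers of the same function, so the pointwise inequality
  \<open>u ^ k \<le> u ^ (k + 1) / c + c ^ k\<close> with \<open>c = 2 j\<^sup>2 \<bar>Q\<bar>\<close> absorbs half of the \<open>j\<close>-th moment and leaves \<open>c\<^sup>j\<close> times
  the moment for \<open>j = 0\<close>. The result \<open>O(R\<^sup>2 h N\<^sup>2 + R N)\<close> (if \<open>h N\<^sup>2 \<ge> 1\<close>) is what independence would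
  predict, for an arbitrary set of points. With the power saving from \<open>L\<close> it forces \<open>R h N\<close> to be
  bounded by a power of \<open>ln x\<close>, and since \<open>N\<close> is nearly \<open>X h\<close>, this is the claim.
\<close>

section \<open>Van der Corput's method\<close>

definition fdiff :: "(nat \<Rightarrow> real) \<Rightarrow> nat \<Rightarrow> real" where
  "fdiff f n = f (Suc n) - f n"

text \<open>
  Only values below \<open>N\<close> are compared, so that the property passes to the shorter sums that
  differencing produces.
\<close>

definition monotone_below :: "nat \<Rightarrow> (nat \<Rightarrow> real) \<Rightarrow> bool" where
  "monotone_below N g \<longleftrightarrow>
     (\<forall>n. Suc n < N \<longrightarrow> g n \<le> g (Suc n)) \<or> (\<forall>n. Suc n < N \<longrightarrow> g (Suc n) \<le> g n)"

lemma sum_abs_diff_monotone: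
  assumes "monotone_below (Suc N) g"
  shows "(\<Sum>n<N. \<bar>g (Suc n) - g n\<bar>) = \<bar>g N - g 0\<bar>"
proof -
  consider "\<forall>n<N. g n \<le> g (Suc n)" | "\<forall>n<N. g (Suc n) \<le> g n"
    using assms unfolding monotone_below_def by auto
  then show ?thesis
  proof cases
    case 1
    have "(\<Sum>n<N. \<bar>g (Suc n) - g n\<bar>) = (\<Sum>n<N. g (Suc n) - g n)"
      by (rule sum.cong) (use 1 in auto)
    also have "\<dots> = g N - g 0" by (rule sum_lessThan_telescope)
    finally have *: "(\<Sum>n<N. \<bar>g (Suc n) - g n\<bar>) = g N - g 0" .
    moreover have "0 \<le> (\<Sum>n<N. \<bar>g (Suc n) - g n\<bar>)" by (rule sum_nonneg) auto
    ultimately show ?thesis by simp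
  next
    case 2
    have "(\<Sum>n<N. \<bar>g (Suc n) - g n\<bar>) = (\<Sum>n<N. g n - g (Suc n))"
      by (rule sum.cong) (use 2 in auto)
    also have "\<dots> = g 0 - g N" by (rule sum_lessThan_telescope')
    finally have *: "(\<Sum>n<N. \<bar>g (Suc n) - g n\<bar>) = g 0 - g N" .
    moreover have "0 \<le> (\<Sum>n<N. \<bar>g (Suc n) - g n\<bar>)" by (rule sum_nonneg) auto
    ultimately show ?thesis by simp
  qed
qed

text \<open>
  Summation by parts. The boundary term at \<open>N\<close> is kept inside the norm, since this makes
  the induction step the addition of a single term.
\<close>

lemma norm_sum_by_parts:
  fixes z :: "nat \<Rightarrow> complex"
  assumes "\<And>n. norm (z n) \<le> 1"
  shows "norm ((\<Sum>n<Suc N. of_real (g n) * (z n - z (Suc n))) + of_real (g N) * z (Suc N))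
           \<le> \<bar>g 0\<bar> + (\<Sum>n<N. \<bar>g (Suc n) - g n\<bar>)"
proof (induction N)
  case 0
  have "of_real (g 0) * (z 0 - z (Suc 0)) + of_real (g 0) * z (Suc 0) = of_real (g 0) * z 0"
    by (simp add: algebra_simps)
  then show ?case using mult_left_mono[OF assms[of 0], of "\<bar>g 0\<bar>"] by (simp add: norm_mult)
next
  case (Suc N)
  let ?S = "\<lambda>N. (\<Sum>n<Suc N. of_real (g n) * (z n - z (Suc n))) + of_real (g N) * z (Suc N)"
  have eq: "?S (Suc N) = ?S N + of_real (g (Suc N) - g N) * z (Suc N)"
    by (simp add: algebra_simps)
  have "norm (?S (Suc N)) \<le> norm (?S N) + norm (of_real (g (Suc N) - g N) * z (Suc N))"
    unfolding eq by (rule norm_triangle_ineq)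
  also have "norm (of_real (g (Suc N) - g N) * z (Suc N)) \<le> \<bar>g (Suc N) - g N\<bar> * 1"
    unfolding norm_mult norm_of_real using assms[of "Suc N"] by (intro mult_left_mono) auto
  finally show ?case using Suc by simp
qed

text \<open>
  This writes \<open>z\<^sub>n = (z\<^sub>n - z\<^sub>n\<^sub>+\<^sub>1) / (1 - cis d)\<close> with a multiplier whose real part is
  constant and whose imaginary part is monotone in \<open>d\<close>, as partial summation needs.
\<close>

lemma one_minus_cis_inverse:
  assumes "0 < d" "d < pi"
  shows "(1 - cis d) * (1/2 + \<i>/2 * of_real (cot (d/2))) = 1"
proof -
  have s: "sin (d/2) > 0" using assms by (intro sin_gt_zero) auto
  have c: "cos d = 1 - 2 * sin (d/2)^2" "sin d = 2 * sin (d/2) * cos (d/2)"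
    using cos_double_sin[of "d/2"] sin_double[of "d/2"] by auto
  have "cos (d/2) * (cos (d/2) * sin (d/2)) + sin (d/2) * (sin (d/2) * sin (d/2))
      = sin (d/2) * (sin (d/2)^2 + cos (d/2)^2)" unfolding power2_eq_square by algebra
  then have e: "cos (d/2) * (cos (d/2) * sin (d/2)) + sin (d/2) * (sin (d/2) * sin (d/2)) = sin (d/2)"
    by simp
  show ?thesis
  proof (rule complex_eqI)
    show "Re ((1 - cis d) * (1/2 + \<i>/2 * of_real (cot (d/2)))) = Re 1"
      using s e by (simp add: cot_def c power2_eq_square field_simps)
    show "Im ((1 - cis d) * (1/2 + \<i>/2 * of_real (cot (d/2)))) = Im 1"
      using s e by (simp add: cot_def c power2_eq_square field_simps)
  qed
qed

lemma cot_le_inverse: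
  fixes y :: real
  assumes "0 < y" "y < pi/2"
  shows "0 \<le> cot y" "cot y \<le> 1 / y"
proof -
  have s: "sin y > 0" and c: "cos y > 0"
    using assms by (auto intro!: sin_gt_zero cos_gt_zero)
  show "0 \<le> cot y" using s c by (simp add: cot_def)
  have "arctan (tan y) \<le> tan y"
    using assms by (intro arctan_le_self less_imp_le tan_gt_zero) auto
  moreover have "arctan (tan y) = y" using assms by (intro arctan_tan) auto
  moreover have "cot y = 1 / tan y" by (simp add: cot_def tan_def)
  ultimately show "cot y \<le> 1 / y" using assms by (simp add: frac_le)
qed

lemma cot_antimono:
  fixes x y :: real
  assumes "0 < x" "x \<le> y" "y < pi/2"
  shows "cot y \<le> cot x"
proof -
  have "tan x \<le> tan y" using assms by (intro tan_mono_le) auto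
  moreover have "tan x > 0" using assms by (intro tan_gt_zero) auto
  moreover have "cot y = 1 / tan y" "cot x = 1 / tan x" by (simp_all add: cot_def tan_def)
  ultimately show ?thesis by (simp add: frac_le)
qed

text \<open>
  Consecutive terms differ by rotations through angles between \<open>lam\<close> and \<open>1\<close>, so each term is a
  multiple of a difference \<open>z\<^sub>n - z\<^sub>n\<^sub>+\<^sub>1\<close>, with a multiplier of size \<open>O(1/lam)\<close>. As the
  angles are monotone, the multipliers have total variation \<open>O(1/lam)\<close>, and summation by parts applies.
\<close>

lemma Kusmin_Landau:
  assumes lam: "0 < lam" and range: "\<And>n. n < N \<Longrightarrow> lam \<le> fdiff f n \<and> fdiff f n \<le> 1"
    and mono: "monotone_below N (fdiff f)"
  shows "norm (\<Sum>n<N. cis (f n)) \<le> 4 / lam"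
proof (cases N)
  case 0
  then show ?thesis using lam by simp
next
  case (Suc M)
  have lam1: "lam \<le> 1" using range[of 0] Suc by auto
  define g where "g = (\<lambda>n. cot (fdiff f n / 2))"
  define z where "z = (\<lambda>n. cis (f n))"
  have d: "0 < fdiff f n / 2" "fdiff f n / 2 < pi / 2" if "n \<le> M" for n
    using range[of n] that Suc lam pi_gt3 by auto
  have g: "0 \<le> g n \<and> g n \<le> 2 / lam" if "n \<le> M" for n
  proof -
    have "1 / (fdiff f n / 2) \<le> 2 / lam" using range[of n] that Suc lam by (simp add: frac_le)
    then show ?thesis using cot_le_inverse[OF d[OF that]] unfolding g_def by simp
  qed
  have "monotone_below (Suc M) g"
  proof -
    have *: "n \<le> M \<and> Suc n \<le> M" if "Suc n < N" for n using that Suc by auto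
    have "(\<forall>n. Suc n < N \<longrightarrow> g (Suc n) \<le> g n) \<or> (\<forall>n. Suc n < N \<longrightarrow> g n \<le> g (Suc n))"
      using mono unfolding monotone_below_def g_def
      by (intro disj_forward[OF mono[unfolded monotone_below_def]] allI impI cot_antimono)
         (use d * in auto)
    then show ?thesis using Suc unfolding monotone_below_def by auto
  qed
  note tv = sum_abs_diff_monotone[OF this]
  have split: "z n = (1/2) * (z n - z (Suc n)) + (\<i>/2) * (of_real (g n) * (z n - z (Suc n)))"
    if "n < N" for n
  proof -
    have zS: "z (Suc n) = z n * cis (fdiff f n)"
      unfolding z_def by (simp add: cis_mult fdiff_def)
    have "z n = z n * ((1 - cis (fdiff f n)) * (1/2 + \<i>/2 * of_real (g n)))"
      using one_minus_cis_inverse[of "fdiff f n"] d[of n] that Suc unfolding g_def by simp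
    also have "\<dots> = (z n - z (Suc n)) * (1/2 + \<i>/2 * of_real (g n))"
      unfolding zS by (metis mult.assoc mult.right_neutral right_diff_distrib)
    also have "\<dots> = (1/2) * (z n - z (Suc n)) + (\<i>/2) * (of_real (g n) * (z n - z (Suc n)))"
      by (simp only: distrib_left mult_ac)
    finally show ?thesis .
  qed
  let ?T = "\<Sum>n<N. of_real (g n) * (z n - z (Suc n))"
  have "(\<Sum>n<N. z n) = (\<Sum>n<N. (1/2) * (z n - z (Suc n)) + (\<i>/2) * (of_real (g n) * (z n - z (Suc n))))"
    by (rule sum.cong[OF refl]) (use split in auto)
  also have "\<dots> = (1/2) * (\<Sum>n<N. z n - z (Suc n)) + (\<i>/2) * ?T"
    by (simp add: sum.distrib sum_distrib_left)
  also have "(\<Sum>n<N. z n - z (Suc n)) = z 0 - z N" by (rule sum_lessThan_telescope')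
  finally have "norm (\<Sum>n<N. z n) \<le> norm ((1/2) * (z 0 - z N)) + norm ((\<i>/2) * ?T)"
    using norm_triangle_ineq[of "(1/2) * (z 0 - z N)" "(\<i>/2) * ?T"] by (simp only:)
  moreover have "norm ((1/2) * (z 0 - z N)) \<le> 1"
    using norm_triangle_ineq4[of "z 0" "z N"] by (simp add: norm_mult z_def)
  moreover have "norm ((\<i>/2) * ?T) = norm ?T / 2" by (simp add: norm_mult)
  moreover have "norm ?T \<le> 6 / lam"
  proof -
    have "norm (?T + of_real (g M) * z N) \<le> \<bar>g 0\<bar> + (\<Sum>n<M. \<bar>g (Suc n) - g n\<bar>)"
      using norm_sum_by_parts[of z g M] Suc by (simp add: z_def)
    also have "\<dots> \<le> 2 / lam + 2 / lam"
      unfolding tv using g[of 0] g[of M] by (intro add_mono) auto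
    finally have "norm (?T + of_real (g M) * z N) \<le> 4 / lam" by simp
    moreover have "norm (of_real (g M) * z N) \<le> 2 / lam" using g[of M] by (simp add: norm_mult z_def)
    moreover have "norm ?T \<le> norm (?T + of_real (g M) * z N) + norm (of_real (g M) * z N)"
      using norm_triangle_ineq4[of "?T + of_real (g M) * z N" "of_real (g M) * z N"] by simp
    ultimately have "norm ?T \<le> 4 / lam + 2 / lam" by linarith
    then show ?thesis by (simp add: add_divide_distrib[symmetric])
  qed
  ultimately have "norm (\<Sum>n<N. z n) \<le> 1 + norm ?T / 2" "norm ?T \<le> 6 / lam" by auto
  then have "norm (\<Sum>n<N. z n) \<le> 1 + 3 / lam" by simp
  also have "\<dots> \<le> 4 / lam" using lam lam1 by (simp add: field_simps)
  finally show ?thesis unfolding z_def .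
qed

text \<open>
  Weyl differencing. Averaging the sum over \<open>H\<close> shifts and applying the Cauchy-Schwarz
  inequality leaves correlations of \<open>z\<close> with its translates. The sequence is extended by zero, so
  that no boundary terms occur.
\<close>

lemma van_der_Corput_inequality:
  fixes z :: "nat \<Rightarrow> complex"
  assumes H: "H \<ge> 1"
  shows "(norm (\<Sum>n<N. z n))\<^sup>2 \<le>
    2 * (real N + real H) / real H * (\<Sum>d<H. norm (\<Sum>n<N - d. z (n + d) * cnj (z n)))"
proof -
  define w where "w = (\<lambda>i. if H \<le> i \<and> i < N + H then z (i - H) else 0)"
  define S where "S = (\<lambda>d. norm (\<Sum>n<N - d. z (n + d) * cnj (z n)))"
  let ?I = "{..<N+H}"
  define s where "s = (\<Sum>n<N. z n)"
  have shift: "(\<Sum>m\<in>?I. w (m + h + 1)) = s" if "h < H" for h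
  proof -
    have "(\<Sum>m\<in>?I. w (m + h + 1)) = (\<Sum>m\<in>{H - h - 1..<N + H - h - 1}. w (m + h + 1))"
      by (rule sum.mono_neutral_right) (use that in \<open>auto simp: w_def\<close>)
    also have "\<dots> = s" unfolding s_def
      by (rule sum.reindex_bij_witness[of _ "\<lambda>n. n + (H - h - 1)" "\<lambda>m. m - (H - h - 1)"])
         (use that in \<open>auto simp: w_def\<close>)
    finally show ?thesis .
  qed
  have corr_aux: "(\<Sum>m\<in>?I. w (m + a + d + 1) * cnj (w (m + a + 1)))
       = (\<Sum>n<N - d. z (n + d) * cnj (z n))" if "a + d < H" for a d
  proof -
    have "(\<Sum>m\<in>?I. w (m + a + d + 1) * cnj (w (m + a + 1)))
        = (\<Sum>m\<in>{H - a - 1..<N + H - d - a - 1}. w (m + a + d + 1) * cnj (w (m + a + 1)))"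
      by (rule sum.mono_neutral_right) (use that in \<open>auto simp: w_def\<close>)
    also have "\<dots> = (\<Sum>n<N - d. z (n + d) * cnj (z n))"
    proof (rule sum.reindex_bij_witness[of _ "\<lambda>n. n + (H - a - 1)" "\<lambda>m. m - (H - a - 1)"])
      fix n assume "n \<in> {..<N - d}"
      then show "n + (H - a - 1) \<in> {H - a - 1..<N + H - d - a - 1}" using that by auto
    next
      fix m assume m: "m \<in> {H - a - 1..<N + H - d - a - 1}"
      then show "m - (H - a - 1) + (H - a - 1) = m" by auto
      show "m - (H - a - 1) \<in> {..<N - d}" using m that by auto
      have e: "m + a + d + 1 - H = m - (H - a - 1) + d" "m + a + 1 - H = m - (H - a - 1)"
        using m that by auto
      have c: "H \<le> m + a + d + 1" "m + a + d + 1 < N + H" "H \<le> m + a + 1" "m + a + 1 < N + H"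
        using m that by auto
      show "z (m - (H - a - 1) + d) * cnj (z (m - (H - a - 1)))
          = w (m + a + d + 1) * cnj (w (m + a + 1))"
        using c e by (auto simp: w_def simp del: One_nat_def)
    qed auto
    finally show ?thesis .
  qed
  have corr: "norm (\<Sum>m\<in>?I. w (m + h + 1) * cnj (w (m + h' + 1))) \<le> S (if h' \<le> h then h - h' else h' - h)"
    if "h < H" "h' < H" for h h'
  proof (cases "h' \<le> h")
    case True
    then show ?thesis using corr_aux[of h' "h - h'"] that
      by (simp add: S_def add.assoc)
  next
    case False
    have "(\<Sum>m\<in>?I. w (m + h + 1) * cnj (w (m + h' + 1)))
        = cnj (\<Sum>m\<in>?I. w (m + h + (h' - h) + 1) * cnj (w (m + h + 1)))"
    proof -
      have e: "m + h + (h' - h) + 1 = m + h' + 1" for m using False by auto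
      show ?thesis unfolding cnj_sum e by (rule sum.cong[OF refl]) simp
    qed
    also have "norm \<dots> = S (h' - h)"
      unfolding complex_mod_cnj S_def using corr_aux[of h "h' - h"] that False by simp
    finally show ?thesis using False by simp
  qed
  have "(real H)\<^sup>2 * (norm s)\<^sup>2 = (norm (\<Sum>h<H. \<Sum>m\<in>?I. w (m + h + 1)))\<^sup>2"
  proof -
    have "(\<Sum>h<H. \<Sum>m\<in>?I. w (m + h + 1)) = (\<Sum>h<H. s)"
      by (rule sum.cong[OF refl]) (rule shift, simp)
    also have "\<dots> = of_nat H * s" by simp
    finally have "norm (\<Sum>h<H. \<Sum>m\<in>?I. w (m + h + 1)) = real H * norm s"
      by (simp only: norm_mult norm_of_nat)
    then show ?thesis by (simp only: power_mult_distrib)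
  qed
  also have "(\<Sum>h<H. \<Sum>m\<in>?I. w (m + h + 1)) = (\<Sum>m\<in>?I. \<Sum>h<H. w (m + h + 1))"
    by (rule sum.swap)
  also have "(norm (\<Sum>m\<in>?I. \<Sum>h<H. w (m + h + 1)))\<^sup>2 \<le> (\<Sum>m\<in>?I. norm (\<Sum>h<H. w (m + h + 1)))\<^sup>2"
    by (intro power_mono norm_sum) auto
  also have "\<dots> \<le> (\<Sum>m\<in>?I. 1\<^sup>2) * (\<Sum>m\<in>?I. (norm (\<Sum>h<H. w (m + h + 1)))\<^sup>2)"
    using Cauchy_Schwarz_ineq_sum[of "\<lambda>_. 1" "\<lambda>m. norm (\<Sum>h<H. w (m + h + 1))" ?I] by simp
  also have "(\<Sum>m\<in>?I. (1::real)\<^sup>2) = real N + real H" by simp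
  also have "(\<Sum>m\<in>?I. (norm (\<Sum>h<H. w (m + h + 1)))\<^sup>2)
      \<le> (\<Sum>h<H. \<Sum>h'<H. S (if h' \<le> h then h - h' else h' - h))"
  proof -
    have "complex_of_real (\<Sum>m\<in>?I. (norm (\<Sum>h<H. w (m + h + 1)))\<^sup>2)
       = (\<Sum>m\<in>?I. (\<Sum>h<H. w (m + h + 1)) * cnj (\<Sum>h<H. w (m + h + 1)))"
      by (simp only: of_real_sum complex_norm_square)
    also have "\<dots> = (\<Sum>m\<in>?I. \<Sum>h<H. \<Sum>h'<H. w (m + h + 1) * cnj (w (m + h' + 1)))"
      by (simp only: cnj_sum sum_product)
    also have "\<dots> = (\<Sum>h<H. \<Sum>m\<in>?I. \<Sum>h'<H. w (m + h + 1) * cnj (w (m + h' + 1)))"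
      by (rule sum.swap)
    also have "\<dots> = (\<Sum>h<H. \<Sum>h'<H. \<Sum>m\<in>?I. w (m + h + 1) * cnj (w (m + h' + 1)))"
      by (intro sum.cong refl sum.swap)
    finally have eq: "complex_of_real (\<Sum>m\<in>?I. (norm (\<Sum>h<H. w (m + h + 1)))\<^sup>2)
       = (\<Sum>h<H. \<Sum>h'<H. \<Sum>m\<in>?I. w (m + h + 1) * cnj (w (m + h' + 1)))" .
    have "(\<Sum>m\<in>?I. (norm (\<Sum>h<H. w (m + h + 1)))\<^sup>2)
       \<le> norm (complex_of_real (\<Sum>m\<in>?I. (norm (\<Sum>h<H. w (m + h + 1)))\<^sup>2))"
      by (subst norm_of_real) (rule abs_ge_self)
    also have "\<dots> \<le> (\<Sum>h<H. \<Sum>h'<H. norm (\<Sum>m\<in>?I. w (m + h + 1) * cnj (w (m + h' + 1))))"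
      unfolding eq by (intro order_trans[OF norm_sum] sum_mono norm_sum)
    also have "\<dots> \<le> (\<Sum>h<H. \<Sum>h'<H. S (if h' \<le> h then h - h' else h' - h))"
      by (intro sum_mono corr) auto
    finally show ?thesis .
  qed
  also have "(\<Sum>h<H. \<Sum>h'<H. S (if h' \<le> h then h - h' else h' - h)) \<le> (\<Sum>h<H. 2 * (\<Sum>d<H. S d))"
  proof (intro sum_mono)
    fix h assume "h \<in> {..<H}"
    then have h: "h < H" by simp
    have S0: "S d \<ge> 0" for d by (simp add: S_def)
    have "(\<Sum>h'<H. S (if h' \<le> h then h - h' else h' - h))
       = (\<Sum>h'\<in>{..h}. S (h - h')) + (\<Sum>h'\<in>{h<..<H}. S (h' - h))"
    proof -
      have U: "{..<H} = {..h} \<union> {h<..<H}" using h by auto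
      have "(\<Sum>h'<H. S (if h' \<le> h then h - h' else h' - h))
        = (\<Sum>h'\<in>{..h}. S (if h' \<le> h then h - h' else h' - h))
          + (\<Sum>h'\<in>{h<..<H}. S (if h' \<le> h then h - h' else h' - h))"
        by (subst U, rule sum.union_disjoint) auto
      then show ?thesis by simp
    qed
    also have "(\<Sum>h'\<in>{..h}. S (h - h')) = (\<Sum>d\<in>{..h}. S d)"
      by (rule sum.reindex_bij_witness[of _ "\<lambda>d. h - d" "\<lambda>d. h - d"]) auto
    also have "\<dots> \<le> (\<Sum>d<H. S d)" using h S0 by (intro sum_mono2) auto
    also have "(\<Sum>h'\<in>{h<..<H}. S (h' - h)) = (\<Sum>d\<in>{0<..<H - h}. S d)"
      by (rule sum.reindex_bij_witness[of _ "\<lambda>d. d + h" "\<lambda>d. d - h"]) auto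
    also have "\<dots> \<le> (\<Sum>d<H. S d)" using S0 by (intro sum_mono2) auto
    finally show "(\<Sum>h'<H. S (if h' \<le> h then h - h' else h' - h)) \<le> 2 * (\<Sum>d<H. S d)" by simp
  qed
  also have "(\<Sum>h<H. 2 * (\<Sum>d<H. S d)) = real H * (2 * (\<Sum>d<H. S d))" by simp
  finally have "(real H)\<^sup>2 * (norm s)\<^sup>2 \<le> (real N + real H) * (real H * (2 * (\<Sum>d<H. S d)))"
    by (simp add: mult_left_mono)
  then have "real H * (real H * (norm s)\<^sup>2) \<le> real H * (2 * (real N + real H) * (\<Sum>d<H. S d))"
    by (simp add: power2_eq_square algebra_simps)
  then have "real H * (norm s)\<^sup>2 \<le> 2 * (real N + real H) * (\<Sum>d<H. S d)"
    using H by (subst (asm) mult_le_cancel_left_pos) auto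
  then show ?thesis using H unfolding s_def[symmetric] S_def[symmetric] by (simp add: field_simps)
qed

lemma fdiff_funpow_shift: "(fdiff ^^ k) (\<lambda>n. f (n + d)) n = (fdiff ^^ k) f (n + d)"
  by (induction k arbitrary: n) (simp_all add: fdiff_def)

lemma fdiff_funpow_diff: "(fdiff ^^ k) (\<lambda>n. f n - g n) n = (fdiff ^^ k) f n - (fdiff ^^ k) g n"
  by (induction k arbitrary: n) (simp_all add: fdiff_def)

lemma fdiff_funpow_cmult: "(fdiff ^^ k) (\<lambda>n. c * f n) n = c * (fdiff ^^ k) f n"
  by (induction k arbitrary: n) (simp_all add: fdiff_def algebra_simps)

text \<open>
  Differencing at distance \<open>d\<close> turns a difference of order \<open>Suc k\<close> into one of order \<open>k\<close> and
  multiplies its size by \<open>d\<close>. This is what drives the induction on the order below.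
\<close>

lemma fdiff_funpow_increment:
  "(fdiff ^^ k) (\<lambda>n. f (n + d) - f n) n = (\<Sum>i<d. (fdiff ^^ Suc k) f (n + i))"
proof -
  have "(\<Sum>i<d. (fdiff ^^ Suc k) f (n + i)) = (\<Sum>i<d. (fdiff ^^ k) f (n + Suc i) - (fdiff ^^ k) f (n + i))"
    by (simp add: fdiff_def)
  also have "\<dots> = (fdiff ^^ k) f (n + d) - (fdiff ^^ k) f n"
    using sum_lessThan_telescope[of "\<lambda>i. (fdiff ^^ k) f (n + i)" d] by simp
  finally show ?thesis by (simp add: fdiff_funpow_diff fdiff_funpow_shift)
qed

lemma monotone_below_increment:
  assumes "monotone_below N ((fdiff ^^ Suc k) f)"
  shows "monotone_below (N - d) ((fdiff ^^ k) (\<lambda>n. f (n + d) - f n))"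
  using assms unfolding monotone_below_def fdiff_funpow_increment
  by (elim disj_forward) (auto intro!: sum_mono)

text \<open>
  A discrete and qualitative form of the \<open>k\<close>-th derivative test: differences play the role of
  derivatives. The induction on the order trades one difference for a factor \<open>d \<le> H\<close> in its size,
  until \<open>Kusmin_Landau\<close> applies. With \<open>H = Y powr s\<close> the size \<open>lam\<close> grows by a factor close to
  \<open>Y powr s\<close> for most \<open>d\<close>; so every range with \<open>0 < u\<close> and \<open>l < 1 + u\<close> can be moved into the range \<open>l < 1\<close>
  of the base case.
\<close>

lemma van_der_Corput_derivative_test:
  fixes alpha l u :: real
  assumes "alpha \<ge> 1" "0 < u" "u \<le> 1" "if k = 0 then l < 1 else l < 1 + u"
  shows "\<exists>B>0. \<exists>\<delta>>0. \<forall>Y\<ge>1. \<forall>N lam f. real N \<le> Y \<longrightarrow> Y powr (-l) \<le> lam \<longrightarrow> lam \<le> Y powr (-u) \<longrightarrow>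
     (\<forall>n<N. lam \<le> (fdiff ^^ Suc k) f n \<and> (fdiff ^^ Suc k) f n \<le> alpha * lam) \<longrightarrow>
     monotone_below N ((fdiff ^^ Suc k) f) \<longrightarrow>
     norm (\<Sum>n<N. cis (f n)) \<le> B * Y powr (1 - \<delta>)"
  using assms
proof (induction k arbitrary: l u)
  case 0
  then have l: "l < 1" by simp
  \<comment> \<open>For \<open>Y \<ge> Y0\<close> the differences are at most \<open>1\<close>; below \<open>Y0\<close> the trivial bound is a constant.\<close>
  define Y0 where "Y0 = alpha powr (1 / u)"
  define B where "B = 4 + Y0 powr (max 0 l + 1)"
  define d where "d = min (1 - l) (1 / 2)"
  show ?case
  proof (rule exI[of _ B], intro conjI exI[of _ d] allI impI)
    show "B > 0" unfolding B_def by (intro add_pos_nonneg) auto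
    show "d > 0" using l by (simp add: d_def)
  next
    fix Y lam :: real and N f
    assume Y: "Y \<ge> 1" and N: "real N \<le> Y" and lam: "Y powr (-l) \<le> lam" "lam \<le> Y powr (-u)"
      and f: "\<forall>n<N. lam \<le> (fdiff ^^ Suc 0) f n \<and> (fdiff ^^ Suc 0) f n \<le> alpha * lam"
      and m: "monotone_below N ((fdiff ^^ Suc 0) f)"
    have lam0: "lam > 0" using lam(1) Y by (smt (verit) powr_gt_zero)
    show "norm (\<Sum>n<N. cis (f n)) \<le> B * Y powr (1 - d)"
    proof (cases "Y \<ge> Y0")
      case True
      have "alpha * lam \<le> 1"
      proof -
        have "alpha = Y0 powr u" using 0 by (simp add: Y0_def powr_powr)
        also have "\<dots> \<le> Y powr u" using True 0 by (intro powr_mono2) (auto simp: Y0_def)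
        finally have "alpha * lam \<le> Y powr u * Y powr (-u)"
          using lam lam0 0 by (intro mult_mono) auto
        then show ?thesis using Y by (simp flip: powr_add)
      qed
      then have "norm (\<Sum>n<N. cis (f n)) \<le> 4 / lam"
        using f m lam0 by (intro Kusmin_Landau) force+
      also have "\<dots> \<le> 4 / Y powr (-l)" using lam lam0 Y by (intro divide_left_mono) auto
      also have "\<dots> = 4 * Y powr l" by (simp add: powr_minus divide_inverse)
      also have "\<dots> \<le> 4 * Y powr (1 - d)" using Y by (intro mult_left_mono powr_mono) (auto simp: d_def)
      also have "\<dots> \<le> B * Y powr (1 - d)" by (intro mult_right_mono) (auto simp: B_def)
      finally show ?thesis .
    next
      case False
      have "norm (\<Sum>n<N. cis (f n)) \<le> (\<Sum>n<N. norm (cis (f n)))" by (rule norm_sum)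
      also have "\<dots> \<le> Y" using N by simp
      also have "\<dots> \<le> Y0 powr 1 * 1" using False Y by simp
      also have "\<dots> \<le> B * Y powr (1 - d)"
      proof (intro mult_mono)
        have "Y0 powr 1 \<le> Y0 powr (max 0 l + 1)" using False Y by (intro powr_mono) auto
        then show "Y0 powr 1 \<le> B" by (simp add: B_def)
        show "1 \<le> Y powr (1 - d)" using Y by (intro ge_one_powr_ge_zero) (auto simp: d_def)
      qed (auto simp: B_def add_nonneg_nonneg)
      finally show ?thesis .
    qed
  qed
next
  case (Suc k)
  have u: "0 < u" "u \<le> 1" and l: "l < 1 + u" and al: "alpha \<ge> 1" using Suc.prems by auto
  \<comment> \<open>The number of shifts is \<open>Y powr s\<close>. Here \<open>s < u\<close> keeps the new differences below \<open>1\<close>, and \<open>s > l - 1\<close>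
    makes those with \<open>d \<ge> Y powr (s - e)\<close> exceed \<open>Y powr (- l')\<close> with \<open>l' < 1\<close>; the smaller \<open>d\<close> are rare.\<close>
  define s where "s = (max 0 (l - 1) + u) / 2"
  define e where "e = min s (s - (l - 1)) / 2"
  have s: "0 < s" "s < u" "l - 1 < s" using u l by (auto simp: s_def max_def field_simps)
  have e: "0 < e" "e \<le> s / 2" "e \<le> (s - (l - 1)) / 2" using s by (auto simp: e_def min_def field_simps)
  define l' u' where "l' = l - s + e" and "u' = u - s"
  have lu': "0 < u'" "u' \<le> 1" "l' < 1" "if k = 0 then l' < 1 else l' < 1 + u'"
    using s e u by (auto simp: l'_def u'_def field_simps)
  obtain B' d' where B': "B' > 0" "d' > 0" and IH: "\<And>Y N lam f. Y \<ge> 1 \<Longrightarrow> real N \<le> Y \<Longrightarrow> Y powr (-l') \<le> lam \<Longrightarrow> lam \<le> Y powr (-u') \<Longrightarrow>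
     (\<And>n. n < N \<Longrightarrow> lam \<le> (fdiff ^^ Suc k) f n \<and> (fdiff ^^ Suc k) f n \<le> alpha * lam) \<Longrightarrow>
     monotone_below N ((fdiff ^^ Suc k) f) \<Longrightarrow>
     norm (\<Sum>n<N. cis (f n)) \<le> B' * Y powr (1 - d')"
    using Suc.IH[OF al lu'(1,2,4)] by blast
  define d where "d = min e d' / 2"
  define B where "B = sqrt (16 + 8 * B')"
  show ?case
  proof (rule exI[of _ B], intro conjI exI[of _ d] allI impI)
    show "B > 0" using B' by (simp add: B_def)
    show "d > 0" using e B' by (simp add: d_def)
  next
    fix Y lam :: real and N f
    assume Y: "Y \<ge> 1" and N: "real N \<le> Y" and lam: "Y powr (-l) \<le> lam" "lam \<le> Y powr (-u)"
      and f: "\<forall>n<N. lam \<le> (fdiff ^^ Suc (Suc k)) f n \<and> (fdiff ^^ Suc (Suc k)) f n \<le> alpha * lam"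
      and m: "monotone_below N ((fdiff ^^ Suc (Suc k)) f)"
    have lam0: "lam > 0" using lam(1) Y by (smt (verit) powr_gt_zero)
    define H where "H = nat \<lfloor>Y powr s\<rfloor>"
    have Ys1: "Y powr s \<ge> 1" using Y s by (intro ge_one_powr_ge_zero) auto
    have H1: "H \<ge> 1" using Ys1 unfolding H_def by linarith
    have H2: "real H \<le> Y powr s" "Y powr s \<le> 2 * real H"
    proof -
      show "real H \<le> Y powr s" using Ys1 unfolding H_def by linarith
      have "Y powr s < real H + 1" unfolding H_def by linarith
      then show "Y powr s \<le> 2 * real H" using H1 by linarith
    qed
    have HY: "real H \<le> Y" using H2(1) powr_mono[of s 1 Y] s u Y by simp
    define S where "S = (\<lambda>d. norm (\<Sum>n<N - d. cis (f (n + d)) * cnj (cis (f n))))"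
    define z where "z = Y powr (s - e)"
    have z1: "z \<ge> 1" unfolding z_def using Y e s by (intro ge_one_powr_ge_zero) auto
    have S_triv: "S d \<le> Y" for d
    proof -
      have "S d \<le> (\<Sum>n<N - d. norm (cis (f (n + d)) * cnj (cis (f n))))"
        unfolding S_def by (rule norm_sum)
      also have "\<dots> \<le> real N" by (simp add: norm_mult)
      finally show ?thesis using N by simp
    qed
    have S_big: "S d \<le> B' * Y powr (1 - d')" if d: "z \<le> real d" "d < H" for d
    proof -
      have d0: "d > 0" using d z1 by (cases d) auto
      have "norm (\<Sum>n<N - d. cis (f (n + d) - f n)) \<le> B' * Y powr (1 - d')"
      proof (rule IH[where lam = "real d * lam"])
        show "Y \<ge> 1" "real (N - d) \<le> Y" using Y N by auto
        have "Y powr (-l') = z * Y powr (-l)" unfolding z_def l'_def by (simp add: algebra_simps flip: powr_add)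
        also have "\<dots> \<le> real d * lam" using d lam z1 by (intro mult_mono) auto
        finally show "Y powr (-l') \<le> real d * lam" .
        have "real d * lam \<le> Y powr s * Y powr (-u)" using d lam lam0 H2 by (intro mult_mono) auto
        also have "\<dots> = Y powr (-u')" unfolding u'_def by (simp add: algebra_simps flip: powr_add)
        finally show "real d * lam \<le> Y powr (-u')" .
        show "monotone_below (N - d) ((fdiff ^^ Suc k) (\<lambda>n. f (n + d) - f n))"
          using m by (rule monotone_below_increment)
        fix n assume n: "n < N - d"
        have "real d * lam = (\<Sum>i<d. lam)" by simp
        also have "\<dots> \<le> (\<Sum>i<d. (fdiff ^^ Suc (Suc k)) f (n + i))" using f n by (intro sum_mono) auto
        finally have 1: "real d * lam \<le> (fdiff ^^ Suc k) (\<lambda>n. f (n + d) - f n) n"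
          unfolding fdiff_funpow_increment .
        have "(\<Sum>i<d. (fdiff ^^ Suc (Suc k)) f (n + i)) \<le> (\<Sum>i<d. alpha * lam)" using f n by (intro sum_mono) auto
        also have "\<dots> = alpha * (real d * lam)" by simp
        finally have 2: "(fdiff ^^ Suc k) (\<lambda>n. f (n + d) - f n) n \<le> alpha * (real d * lam)"
          unfolding fdiff_funpow_increment .
        show "real d * lam \<le> (fdiff ^^ Suc k) (\<lambda>n. f (n + d) - f n) n \<and> (fdiff ^^ Suc k) (\<lambda>n. f (n + d) - f n) n \<le> alpha * (real d * lam)"
          using 1 2 by blast
      qed
      then show ?thesis unfolding S_def by (simp add: cis_cnj cis_mult)
    qed
    have "(\<Sum>d<H. S d) \<le> (\<Sum>d<H. (if real d < z then Y else 0) + B' * Y powr (1 - d'))"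
      using S_triv S_big B' Y by (intro sum_mono) (auto simp: not_less intro: add_increasing2)
    also have "\<dots> = (\<Sum>d<H. (if real d < z then Y else 0)) + real H * (B' * Y powr (1 - d'))"
      by (simp add: sum.distrib)
    also have "(\<Sum>d<H. (if real d < z then Y else 0)) = (\<Sum>d\<in>{d\<in>{..<H}. real d < z}. Y)"
      by (subst sum.inter_filter) auto
    also have "\<dots> = real (card {d\<in>{..<H}. real d < z}) * Y" by simp
    also have "\<dots> \<le> (2 * z) * Y"
    proof (intro mult_right_mono)
      have "{d\<in>{..<H}. real d < z} \<subseteq> {..nat \<lfloor>z\<rfloor>}" by (auto simp: le_nat_floor)
      then have "card {d\<in>{..<H}. real d < z} \<le> card {..nat \<lfloor>z\<rfloor>}" by (intro card_mono) auto
      also have "\<dots> = nat \<lfloor>z\<rfloor> + 1" by simp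
      finally show "real (card {d\<in>{..<H}. real d < z}) \<le> 2 * z" using z1 by linarith
    qed (use Y in auto)
    also have "real H * (B' * Y powr (1 - d')) \<le> Y powr s * (B' * Y powr (1 - d'))"
      using H2 B' by (intro mult_right_mono) auto
    finally have sumS: "(\<Sum>d<H. S d) \<le> 2 * z * Y + Y powr s * (B' * Y powr (1 - d'))" by simp
    have S0: "(\<Sum>d<H. S d) \<ge> 0" by (intro sum_nonneg) (auto simp: S_def)
    have "(norm (\<Sum>n<N. cis (f n)))\<^sup>2 \<le> 2 * (real N + real H) / real H * (\<Sum>d<H. S d)"
      using van_der_Corput_inequality[OF H1, of "\<lambda>n. cis (f n)" N] unfolding S_def .
    also have "\<dots> \<le> (8 * Y / Y powr s) * (\<Sum>d<H. S d)"
    proof (intro mult_right_mono S0)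
      have "2 * (real N + real H) / real H \<le> 4 * Y / (Y powr s / 2)"
        using N HY H1 H2 Ys1 Y by (intro frac_le) auto
      then show "2 * (real N + real H) / real H \<le> 8 * Y / Y powr s" by simp
    qed
    also have "\<dots> \<le> (8 * Y / Y powr s) * (2 * z * Y + Y powr s * (B' * Y powr (1 - d')))"
      using sumS Y by (intro mult_left_mono) auto
    also have "\<dots> = 16 * Y powr (2 - e) + 8 * B' * Y powr (2 - d')"
    proof -
      have 1: "Y / Y powr s * (z * Y) = Y powr (2 - e)"
      proof -
        have "Y / Y powr s * (z * Y) = Y powr 1 / Y powr s * (z * Y powr 1)" using Y by simp
        also have "\<dots> = Y powr (1 - s + ((s - e) + 1))"
          unfolding z_def by (simp only: powr_diff powr_add)
        finally show ?thesis by (simp add: algebra_simps)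
      qed
      have 2: "Y / Y powr s * (Y powr s * Y powr (1 - d')) = Y powr (2 - d')"
      proof -
        have "Y / Y powr s * (Y powr s * Y powr (1 - d')) = Y powr 1 / Y powr s * (Y powr s * Y powr (1 - d'))" using Y by simp
        also have "\<dots> = Y powr (1 - s + (s + (1 - d')))"
          by (simp only: powr_diff powr_add)
        finally show ?thesis by (simp add: algebra_simps)
      qed
      have "(8 * Y / Y powr s) * (2 * z * Y + Y powr s * (B' * Y powr (1 - d'))) =
        16 * (Y / Y powr s * (z * Y)) + 8 * B' * (Y / Y powr s * (Y powr s * Y powr (1 - d')))"
        by (simp add: algebra_simps)
      then show ?thesis unfolding 1 2 .
    qed
    also have "\<dots> \<le> 16 * Y powr (2 - 2 * d) + 8 * B' * Y powr (2 - 2 * d)"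
      using Y B' by (intro add_mono mult_left_mono powr_mono) (auto simp: d_def)
    also have "\<dots> = (B * Y powr (1 - d))\<^sup>2"
    proof -
      have "(Y powr (1 - d))\<^sup>2 = Y powr (2 - 2 * d)" by (simp add: power2_eq_square flip: powr_add)
      moreover have "B\<^sup>2 = 16 + 8 * B'" using B' by (simp add: B_def)
      ultimately show ?thesis by (simp add: power_mult_distrib distrib_right)
    qed
    finally have "norm (\<Sum>n<N. cis (f n)) \<le> \<bar>B * Y powr (1 - d)\<bar>"
      by (metis abs_le_square_iff abs_norm_cancel)
    then show "norm (\<Sum>n<N. cis (f n)) \<le> B * Y powr (1 - d)"
      using B' by (simp add: B_def)
  qed
qed

lemma fdiff_funpow_mean_value:
  fixes g :: "nat \<Rightarrow> real \<Rightarrow> real"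
  assumes "\<And>i x. x > 0 \<Longrightarrow> (g i has_real_derivative g (Suc i) x) (at x)" "c > 0"
  shows "\<exists>\<xi>. c + real n \<le> \<xi> \<and> \<xi> \<le> c + real n + real k \<and> (fdiff ^^ k) (\<lambda>n. g 0 (c + real n)) n = g k \<xi>"
  using assms(1)
proof (induction k arbitrary: g)
  case 0
  then show ?case by auto
next
  case (Suc k)
  define h where "h = (\<lambda>i x. g i (x + 1) - g i x)"
  have "(h i has_real_derivative h (Suc i) x) (at x)" if "x > 0" for i x
    unfolding h_def
    using Suc.prems[of x i] DERIV_shift[of "g i" "g (Suc i) (x + 1)" x 1] Suc.prems[of "x + 1" i] that
    by (intro DERIV_diff) auto
  from Suc.IH[of h, OF this] obtain \<xi> where \<xi>: "c + real n \<le> \<xi>" "\<xi> \<le> c + real n + real k"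
    "(fdiff ^^ k) (\<lambda>n. h 0 (c + real n)) n = h k \<xi>" by blast
  have "(fdiff ^^ Suc k) (\<lambda>n. g 0 (c + real n)) = (fdiff ^^ k) (fdiff (\<lambda>n. g 0 (c + real n)))"
    by (simp add: funpow_swap1)
  also have "fdiff (\<lambda>n. g 0 (c + real n)) = (\<lambda>n. h 0 (c + real n))"
    by (auto simp: fdiff_def h_def fun_eq_iff algebra_simps)
  finally have eq: "(fdiff ^^ Suc k) (\<lambda>n. g 0 (c + real n)) n = g k (\<xi> + 1) - g k \<xi>"
    using \<xi>(3) by (simp add: h_def)
  have "\<exists>z. z > \<xi> \<and> z < \<xi> + 1 \<and> g k (\<xi> + 1) - g k \<xi> = (\<xi> + 1 - \<xi>) * g (Suc k) z"
    using \<xi>(1) assms(2) by (intro MVT2 Suc.prems) auto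
  then obtain z where "z > \<xi>" "z < \<xi> + 1" "g k (\<xi> + 1) - g k \<xi> = g (Suc k) z" by auto
  then show ?case using eq \<xi> by (intro exI[of _ z]) auto
qed

lemma fdiff_funpow_ln:
  fixes a :: real
  assumes "a > 0"
  shows "\<exists>\<xi>. a + real n \<le> \<xi> \<and> \<xi> \<le> a + real n + real (Suc k) \<and>
    (fdiff ^^ Suc k) (\<lambda>n. ln (a + real n)) n = (-1) ^ k * fact k / \<xi> ^ Suc k"
proof -
  define g where "g = (\<lambda>i x::real. case i of 0 \<Rightarrow> ln x | Suc j \<Rightarrow> (-1) ^ j * fact j / x ^ Suc j)"
  have "(g i has_real_derivative g (Suc i) x) (at x)" if x: "x > 0" for i x
  proof (cases i)
    case 0
    then show ?thesis using x unfolding g_def by (auto intro!: derivative_eq_intros)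
  next
    case (Suc j)
    have "((\<lambda>x. x ^ Suc j) has_real_derivative real (Suc j) * x ^ j) (at x)"
      using DERIV_pow[of "Suc j" x] by simp
    then have "((\<lambda>x. inverse (x ^ Suc j)) has_real_derivative
        - (real (Suc j) * x ^ j * inverse ((x ^ Suc j) ^ Suc (Suc 0)))) (at x)"
      using x by (intro DERIV_inverse_fun) auto
    note D = DERIV_cmult[OF this, of "(-1) ^ j * fact j"]
    have "(-1) ^ j * fact j * - (real (Suc j) * x ^ j * inverse ((x ^ Suc j) ^ Suc (Suc 0)))
        = (-1) ^ Suc j * fact (Suc j) / x ^ Suc (Suc j)" using x by (simp add: field_simps)
    with D show ?thesis unfolding Suc g_def nat.case by (simp only: divide_inverse)
  qed
  from fdiff_funpow_mean_value[of g a n "Suc k", OF this assms] show ?thesis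
    by (auto simp: g_def)
qed

text \<open>
  For \<open>n\<close> of size \<open>a\<close> the differences of order \<open>k + 1\<close> of \<open>t * ln n\<close> have constant sign, are monotone, and
  have size \<open>\<bar>t\<bar> / a ^ (k + 1)\<close>; so the derivative test applies to the stated range of \<open>t\<close>. The exponents
  \<open>l'\<close> and \<open>u'\<close> differ from \<open>l\<close> and \<open>u\<close> only to make room for constants.
\<close>

lemma sum_cis_log_range:
  fixes t :: real
  assumes "C \<ge> 1" "0 < u" "u \<le> 1" "if k = 0 then l < 1 else l < 1 + u" "u < u'" "l' < l"
  shows "\<exists>\<delta>>0. \<forall>\<^sub>F a in sequentially. \<forall>t.
     real a powr (real (Suc k) - l') \<le> \<bar>t\<bar> \<longrightarrow> \<bar>t\<bar> \<le> real a powr (real (Suc k) - u') \<longrightarrow>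
     norm (\<Sum>n\<in>{a..<C * a}. cis (t * ln (real n))) \<le> real a powr (1 - \<delta>)"
proof -
  define c where "c = fact k / real (C + Suc k) ^ Suc k"
  define alpha where "alpha = real (C + Suc k) ^ Suc k"
  have alpha1: "alpha \<ge> 1" unfolding alpha_def by (intro one_le_power) auto
  have c0: "c > 0" by (simp add: c_def)
  obtain B d where B: "B > 0" and d: "d > 0" and main: "\<And>Y N lam f. Y \<ge> 1 \<Longrightarrow> real N \<le> Y \<Longrightarrow> Y powr (-l) \<le> lam \<Longrightarrow> lam \<le> Y powr (-u) \<Longrightarrow>
     (\<And>n. n < N \<Longrightarrow> lam \<le> (fdiff ^^ Suc k) f n \<and> (fdiff ^^ Suc k) f n \<le> alpha * lam) \<Longrightarrow>
     monotone_below N ((fdiff ^^ Suc k) f) \<Longrightarrow>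
     norm (\<Sum>n<N. cis (f n)) \<le> B * Y powr (1 - d)"
    using van_der_Corput_derivative_test[OF alpha1 assms(2-4)] by blast
  have ev1: "\<forall>\<^sub>F a in sequentially. (real C * real a) powr (-l) \<le> c * real a powr (-l')"
  proof -
    have C0: "real C > 0" using assms by simp
    show ?thesis using c0 C0 assms by real_asymp
  qed
  have ev2: "\<forall>\<^sub>F a in sequentially. c * real a powr (-u') \<le> (real C * real a) powr (-u)"
  proof -
    have C0: "real C > 0" using assms by simp
    show ?thesis using c0 C0 assms by real_asymp
  qed
  have ev3: "\<forall>\<^sub>F a in sequentially. B * (real C * real a) powr (1 - d) \<le> real a powr (1 - d / 2)"
  proof -
    have C0: "real C > 0" using assms by simp
    show ?thesis using B d C0 by real_asymp
  qed
  have "\<forall>\<^sub>F a in sequentially. \<forall>t.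
     real a powr (real (Suc k) - l') \<le> \<bar>t\<bar> \<longrightarrow> \<bar>t\<bar> \<le> real a powr (real (Suc k) - u') \<longrightarrow>
     norm (\<Sum>n\<in>{a..<C * a}. cis (t * ln (real n))) \<le> real a powr (1 - d / 2)"
    using ev1 ev2 ev3 eventually_ge_at_top[of 1]
  proof eventually_elim
    case (elim a)
    show ?case
    proof (intro allI impI)
      fix t :: real
      assume t: "real a powr (real (Suc k) - l') \<le> \<bar>t\<bar>" "\<bar>t\<bar> \<le> real a powr (real (Suc k) - u')"
      have a1: "real a \<ge> 1" using elim by simp
      define N where "N = C * a - a"
      \<comment> \<open>The sign makes the difference of order \<open>Suc k\<close> positive; conjugation shows that it does not affect the norm.\<close>
      define s where "s = \<bar>t\<bar> * (-1) ^ k"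
      define f where "f = (\<lambda>n. s * ln (real a + real n))"
      define lam where "lam = \<bar>t\<bar> * c / real a ^ Suc k"
      have t0: "\<bar>t\<bar> > 0" using t(1) a1 by (smt (verit) powr_gt_zero)
      have Ca: "C * a \<ge> a" using assms by simp
      have bounds: "\<exists>\<xi>. real a \<le> \<xi> \<and> \<xi> \<le> real (C + Suc k) * real a \<and>
          (fdiff ^^ Suc k) f n = \<bar>t\<bar> * fact k / \<xi> ^ Suc k" if n: "n < N" for n
      proof -
        obtain \<xi> where x: "real a + real n \<le> \<xi>" "\<xi> \<le> real a + real n + real (Suc k)"
          "(fdiff ^^ Suc k) (\<lambda>n. ln (real a + real n)) n = (-1) ^ k * fact k / \<xi> ^ Suc k"
          using fdiff_funpow_ln[of "real a" n k] a1 by auto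
        have "real a + real n \<le> real C * real a"
          using n unfolding N_def by (metis Ca le_add_diff_inverse less_imp_le nat_add_left_cancel_le of_nat_add of_nat_le_iff of_nat_mult)
        moreover have "real (Suc k) \<le> real (Suc k) * real a" using a1 by (simp add: mult_left_mono[of 1 "real a" "real (Suc k)", simplified] del: of_nat_Suc)
        moreover have "real (C + Suc k) * real a = real C * real a + real (Suc k) * real a"
          by (simp only: of_nat_add distrib_right)
        ultimately have "\<xi> \<le> real (C + Suc k) * real a" using x(2) by linarith
        moreover have "(fdiff ^^ Suc k) f n = \<bar>t\<bar> * fact k / \<xi> ^ Suc k"
        proof -
          have "(fdiff ^^ Suc k) f n = s * ((-1) ^ k * fact k / \<xi> ^ Suc k)"
            unfolding f_def fdiff_funpow_cmult x(3) ..
          also have "s * (-1) ^ k = \<bar>t\<bar>" by (simp add: s_def flip: power_add mult_2)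
          then have "s * ((-1) ^ k * fact k / \<xi> ^ Suc k) = \<bar>t\<bar> * fact k / \<xi> ^ Suc k"
            by (metis mult.assoc times_divide_eq_right)
          finally show ?thesis .
        qed
        ultimately show ?thesis using x(1) by (intro exI[of _ \<xi>]) auto
      qed
      have lam_c: "lam = \<bar>t\<bar> * fact k / (real (C + Suc k) * real a) ^ Suc k"
        unfolding lam_def c_def by (simp only: power_mult_distrib) (simp del: of_nat_Suc power_Suc of_nat_add)
      have alam: "alpha * lam = \<bar>t\<bar> * fact k / real a ^ Suc k"
        unfolding lam_def c_def alpha_def by (simp del: of_nat_Suc power_Suc of_nat_add)
      have range: "lam \<le> (fdiff ^^ Suc k) f n \<and> (fdiff ^^ Suc k) f n \<le> alpha * lam" if n: "n < N" for n
      proof -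
        obtain \<xi> where x: "real a \<le> \<xi>" "\<xi> \<le> real (C + Suc k) * real a"
          "(fdiff ^^ Suc k) f n = \<bar>t\<bar> * fact k / \<xi> ^ Suc k" using bounds[OF n] by blast
        have "lam \<le> \<bar>t\<bar> * fact k / \<xi> ^ Suc k" unfolding lam_c
          using x a1 by (intro divide_left_mono power_mono mult_pos_pos zero_less_power) auto
        moreover have "\<bar>t\<bar> * fact k / \<xi> ^ Suc k \<le> alpha * lam" unfolding alam
          using x a1 by (intro divide_left_mono power_mono mult_pos_pos zero_less_power) auto
        ultimately show ?thesis unfolding x(3) by blast
      qed
      have mono: "monotone_below N ((fdiff ^^ Suc k) f)"
      proof -
        have "(fdiff ^^ Suc k) f (Suc n) \<le> (fdiff ^^ Suc k) f n" for n
        proof -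
          obtain \<xi> where x: "real a + real n \<le> \<xi>"
            "(fdiff ^^ Suc (Suc k)) (\<lambda>n. ln (real a + real n)) n = (-1) ^ Suc k * fact (Suc k) / \<xi> ^ Suc (Suc k)"
            using fdiff_funpow_ln[of "real a" n "Suc k"] a1 by auto
          have "(fdiff ^^ Suc k) f (Suc n) - (fdiff ^^ Suc k) f n = (fdiff ^^ Suc (Suc k)) f n"
            by (simp add: fdiff_def)
          also have "\<dots> = s * ((-1) ^ Suc k * fact (Suc k) / \<xi> ^ Suc (Suc k))"
            unfolding f_def fdiff_funpow_cmult x(2) ..
          also have "s * (-1) ^ Suc k = - \<bar>t\<bar>" by (simp add: s_def flip: power_add mult_2)
          then have "s * ((-1) ^ Suc k * fact (Suc k) / \<xi> ^ Suc (Suc k)) = - \<bar>t\<bar> * fact (Suc k) / \<xi> ^ Suc (Suc k)"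
            by (metis mult.assoc times_divide_eq_right)
          also have "\<dots> \<le> 0" using x(1) a1 by (intro divide_nonpos_nonneg mult_nonpos_nonneg zero_le_power) auto
          finally show ?thesis by simp
        qed
        then show ?thesis unfolding monotone_below_def by blast
      qed
      have "norm (\<Sum>n<N. cis (f n)) \<le> B * (real C * real a) powr (1 - d)"
      proof (rule main[OF _ _ _ _ range mono])
        show "real C * real a \<ge> 1" using a1 assms(1) by (simp add: mult_ge1_I)
        show "real N \<le> real C * real a" unfolding N_def by (metis diff_le_self of_nat_le_iff of_nat_mult)
        have pw: "real a powr (real (Suc k) - v) / real a ^ Suc k = real a powr (-v)" for v
          using a1 by (simp add: powr_diff powr_minus divide_inverse powr_realpow[symmetric] del: of_nat_Suc power_Suc)
        have "(real C * real a) powr (-l) \<le> c * real a powr (-l')" by (fact elim)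
        also have "\<dots> = c * (real a powr (real (Suc k) - l') / real a ^ Suc k)" unfolding pw ..
        also have "\<dots> \<le> c * (\<bar>t\<bar> / real a ^ Suc k)"
          using t c0 a1 by (intro mult_left_mono divide_right_mono) auto
        finally show "(real C * real a) powr (-l) \<le> lam" by (simp add: lam_def mult.commute)
        have "lam = c * (\<bar>t\<bar> / real a ^ Suc k)" by (simp add: lam_def)
        also have "\<dots> \<le> c * (real a powr (real (Suc k) - u') / real a ^ Suc k)"
          using t c0 a1 by (intro mult_left_mono divide_right_mono) auto
        also have "\<dots> = c * real a powr (-u')" unfolding pw ..
        also have "\<dots> \<le> (real C * real a) powr (-u)" by (fact elim)
        finally show "lam \<le> (real C * real a) powr (-u)" .
      qed
      also have "\<dots> \<le> real a powr (1 - d / 2)" by (fact elim)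
      finally have *: "norm (\<Sum>n<N. cis (f n)) \<le> real a powr (1 - d / 2)" .
      have "(\<Sum>n\<in>{a..<C * a}. cis (t * ln (real n))) = (\<Sum>n<N. cis (t * ln (real a + real n)))"
        unfolding N_def
        by (rule sum.reindex_bij_witness[of _ "\<lambda>n. n + a" "\<lambda>n. n - a"]) (auto simp: of_nat_diff)
      moreover have "norm (\<Sum>n<N. cis (t * ln (real a + real n))) = norm (\<Sum>n<N. cis (f n))"
      proof -
        have "s = t \<or> s = - t" unfolding s_def by (cases "even k") (auto simp: abs_if)
        then show ?thesis
        proof
          assume "s = t"
          then show ?thesis by (simp add: f_def)
        next
          assume "s = - t"
          then have "(\<Sum>n<N. cis (f n)) = cnj (\<Sum>n<N. cis (t * ln (real a + real n)))"
            by (simp add: f_def cis_cnj)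
          then show ?thesis by (simp only: complex_mod_cnj)
        qed
      qed
      ultimately show "norm (\<Sum>n\<in>{a..<C * a}. cis (t * ln (real n))) \<le> real a powr (1 - d / 2)"
        using * by simp
    qed
  qed
  then show ?thesis using d by (intro exI[of _ "d / 2"]) auto
qed

text \<open>
  The range of \<open>t\<close> that one choice of \<open>(l, u)\<close> gives for a given order has length less than one in the
  exponent of \<open>a\<close>. So two choices are needed: \<open>(15/16, 1/16)\<close>, which covers the exponents from
  \<open>k + 1/8\<close> to \<open>k + 7/8\<close>, and \<open>(5/4, 3/8)\<close> at the next order, which bridges the hole around \<open>k + 1\<close>.
\<close>

theorem sum_cis_log_power_saving:
  fixes A :: real
  assumes "C \<ge> 1"
  shows "\<exists>\<delta>>0. \<forall>\<^sub>F a in sequentially. \<forall>t. real a powr (1/8) \<le> \<bar>t\<bar> \<longrightarrow> \<bar>t\<bar> \<le> real a powr A \<longrightarrow>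
     norm (\<Sum>n\<in>{a..<C * a}. cis (t * ln (real n))) \<le> real a powr (1 - \<delta>)"
proof -
  define K where "K = nat \<lceil>A\<rceil> + 2"
  define P where "P = (\<lambda>lo hi \<delta> a. \<forall>t. real a powr lo \<le> \<bar>t\<bar> \<longrightarrow> \<bar>t\<bar> \<le> real a powr hi \<longrightarrow>
     norm (\<Sum>n\<in>{a..<C * a}. cis (t * ln (real n))) \<le> real a powr (1 - \<delta>))"
  have "\<exists>\<delta>>0. \<forall>\<^sub>F a in sequentially. P (real (Suc k) - 7/8) (real (Suc k) - 1/8) \<delta> a" for k
    unfolding P_def by (rule sum_cis_log_range[where l = "15/16" and u = "1/16"]) (use assms in auto)
  then obtain d1 where d1: "\<And>k. d1 k > 0"
    "\<And>k. \<forall>\<^sub>F a in sequentially. P (real (Suc k) - 7/8) (real (Suc k) - 1/8) (d1 k) a" by metis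
  have "\<exists>\<delta>>0. \<forall>\<^sub>F a in sequentially. P (real (Suc (Suc k)) - 9/8) (real (Suc (Suc k)) - 1/2) \<delta> a" for k
    unfolding P_def by (rule sum_cis_log_range[where l = "5/4" and u = "3/8"]) (use assms in auto)
  then obtain d2 where d2: "\<And>k. d2 k > 0"
    "\<And>k. \<forall>\<^sub>F a in sequentially. P (real (Suc (Suc k)) - 9/8) (real (Suc (Suc k)) - 1/2) (d2 k) a" by metis
  define d where "d = Min (d1 ` {..K} \<union> d2 ` {..K})"
  have d0: "d > 0" unfolding d_def using d1 d2 by (subst Min_gr_iff) auto
  have dle: "d \<le> d1 k" "d \<le> d2 k" if "k \<le> K" for k
    unfolding d_def using that by (auto intro!: Min_le)
  have "\<forall>\<^sub>F a in sequentially. \<forall>k\<in>{..K}. P (real (Suc k) - 7/8) (real (Suc k) - 1/8) (d1 k) a"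
    using d1 by (intro eventually_ball_finite) auto
  moreover have "\<forall>\<^sub>F a in sequentially. \<forall>k\<in>{..K}. P (real (Suc (Suc k)) - 9/8) (real (Suc (Suc k)) - 1/2) (d2 k) a"
    using d2 by (intro eventually_ball_finite) auto
  ultimately have "\<forall>\<^sub>F a in sequentially. P (1/8) A d a"
    using eventually_ge_at_top[of 2]
  proof eventually_elim
    case (elim a)
    show ?case unfolding P_def
    proof (intro allI impI)
      fix t :: real assume t: "real a powr (1/8) \<le> \<bar>t\<bar>" "\<bar>t\<bar> \<le> real a powr A"
      have a: "real a > 1" using elim by simp
      define th where "th = log (real a) \<bar>t\<bar>"
      have t0: "\<bar>t\<bar> > 0" using t(1) a by (smt (verit) powr_gt_zero)
      have tth: "\<bar>t\<bar> = real a powr th" unfolding th_def using a t0 by simp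
      have th: "1/8 \<le> th" "th \<le> A" using t a unfolding tth by auto
      \<comment> \<open>The exponent lies in \<open>[k + 1/8, k + 9/8)\<close>: the first choice covers it up to \<open>k + 7/8\<close>, the second one the rest.\<close>
      define k where "k = nat \<lfloor>th - 1/8\<rfloor>"
      have k: "real k \<le> th - 1/8" "th - 1/8 < real k + 1" using th(1) unfolding k_def by linarith+
      have kK: "k \<le> K" unfolding K_def using k th by linarith
      have down: "real a powr (1 - d') \<le> real a powr (1 - d)" if "d \<le> d'" for d'
        using that a by (intro powr_mono) auto
      show "norm (\<Sum>n\<in>{a..<C * a}. cis (t * ln (real n))) \<le> real a powr (1 - d)"
      proof (cases "th \<le> real (Suc k) - 1/8")
        case True
        have "norm (\<Sum>n\<in>{a..<C * a}. cis (t * ln (real n))) \<le> real a powr (1 - d1 k)"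
          using elim(1) kK k True a unfolding P_def tth by (auto simp: tth)
        then show ?thesis using down[OF dle(1)[OF kK]] by simp
      next
        case False
        have "norm (\<Sum>n\<in>{a..<C * a}. cis (t * ln (real n))) \<le> real a powr (1 - d2 k)"
          using elim(2) kK k False a unfolding P_def tth by (auto simp: tth)
        then show ?thesis using down[OF dle(2)[OF kK]] by simp
      qed
    qed
  qed
  then show ?thesis using d0 unfolding P_def by blast
qed

section \<open>Gaussian mean values of exponential sums\<close>

definition gauss_kernel :: "real \<Rightarrow> real \<Rightarrow> real" where
  "gauss_kernel h u = exp (- ((u / h)\<^sup>2 / 2))"

text \<open>
  Its Fourier transform is \<open>gauss_kernel h\<close>. It is a probability measure, so that all bounded
  functions are integrable.
\<close>

definition gauss_measure :: "real \<Rightarrow> real measure" where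
  "gauss_measure h = density lborel (normal_density 0 (1 / h))"

lemma gauss_kernel_nonneg: "gauss_kernel h u \<ge> 0"
  by (simp add: gauss_kernel_def)

lemma gauss_kernel_le:
  assumes "h > 0" "V \<ge> 0" "h * V \<le> \<bar>u\<bar>"
  shows "gauss_kernel h u \<le> exp (- (V\<^sup>2 / 2))"
proof -
  have "V \<le> \<bar>u\<bar> / h" using assms by (simp add: field_simps)
  then have "V\<^sup>2 \<le> (\<bar>u\<bar> / h)\<^sup>2" using assms by (intro power_mono) auto
  then show ?thesis by (simp add: gauss_kernel_def power_divide)
qed

lemma gauss_kernel_le_indicator:
  assumes "h > 0" "V \<ge> 0"
  shows "gauss_kernel h u \<le> (if \<bar>u\<bar> \<le> h * V then 1 else 0) + exp (- (V\<^sup>2 / 2))"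
proof (cases "\<bar>u\<bar> \<le> h * V")
  case True
  have "gauss_kernel h u \<le> 1" by (simp add: gauss_kernel_def)
  then show ?thesis using True by (simp add: add_increasing2)
next
  case False
  then show ?thesis using gauss_kernel_le[OF assms, of u] by simp
qed

lemma prob_space_gauss_measure: "h > 0 \<Longrightarrow> prob_space (gauss_measure h)"
  unfolding gauss_measure_def by (rule prob_space_normal_density) simp

lemma sets_gauss_measure [measurable_cong, simp]: "sets (gauss_measure h) = sets borel"
  and space_gauss_measure [simp]: "space (gauss_measure h) = UNIV"
  by (simp_all add: gauss_measure_def)

lemma integrable_gauss_measure_bounded:
  fixes f :: "real \<Rightarrow> 'b::{banach, second_countable_topology}"
  assumes "h > 0" "f \<in> borel_measurable borel" "\<And>t. norm (f t) \<le> B"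
  shows "integrable (gauss_measure h) f"
proof -
  interpret prob_space "gauss_measure h" by (rule prob_space_gauss_measure) fact
  have "f \<in> borel_measurable (gauss_measure h)" using assms(2) by (simp cong: measurable_cong_sets)
  then show ?thesis using assms(3) by (intro integrable_const_bound[of _ B]) auto
qed

lemma borel_measurable_cis [measurable]: "cis \<in> borel_measurable borel"
  by (intro borel_measurable_continuous_onI continuous_intros)

lemma integral_gauss_measure:
  fixes f :: "real \<Rightarrow> complex"
  assumes "h > 0" "f \<in> borel_measurable borel"
  shows "(\<integral>t. f t \<partial>gauss_measure h) = (\<integral>t. normal_density 0 (1 / h) t *\<^sub>R f t \<partial>lborel)"
  unfolding gauss_measure_def using assms by (subst integral_density) auto

lemma integral_cis_gauss_measure:
  assumes h: "h > 0"
  shows "(\<integral>t. cis (t * u) \<partial>gauss_measure h) = of_real (gauss_kernel h u)"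
proof -
  have "(\<integral>t. cis (t * u) \<partial>gauss_measure h) = (\<integral>t. normal_density 0 (1 / h) t *\<^sub>R cis (t * u) \<partial>lborel)"
    using h by (intro integral_gauss_measure) auto
  also have "\<dots> = \<bar>1 / h\<bar> *\<^sub>R (\<integral>x. normal_density 0 (1 / h) (0 + (1 / h) * x) *\<^sub>R cis ((0 + (1 / h) * x) * u) \<partial>lborel)"
    using h by (intro lborel_integral_real_affine) auto
  also have "\<dots> = (\<integral>x. (1 / h) *\<^sub>R (normal_density 0 (1 / h) (0 + (1 / h) * x) *\<^sub>R cis ((0 + (1 / h) * x) * u)) \<partial>lborel)"
    using h by (subst integral_scaleR_right) auto
  also have "\<dots> = (\<integral>x. std_normal_density x *\<^sub>R iexp ((u / h) * x) \<partial>lborel)"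
  proof (rule Bochner_Integration.integral_cong[OF refl])
    fix x :: real
    have "1 / h * normal_density 0 (1 / h) (0 + 1 / h * x) = std_normal_density x"
      using h by (simp add: normal_density_def real_sqrt_mult real_sqrt_divide power_divide field_simps)
    moreover have "cis ((0 + (1 / h) * x) * u) = iexp ((u / h) * x)"
      by (simp add: cis_conv_exp mult_ac)
    ultimately show "(1 / h) *\<^sub>R (normal_density 0 (1 / h) (0 + (1 / h) * x) *\<^sub>R cis ((0 + (1 / h) * x) * u))
        = std_normal_density x *\<^sub>R iexp ((u / h) * x)"
      by (metis scaleR_scaleR)
  qed
  also have "\<dots> = char std_normal_distribution (u / h)"
    unfolding char_def by (subst integral_density) auto
  also have "\<dots> = of_real (gauss_kernel h u)"
    unfolding char_std_normal_distribution gauss_kernel_def by simp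
  finally show ?thesis .
qed

text \<open>
  Multiplying the density by the damping factor gives a multiple of the density for \<open>H\<close>. In this way
  one integral represents the kernels of both widths.
\<close>

lemma integral_cis_damped_gauss_measure:
  assumes h: "0 < h" and H: "h \<le> H"
  shows "(\<integral>t. exp (- ((H\<^sup>2 - h\<^sup>2) * t\<^sup>2 / 2)) *\<^sub>R cis (t * u) \<partial>gauss_measure h)
       = of_real (h / H * gauss_kernel H u)"
proof -
  have "(\<integral>t. exp (- ((H\<^sup>2 - h\<^sup>2) * t\<^sup>2 / 2)) *\<^sub>R cis (t * u) \<partial>gauss_measure h)
      = (\<integral>t. normal_density 0 (1 / h) t *\<^sub>R (exp (- ((H\<^sup>2 - h\<^sup>2) * t\<^sup>2 / 2)) *\<^sub>R cis (t * u)) \<partial>lborel)"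
    using h by (intro integral_gauss_measure) auto
  also have "\<dots> = (\<integral>t. (h / H) *\<^sub>R (normal_density 0 (1 / H) t *\<^sub>R cis (t * u)) \<partial>lborel)"
  proof (rule Bochner_Integration.integral_cong[OF refl])
    fix t :: real
    have H0: "H > 0" using h H by simp
    have e: "exp (- (t\<^sup>2 * h\<^sup>2 / 2)) * exp (- ((H\<^sup>2 - h\<^sup>2) * t\<^sup>2 / 2)) = exp (- (t\<^sup>2 * H\<^sup>2 / 2))"
      unfolding exp_add[symmetric] by (simp add: algebra_simps)
    have n: "normal_density 0 (1 / c) t = c / sqrt (2 * pi) * exp (- (t\<^sup>2 * c\<^sup>2 / 2))" if "c > 0" for c :: real
      using that by (simp add: normal_density_def real_sqrt_mult real_sqrt_divide power_divide field_simps)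
    have "normal_density 0 (1 / h) t * exp (- ((H\<^sup>2 - h\<^sup>2) * t\<^sup>2 / 2)) = h / sqrt (2 * pi) * exp (- (t\<^sup>2 * H\<^sup>2 / 2))"
      unfolding n[OF h] e[symmetric] by simp
    also have "\<dots> = h / H * normal_density 0 (1 / H) t" unfolding n[OF H0] using H0 by simp
    finally show "normal_density 0 (1 / h) t *\<^sub>R (exp (- ((H\<^sup>2 - h\<^sup>2) * t\<^sup>2 / 2)) *\<^sub>R cis (t * u))
        = (h / H) *\<^sub>R (normal_density 0 (1 / H) t *\<^sub>R cis (t * u))" by (metis scaleR_scaleR)
  qed
  also have "\<dots> = (h / H) *\<^sub>R (\<integral>t. normal_density 0 (1 / H) t *\<^sub>R cis (t * u) \<partial>lborel)"
    using h H by (subst integral_scaleR_right) auto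
  also have "(\<integral>t. normal_density 0 (1 / H) t *\<^sub>R cis (t * u) \<partial>lborel) = (\<integral>t. cis (t * u) \<partial>gauss_measure H)"
    using h H by (intro integral_gauss_measure[symmetric]) auto
  also have "\<dots> = of_real (gauss_kernel H u)" using h H by (intro integral_cis_gauss_measure) auto
  finally show ?thesis by (simp add: scaleR_conv_of_real)
qed

lemma square_integral_gauss_measure:
  assumes h: "h > 0"
  shows "integrable (gauss_measure h) (\<lambda>t. t\<^sup>2)" "(\<integral>t. t\<^sup>2 \<partial>gauss_measure h) = 1 / h\<^sup>2"
proof -
  have hb: "has_bochner_integral lborel (\<lambda>t. normal_density 0 (1 / h) t * t\<^sup>2) (1 / h\<^sup>2)"
    using normal_moment_even[of "1 / h" 0 1] h by (simp add: power_divide fact_2)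
  then show "integrable (gauss_measure h) (\<lambda>t. t\<^sup>2)"
    unfolding gauss_measure_def by (subst integrable_density) (auto simp: has_bochner_integral_iff)
  show "(\<integral>t. t\<^sup>2 \<partial>gauss_measure h) = 1 / h\<^sup>2"
    unfolding gauss_measure_def using hb by (subst integral_density) (auto simp: has_bochner_integral_iff)
qed

definition exp_sum :: "'i set \<Rightarrow> ('i \<Rightarrow> real) \<Rightarrow> real \<Rightarrow> complex" where
  "exp_sum I \<phi> t = (\<Sum>i\<in>I. cis (t * \<phi> i))"

lemma borel_measurable_exp_sum [measurable]: "exp_sum I \<phi> \<in> borel_measurable borel"
  unfolding exp_sum_def by measurable

lemma norm_exp_sum_le: "norm (exp_sum I \<phi> t) \<le> real (card I)"
proof -
  have "norm (exp_sum I \<phi> t) \<le> (\<Sum>i\<in>I. norm (cis (t * \<phi> i)))"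
    unfolding exp_sum_def by (rule norm_sum)
  then show ?thesis by simp
qed

lemma exp_sum_times:
  "exp_sum I \<phi> t * exp_sum J \<psi> t = exp_sum (I \<times> J) (\<lambda>(i, j). \<phi> i + \<psi> j) t"
  unfolding exp_sum_def sum_product sum.cartesian_product
  by (intro sum.cong) (auto simp: cis_mult distrib_left)

lemma mean_square_exp_sum:
  assumes h: "h > 0"
  shows "(\<integral>t. (norm (exp_sum I \<phi> t))\<^sup>2 \<partial>gauss_measure h) = (\<Sum>i\<in>I. \<Sum>j\<in>I. gauss_kernel h (\<phi> i - \<phi> j))"
proof -
  have int: "integrable (gauss_measure h) (\<lambda>t. cis (t * u))" for u
    using h by (intro integrable_gauss_measure_bounded[of _ _ 1]) auto
  have "complex_of_real (\<integral>t. (norm (exp_sum I \<phi> t))\<^sup>2 \<partial>gauss_measure h)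
      = (\<integral>t. complex_of_real ((norm (exp_sum I \<phi> t))\<^sup>2) \<partial>gauss_measure h)"
    by (rule integral_complex_of_real[symmetric])
  also have "\<dots> = (\<integral>t. (\<Sum>i\<in>I. \<Sum>j\<in>I. cis (t * (\<phi> i - \<phi> j))) \<partial>gauss_measure h)"
    unfolding complex_norm_square exp_sum_def cnj_sum sum_product
    by (simp add: cis_cnj cis_mult algebra_simps)
  also have "\<dots> = (\<Sum>i\<in>I. \<Sum>j\<in>I. (\<integral>t. cis (t * (\<phi> i - \<phi> j)) \<partial>gauss_measure h))"
    using int by (simp add: Bochner_Integration.integral_sum)
  also have "\<dots> = complex_of_real (\<Sum>i\<in>I. \<Sum>j\<in>I. gauss_kernel h (\<phi> i - \<phi> j))"
    by (simp add: integral_cis_gauss_measure[OF h])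
  finally show ?thesis by (simp only: of_real_eq_iff)
qed

text \<open>
  The difference of the two smoothed counts is an integral of the exponential sum against
  \<open>1 - exp (...)\<close>, a factor that vanishes to second order at \<open>t = 0\<close>. This removes the main term without
  any evaluation of it.
\<close>

lemma kernel_comparison:
  assumes h: "0 < h" and H: "h \<le> H" and I: "finite I"
  shows "(\<Sum>i\<in>I. h / H * gauss_kernel H (\<phi> i)) \<le> (\<Sum>i\<in>I. gauss_kernel h (\<phi> i)) +
    (\<integral>t. (1 - exp (- ((H\<^sup>2 - h\<^sup>2) * t\<^sup>2 / 2))) * norm (exp_sum I \<phi> t) \<partial>gauss_measure h)"
proof -
  define \<psi> where "\<psi> = (\<lambda>t::real. 1 - exp (- ((H\<^sup>2 - h\<^sup>2) * t\<^sup>2 / 2)))"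
  have HH: "H\<^sup>2 - h\<^sup>2 \<ge> 0" using h H by (simp add: power_mono)
  have psi: "0 \<le> \<psi> t" "\<psi> t \<le> 1" for t using HH by (auto simp: \<psi>_def)
  have [measurable]: "\<psi> \<in> borel_measurable borel" unfolding \<psi>_def by measurable
  have int1: "integrable (gauss_measure h) (\<lambda>t. cis (t * u))" for u
    using h by (intro integrable_gauss_measure_bounded[of _ _ 1]) auto
  have int2: "integrable (gauss_measure h) (\<lambda>t. exp (- ((H\<^sup>2 - h\<^sup>2) * t\<^sup>2 / 2)) *\<^sub>R cis (t * u))" for u
    using h HH by (intro integrable_gauss_measure_bounded[of _ _ 1]) auto
  have int3: "integrable (gauss_measure h) (\<lambda>t. \<psi> t *\<^sub>R cis (t * u))" for u
    using h psi by (intro integrable_gauss_measure_bounded[of _ _ 1]) auto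
  have one: "(\<integral>t. \<psi> t *\<^sub>R cis (t * u) \<partial>gauss_measure h) = of_real (gauss_kernel h u - h / H * gauss_kernel H u)" for u
    unfolding \<psi>_def scaleR_diff_left scaleR_one
    using int1 int2 integral_cis_gauss_measure[OF h] integral_cis_damped_gauss_measure[OF h H]
    by (subst Bochner_Integration.integral_diff) auto
  have "complex_of_real (\<Sum>i\<in>I. gauss_kernel h (\<phi> i) - h / H * gauss_kernel H (\<phi> i))
      = (\<Sum>i\<in>I. (\<integral>t. \<psi> t *\<^sub>R cis (t * \<phi> i) \<partial>gauss_measure h))"
    unfolding one by simp
  also have "\<dots> = (\<integral>t. (\<Sum>i\<in>I. \<psi> t *\<^sub>R cis (t * \<phi> i)) \<partial>gauss_measure h)"
    using int3 by (intro Bochner_Integration.integral_sum[symmetric]) auto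
  also have "\<dots> = (\<integral>t. \<psi> t *\<^sub>R exp_sum I \<phi> t \<partial>gauss_measure h)"
    by (simp add: exp_sum_def scaleR_sum_right)
  finally have eq: "complex_of_real (\<Sum>i\<in>I. gauss_kernel h (\<phi> i) - h / H * gauss_kernel H (\<phi> i))
      = (\<integral>t. \<psi> t *\<^sub>R exp_sum I \<phi> t \<partial>gauss_measure h)" .
  have "- (\<Sum>i\<in>I. gauss_kernel h (\<phi> i) - h / H * gauss_kernel H (\<phi> i))
      \<le> norm (complex_of_real (\<Sum>i\<in>I. gauss_kernel h (\<phi> i) - h / H * gauss_kernel H (\<phi> i)))"
    by (subst norm_of_real) (rule abs_ge_minus_self)
  also have "\<dots> \<le> (\<integral>t. norm (\<psi> t *\<^sub>R exp_sum I \<phi> t) \<partial>gauss_measure h)"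
    unfolding eq by (rule integral_norm_bound)
  also have "\<dots> = (\<integral>t. \<psi> t * norm (exp_sum I \<phi> t) \<partial>gauss_measure h)"
    using psi by simp
  finally show ?thesis unfolding \<psi>_def by (simp add: sum_subtractf)
qed

lemma integral_product_le_sqrt:
  fixes f g :: "real \<Rightarrow> real"
  assumes h: "h > 0" and [measurable]: "f \<in> borel_measurable borel" "g \<in> borel_measurable borel"
    and "\<And>t. \<bar>f t\<bar> \<le> B" "\<And>t. \<bar>g t\<bar> \<le> B"
    and "(\<integral>t. (f t)\<^sup>2 \<partial>gauss_measure h) \<le> a" "(\<integral>t. (g t)\<^sup>2 \<partial>gauss_measure h) \<le> b" "a > 0" "b > 0"
  shows "(\<integral>t. f t * g t \<partial>gauss_measure h) \<le> sqrt (a * b)"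
proof -
  \<comment> \<open>The weight that balances the two terms of the arithmetic-geometric mean inequality.\<close>
  define s where "s = sqrt (b / a)"
  have s: "s > 0" using assms by (simp add: s_def)
  have B0: "B \<ge> 0" using assms(4)[of 0] by linarith
  have i1: "integrable (gauss_measure h) (\<lambda>t. f t * g t)"
    using h assms B0 by (intro integrable_gauss_measure_bounded[of _ _ "B * B"]) (auto simp: abs_mult intro!: mult_mono)
  have i2: "integrable (gauss_measure h) (\<lambda>t. (f t)\<^sup>2)"
    using h assms B0 by (intro integrable_gauss_measure_bounded[of _ _ "B\<^sup>2"]) (auto simp: abs_le_square_iff[symmetric])
  have i3: "integrable (gauss_measure h) (\<lambda>t. (g t)\<^sup>2)"
    using h assms B0 by (intro integrable_gauss_measure_bounded[of _ _ "B\<^sup>2"]) (auto simp: abs_le_square_iff[symmetric])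
  have "(\<integral>t. f t * g t \<partial>gauss_measure h) \<le> (\<integral>t. s / 2 * (f t)\<^sup>2 + 1 / (2 * s) * (g t)\<^sup>2 \<partial>gauss_measure h)"
  proof (rule integral_mono)
    fix t
    have "0 \<le> (s * f t - g t)\<^sup>2" by simp
    then have "2 * s * (f t * g t) \<le> s\<^sup>2 * (f t)\<^sup>2 + (g t)\<^sup>2" by (simp add: power2_eq_square algebra_simps)
    then show "f t * g t \<le> s / 2 * (f t)\<^sup>2 + 1 / (2 * s) * (g t)\<^sup>2"
      using s by (simp add: field_simps power2_eq_square)
  qed (use i1 i2 i3 in auto)
  also have "\<dots> = s / 2 * (\<integral>t. (f t)\<^sup>2 \<partial>gauss_measure h) + 1 / (2 * s) * (\<integral>t. (g t)\<^sup>2 \<partial>gauss_measure h)"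
    using i2 i3 by simp
  also have "\<dots> \<le> s / 2 * a + 1 / (2 * s) * b"
    using assms s by (intro add_mono mult_left_mono) auto
  also have "\<dots> = sqrt (a * b)"
  proof -
    have "s * a = sqrt (a * b)" "b / s = sqrt (a * b)"
      using assms by (simp_all add: s_def real_sqrt_divide real_sqrt_mult field_simps)
    then show ?thesis by (simp add: field_simps)
  qed
  finally show ?thesis .
qed

section \<open>Dyadic intervals with many primes\<close>

lemma times_binomial_fact:
  "real (Suc j) * real (Suc (j + d) choose Suc j) = fact (Suc (j + d)) / (fact j * fact d)"
proof -
  have "real (Suc (j + d) choose Suc j) = fact (Suc (j + d)) / (fact (Suc j) * fact d)"
    using binomial_fact[of "Suc j" "Suc (j + d)", where 'a = real] by simp
  also have "\<dots> = fact (Suc (j + d)) / (real (Suc j) * fact j * fact d)"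
    by (simp only: fact_Suc[of j])
  finally have eq: "real (Suc (j + d) choose Suc j) = fact (Suc (j + d)) / (real (Suc j) * fact j * fact d)" .
  show ?thesis unfolding eq by (simp del: of_nat_Suc fact_Suc)
qed

text \<open>
  The reciprocals of \<open>k * (n choose k)\<close> form Leibniz's harmonic triangle, where each entry is the
  sum of two entries of the next row.
\<close>

lemma Leibniz_triangle_recurrence:
  "1 / (real (Suc j) * real (Suc (j + d) choose Suc j))
     = 1 / (real (Suc j) * real (Suc (j + Suc d) choose Suc j))
       + 1 / (real (Suc (Suc j)) * real (Suc (Suc j + d) choose Suc (Suc j)))"
proof -
  have aux: "1 / (A / (F * G)) = 1 / ((x + y) * A / (F * (y * G))) + 1 / ((x + y) * A / ((x * F) * G))"
    if "A > 0" "F > 0" "G > 0" "x > 0" "y > 0" for A F G x y :: real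
  proof -
    have "x + y \<noteq> 0" using that by simp
    then show ?thesis using that by (simp add: divide_simps) (simp add: algebra_simps)
  qed
  have e: "fact (Suc (j + Suc d)) = (real (Suc j) + real (Suc d)) * fact (Suc (j + d))"
    "fact (Suc (Suc j + d)) = (real (Suc j) + real (Suc d)) * fact (Suc (j + d))"
    by (simp_all add: algebra_simps)
  show ?thesis
    unfolding times_binomial_fact[of j d] times_binomial_fact[of j "Suc d"] times_binomial_fact[of "Suc j" d]
      e fact_Suc[of j] fact_Suc[of d]
    by (rule aux) auto
qed

text \<open>
  By the recurrence in the harmonic triangle, \<open>L\<close> times an entry is an integer as soon as this holds for
  the boundary entries \<open>1/m\<close> with \<open>m \<le> n\<close>, that is, if \<open>m dvd L\<close> for these \<open>m\<close>.
\<close>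

lemma times_binomial_dvd_common_multiple:
  assumes "\<And>m. 1 \<le> m \<Longrightarrow> m \<le> Suc (j + d) \<Longrightarrow> m dvd L"
  shows "Suc j * (Suc (j + d) choose Suc j) dvd L"
proof -
  have "\<exists>z::int. of_int z = real L / (real (Suc j) * real (Suc (j + d) choose Suc j))"
    using assms
  proof (induction d arbitrary: j)
    case 0
    have "Suc j dvd L" using 0 by simp
    then obtain q where "L = Suc j * q" by (auto elim: dvdE)
    then show ?case by (intro exI[of _ "int q"]) (simp del: of_nat_Suc mult_Suc)
  next
    case (Suc d)
    obtain z1 :: int where z1: "of_int z1 = real L / (real (Suc j) * real (Suc (j + d) choose Suc j))"
      using Suc.IH[of j] Suc.prems by auto
    obtain z2 :: int where z2: "of_int z2 = real L / (real (Suc (Suc j)) * real (Suc (Suc j + d) choose Suc (Suc j)))"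
      using Suc.IH[of "Suc j"] Suc.prems by auto
    have "real L / (real (Suc j) * real (Suc (j + d) choose Suc j))
        = real L / (real (Suc j) * real (Suc (j + Suc d) choose Suc j))
        + real L / (real (Suc (Suc j)) * real (Suc (Suc j + d) choose Suc (Suc j)))"
      using arg_cong[OF Leibniz_triangle_recurrence[of j d], of "\<lambda>x. real L * x"]
      by (simp only: distrib_left times_divide_eq_right mult_1_right)
    then have "of_int (z1 - z2) = real L / (real (Suc j) * real (Suc (j + Suc d) choose Suc j))"
      using z1 z2 by simp
    then show ?case by blast
  qed
  then obtain z :: int where z: "of_int z = real L / (real (Suc j) * real (Suc (j + d) choose Suc j))" by blast
  have "real (Suc j) * real (Suc (j + d) choose Suc j) \<noteq> 0" by (simp del: binomial_Suc_Suc)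
  with z have "real L = of_int z * (real (Suc j) * real (Suc (j + d) choose Suc j))"
    by (simp add: field_simps del: binomial_Suc_Suc of_nat_Suc)
  then have "int L = z * int (Suc j * (Suc (j + d) choose Suc j))"
    by (metis (no_types, lifting) of_int_eq_iff of_int_mult of_int_of_nat_eq of_nat_mult)
  then have "int (Suc j * (Suc (j + d) choose Suc j)) dvd int L" by simp
  then show ?thesis by (simp only: int_dvd_int_iff)
qed

text \<open>
  The least common multiple of the numbers up to \<open>n\<close> is a product of prime powers, each at most \<open>n\<close>. This
  is Chebyshev's argument, with the divisibility above in place of a formula for the prime factors of
  factorials.
\<close>

lemma binomial_le_power_card_primes:
  assumes "1 \<le> k" "k \<le> n"
  shows "(n choose k) \<le> n ^ card {p. prime p \<and> p \<le> n}"
proof -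
  \<comment> \<open>With these exponents \<open>L\<close> is the least common multiple of the numbers up to \<open>n\<close>.\<close>
  define e where "e = (\<lambda>p. Max {i. p ^ i \<le> n})"
  define A where "A = {p. prime p \<and> p \<le> n}"
  define L where "L = (\<Prod>p\<in>A. p ^ e p)"
  have finA: "finite A" unfolding A_def by auto
  have fin: "finite {i. p ^ i \<le> n}" if "prime p" for p
  proof (rule finite_subset)
    show "{i. p ^ i \<le> n} \<subseteq> {..n}"
    proof
      fix i assume "i \<in> {i. p ^ i \<le> n}"
      then have "p ^ i \<le> n" by simp
      moreover have "i < p ^ i" using that prime_ge_2_nat[OF that] by (metis less_exp power_mono dual_order.strict_trans1 zero_le)
      ultimately show "i \<in> {..n}" by simp
    qed
  qed auto
  have pe: "p ^ e p \<le> n" if "prime p" for p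
    using Max_in[OF fin[OF that]] assms unfolding e_def by (force intro: exI[of _ 0])
  have L0: "L \<noteq> 0" unfolding L_def A_def by (auto simp: prime_gt_0_nat)
  have "m dvd L" if m: "1 \<le> m" "m \<le> n" for m
  proof (rule multiplicity_le_imp_dvd)
    show "m \<noteq> 0" using m by simp
    fix p :: nat assume p: "prime p"
    let ?f = "multiplicity p m"
    have "p ^ ?f dvd m" by (rule multiplicity_dvd)
    then have le: "p ^ ?f \<le> n" using m by (meson dvd_imp_le dual_order.trans less_le_trans zero_less_one)
    then have fe: "?f \<le> e p" unfolding e_def using fin[OF p] by (intro Max_ge) auto
    show "?f \<le> multiplicity p L"
    proof (cases "?f = 0")
      case False
      have "p ^ 1 \<le> p ^ ?f" using False p prime_ge_1_nat[OF p] by (intro power_increasing) auto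
      then have "p \<in> A" using le p by (simp add: A_def)
      then have "p ^ e p dvd L" unfolding L_def using finA by (intro dvd_prodI) auto
      then have "p ^ ?f dvd L" using fe by (meson dvd_trans le_imp_power_dvd)
      then show ?thesis using L0 p by (intro multiplicity_geI) auto
    qed simp
  qed
  then have "Suc (k - 1) * (Suc (k - 1 + (n - k)) choose Suc (k - 1)) dvd L"
    using assms by (intro times_binomial_dvd_common_multiple) auto
  then have "k * (n choose k) dvd L" using assms by (simp del: binomial_Suc_Suc)
  then have "k * (n choose k) \<le> L" using L0 by (intro dvd_imp_le) auto
  moreover have "1 * (n choose k) \<le> k * (n choose k)" using assms by (intro mult_right_mono) auto
  moreover have "L \<le> (\<Prod>p\<in>A. n)" unfolding L_def A_def using pe by (intro prod_mono) auto
  ultimately have "(n choose k) \<le> (\<Prod>p\<in>A. n)" by linarith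
  then show ?thesis unfolding A_def by simp
qed

lemma card_primes_lower_bound:
  assumes "s \<ge> 1"
  shows "real s * ln 4 - ln (2 * real s) \<le> real (card {p. prime p \<and> p \<le> 2 * s}) * ln (2 * real s)"
proof -
  let ?c = "card {p. prime p \<and> p \<le> 2 * s}"
  have "4 ^ s / (2 * real s) \<le> real ((2 * s) choose s)"
    using assms by (intro central_binomial_lower_bound) auto
  also have "\<dots> \<le> real ((2 * s) ^ ?c)"
    using binomial_le_power_card_primes[of s "2 * s"] assms by (simp only: of_nat_le_iff)
  also have "\<dots> = (2 * real s) ^ ?c" by simp
  finally have "ln (4 ^ s / (2 * real s)) \<le> ln ((2 * real s) ^ ?c)"
    using assms by (subst ln_le_cancel_iff) auto
  moreover have "ln (4 ^ s / (2 * real s)) = real s * ln 4 - ln (2 * real s)"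
    using assms by (subst ln_div) (auto simp: ln_realpow)
  moreover have "ln ((2 * real s) ^ ?c) = real ?c * ln (2 * real s)"
    by (rule ln_realpow)
  ultimately show ?thesis by simp
qed

lemma card_primes_ge:
  "\<forall>\<^sub>F q::real in at_top. real (card {p. prime p \<and> real p \<le> q}) \<ge> q / (2 * ln q)"
proof -
  have 1: "\<forall>\<^sub>F q::real in at_top. (q / 2 - 1) * (4 / 3) - ln q \<ge> q / 2"
    by real_asymp
  have ln4: "ln 4 \<ge> (4 / 3 :: real)"
    using ln2_ge_two_thirds ln_realpow[of 2 2] by simp
  have 2: "\<forall>\<^sub>F q::real in at_top. q \<ge> 4" by (rule eventually_ge_at_top)
  from 1 2 show ?thesis
  proof eventually_elim
    case (elim q)
    define s where "s = nat \<lfloor>q / 2\<rfloor>"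
    have s: "real s \<le> q / 2" "q / 2 - 1 \<le> real s" "s \<ge> 1" unfolding s_def using elim by linarith+
    have fin: "finite {p. prime p \<and> real p \<le> q}"
      by (rule finite_subset[of _ "{..nat \<lfloor>q\<rfloor>}"]) (auto simp: le_nat_floor)
    have "q / 2 \<le> (q / 2 - 1) * (4 / 3) - ln q" by (fact elim)
    also have "\<dots> \<le> (q / 2 - 1) * ln 4 - ln q"
      using elim ln4 by (intro diff_right_mono mult_left_mono) auto
    also have "\<dots> \<le> real s * ln 4 - ln (2 * real s)"
      using s elim by (intro diff_mono mult_right_mono) auto
    also have "\<dots> \<le> real (card {p. prime p \<and> p \<le> 2 * s}) * ln (2 * real s)"
      using card_primes_lower_bound[OF s(3)] .
    also have "\<dots> \<le> real (card {p. prime p \<and> real p \<le> q}) * ln q"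
    proof (intro mult_mono)
      have "{p. prime p \<and> p \<le> 2 * s} \<subseteq> {p. prime p \<and> real p \<le> q}" using s(1) by auto
      then show "real (card {p. prime p \<and> p \<le> 2 * s}) \<le> real (card {p. prime p \<and> real p \<le> q})"
        using fin by (simp add: card_mono)
    qed (use s elim in auto)
    finally show ?case using elim by (simp add: field_simps)
  qed
qed

text \<open>
  By pigeonhole, one of the \<open>O(ln q)\<close> dyadic intervals below \<open>q\<close> contains the average number of
  primes. Losing logarithms is harmless; what is needed later is that all primes have the same size.
\<close>

theorem dyadic_interval_with_many_primes:
  "\<forall>\<^sub>F q::real in at_top. \<exists>P\<ge>1. 2 * P \<le> q \<and>
     q / (8 * (ln q)\<^sup>2) \<le> real (card {p. prime p \<and> P < real p \<and> real p \<le> 2 * P})"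
  using card_primes_ge eventually_ge_at_top[of 3]
proof eventually_elim
  case (elim q)
  define I where "I = nat \<lfloor>log 2 q\<rfloor>"
  define B where "B = (\<lambda>i::nat. {p. prime p \<and> q / 2 ^ Suc i < real p \<and> real p \<le> q / 2 ^ i})"
  have finB: "finite (B i)" for i
    by (rule finite_subset[of _ "{..nat \<lfloor>q / 2 ^ i\<rfloor>}"]) (auto simp: le_nat_floor B_def)
  have log: "log 2 q \<ge> 1" using elim by (simp add: le_log_iff)
  have I1: "I \<ge> 1" "real I \<le> log 2 q" using log unfolding I_def by linarith+
  have sub: "{p. prime p \<and> real p \<le> q} \<subseteq> (\<Union>i<I. B i)"
  proof
    fix p assume "p \<in> {p. prime p \<and> real p \<le> q}"
    then have p: "prime p" "real p \<le> q" by auto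
    then have p2: "real p \<ge> 2" using prime_ge_2_nat[of p] by simp
    define i where "i = nat \<lfloor>log 2 (q / real p)\<rfloor>"
    have l0: "0 \<le> log 2 (q / real p)" using p p2 by (subst zero_le_log_cancel_iff) auto
    have i: "real i \<le> log 2 (q / real p)" "log 2 (q / real p) < real i + 1" using l0 unfolding i_def by linarith+
    have "2 ^ i \<le> q / real p" using i(1) p p2 elim by (subst (asm) le_log_iff) (auto simp: powr_realpow)
    moreover have "q / real p < 2 ^ Suc i"
      using i(2) p p2 elim by (subst (asm) log_less_iff) (auto simp: powr_add powr_realpow)
    ultimately have "p \<in> B i" using p p2 unfolding B_def by (auto simp: field_simps)
    moreover have "i < I"
    proof -
      have "log 2 (q / real p) \<le> log 2 (q / 2)" using p p2 elim by (intro log_mono divide_left_mono) auto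
      also have "\<dots> = log 2 q - 1" using elim by (simp add: log_divide)
      finally show ?thesis using i(1) I1 unfolding I_def by linarith
    qed
    ultimately show "p \<in> (\<Union>i<I. B i)" by blast
  qed
  have "\<exists>i<I. q / (8 * (ln q)\<^sup>2) \<le> real (card (B i))"
  proof (rule ccontr)
    assume "\<not> ?thesis"
    then have c: "real (card (B i)) < q / (8 * (ln q)\<^sup>2)" if "i < I" for i using that by auto
    have lnq: "ln q > 0" using elim by simp
    have "q / (2 * ln q) \<le> real (card {p. prime p \<and> real p \<le> q})" by (fact elim)
    also have "\<dots> \<le> real (card (\<Union>i<I. B i))" using sub finB by (simp add: card_mono)
    also have "\<dots> \<le> (\<Sum>i<I. real (card (B i)))"
      by (metis card_UN_le finite_lessThan of_nat_le_iff of_nat_sum)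
    also have "\<dots> < (\<Sum>i<I. q / (8 * (ln q)\<^sup>2))" using c I1 by (intro sum_strict_mono) (auto simp: lessThan_empty_iff)
    also have "\<dots> = real I * (q / (8 * (ln q)\<^sup>2))" by simp
    also have "\<dots> \<le> (2 * ln q) * (q / (8 * (ln q)\<^sup>2))"
    proof (intro mult_right_mono)
      have "real I \<le> ln q / ln 2" using I1 by (simp add: log_def)
      also have "\<dots> \<le> ln q / (1/2)" using ln2_ge_two_thirds lnq by (intro divide_left_mono) auto
      finally show "real I \<le> 2 * ln q" by simp
    qed (use elim in auto)
    also have "\<dots> = q / (4 * ln q)" using lnq by (simp add: power2_eq_square)
    finally show False using lnq elim by (simp add: field_simps)
  qed
  then obtain i where i: "i < I" "q / (8 * (ln q)\<^sup>2) \<le> real (card (B i))" by blast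
  have "2 ^ Suc i \<le> q"
  proof -
    have "real (Suc i) \<le> log 2 q" using i I1 by simp
    then have "2 powr real (Suc i) \<le> q" using elim by (subst (asm) le_log_iff) auto
    then show ?thesis by (subst (asm) powr_realpow) auto
  qed
  moreover have "2 * (q / 2 ^ Suc i) \<le> q" using elim by (simp add: field_simps self_le_ge2_pow)
  ultimately show ?case using i(2) unfolding B_def
    by (intro exI[of _ "q / 2 ^ Suc i"]) (auto simp: field_simps)
qed

section \<open>Products of primes and their moments\<close>

text \<open>
  Powers of an exponential sum over \<open>Q\<close> are exponential sums over ordered lists, so no
  multiplicities have to be recorded.
\<close>

definition lists_of :: "'a set \<Rightarrow> nat \<Rightarrow> 'a list set" where
  "lists_of Q j = {xs. set xs \<subseteq> Q \<and> length xs = j}"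

lemma finite_lists_of: "finite Q \<Longrightarrow> finite (lists_of Q j)"
  and card_lists_of: "finite Q \<Longrightarrow> card (lists_of Q j) = card Q ^ j"
  by (simp_all add: lists_of_def finite_lists_length_eq card_lists_length_eq)

lemma lists_of_0 [simp]: "lists_of Q 0 = {[]}"
  by (auto simp: lists_of_def)

definition ln_prod :: "nat list \<Rightarrow> real" where
  "ln_prod xs = ln (real (prod_list xs))"

lemma prod_list_pos_nat: "\<forall>x\<in>set xs. (0::nat) < x \<Longrightarrow> 0 < prod_list xs"
  by (induction xs) auto

lemma exp_sum_power_lists:
  assumes "finite Q" "\<And>p. p \<in> Q \<Longrightarrow> p > 0"
  shows "exp_sum Q (\<lambda>p. ln (real p)) t ^ j = exp_sum (lists_of Q j) ln_prod t"
proof (induction j)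
  case 0
  then show ?case by (simp add: exp_sum_def ln_prod_def)
next
  case (Suc j)
  have "exp_sum Q (\<lambda>p. ln (real p)) t ^ Suc j
     = (\<Sum>(p, xs)\<in>Q \<times> lists_of Q j. cis (t * (ln (real p) + ln_prod xs)))"
    unfolding power_Suc Suc exp_sum_times by (simp add: exp_sum_def case_prod_unfold)
  also have "\<dots> = (\<Sum>xs\<in>lists_of Q (Suc j). cis (t * ln_prod xs))"
  proof (rule sum.reindex_bij_witness[of _ "\<lambda>xs. (hd xs, tl xs)" "\<lambda>(p, xs). p # xs"])
    fix a assume "a \<in> Q \<times> lists_of Q j"
    then obtain p xs where a: "a = (p, xs)" "p \<in> Q" "set xs \<subseteq> Q" by (auto simp: lists_of_def)
    then have "prod_list xs > 0" "p > 0" using assms by (auto intro!: prod_list_pos_nat)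
    then show "cis (t * ln_prod (case a of (p, xs) \<Rightarrow> p # xs)) = (case a of (p, xs) \<Rightarrow> cis (t * (ln (real p) + ln_prod xs)))"
      by (simp add: a ln_prod_def ln_mult)
  qed (auto simp: lists_of_def length_Suc_conv)
  finally show ?case by (simp add: exp_sum_def)
qed

definition drop_nth :: "nat \<Rightarrow> 'a list \<Rightarrow> 'a list" where
  "drop_nth i xs = take i xs @ drop (Suc i) xs"

lemma drop_nth_in_lists_of: "xs \<in> lists_of Q (Suc j) \<Longrightarrow> i < Suc j \<Longrightarrow> drop_nth i xs \<in> lists_of Q j"
  by (auto simp: lists_of_def drop_nth_def dest: in_set_takeD in_set_dropD)

lemma ln_prod_drop_nth:
  assumes "i < length xs" "\<forall>x\<in>set xs. 0 < x"
  shows "ln_prod xs = ln (real (xs ! i)) + ln_prod (drop_nth i xs)"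
proof -
  have "prod_list xs = xs ! i * prod_list (drop_nth i xs)"
    by (subst id_take_nth_drop[OF assms(1)]) (simp add: drop_nth_def mult_ac)
  moreover have "prod_list (drop_nth i xs) > 0"
    using assms(2) by (intro prod_list_pos_nat) (auto simp: drop_nth_def dest: in_set_takeD in_set_dropD)
  moreover have "xs ! i > 0" using assms by auto
  ultimately show ?thesis by (simp add: ln_prod_def ln_mult)
qed

lemma drop_nth_inject:
  assumes "length xs = length ys" "i < length xs" "xs ! i = ys ! i" "drop_nth i xs = drop_nth i ys"
  shows "xs = ys"
proof -
  have "length (take i xs) = length (take i ys)" using assms by simp
  then have "take i xs = take i ys" "drop (Suc i) xs = drop (Suc i) ys"
    using assms(4) unfolding drop_nth_def by (simp_all add: append_eq_append_conv)
  then show ?thesis using assms by (metis id_take_nth_drop)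
qed

lemma sum_union_le:
  fixes f :: "'a \<Rightarrow> real"
  assumes "finite A" "finite B" "\<And>x. f x \<ge> 0"
  shows "sum f (A \<union> B) \<le> sum f A + sum f B"
  using sum.union_inter[OF assms(1,2), of f] sum_nonneg[of "A \<inter> B" f] assms(3) by simp

lemma sum_UN_le:
  fixes f :: "'a \<Rightarrow> real"
  assumes "finite W" "\<And>w. w \<in> W \<Longrightarrow> finite (E w)" "\<And>x. f x \<ge> 0"
  shows "sum f (\<Union>w\<in>W. E w) \<le> (\<Sum>w\<in>W. sum f (E w))"
  using assms(1,2)
proof (induction W)
  case (insert w W)
  have "sum f (E w \<union> (\<Union>w\<in>W. E w)) \<le> sum f (E w) + sum f (\<Union>w\<in>W. E w)"
    using insert assms(3) by (intro sum_union_le) auto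
  then show ?case using insert by simp
qed simp

text \<open>
  If position \<open>i\<close> of \<open>xs\<close> and position \<open>i'\<close> of \<open>ys\<close> carry the same entry, deleting both leaves
  \<open>ln_prod xs - ln_prod ys\<close> unchanged. For fixed positions the deletion is injective once the deleted
  entry is remembered, which explains the factors \<open>j\<^sup>2\<close> and \<open>card Q\<close>.
\<close>

lemma sum_pairs_with_common_entry:
  fixes f :: "real \<Rightarrow> real"
  assumes Q: "finite Q" "\<And>p. p \<in> Q \<Longrightarrow> p > 0" and f: "\<And>u. f u \<ge> 0"
  shows "(\<Sum>(xs, ys)\<in>lists_of Q j \<times> lists_of Q j. f (ln_prod xs - ln_prod ys))
    \<le> (\<Sum>(xs, ys)\<in>{(xs, ys)\<in>lists_of Q j \<times> lists_of Q j. set xs \<inter> set ys = {}}. f (ln_prod xs - ln_prod ys))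
      + (real j)\<^sup>2 * real (card Q) * (\<Sum>(xs, ys)\<in>lists_of Q (j - 1) \<times> lists_of Q (j - 1). f (ln_prod xs - ln_prod ys))"
proof (cases j)
  case 0
  have "{(xs, ys)\<in>lists_of Q 0 \<times> lists_of Q 0. set xs \<inter> set ys = {}} = {([], [])}" by auto
  then show ?thesis using 0 by simp
next
  case (Suc k)
  let ?T = "lists_of Q j \<times> lists_of Q j" and ?U = "lists_of Q k \<times> lists_of Q k"
  let ?F = "\<lambda>(xs, ys). f (ln_prod xs - ln_prod ys)"
  define D where "D = {(xs, ys)\<in>?T. set xs \<inter> set ys = {}}"
  define E where "E = (\<lambda>(i, i'). {(xs, ys)\<in>?T. xs ! i = ys ! i'})"
  have finT: "finite ?T" using Q by (simp add: finite_lists_of)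
  have finE: "finite (E z)" for z using finT unfolding E_def by (cases z) (auto intro: finite_subset)
  have pos: "?F z \<ge> 0" for z using f by (cases z) simp
  have cover: "?T \<subseteq> D \<union> (\<Union>z\<in>{..<j} \<times> {..<j}. E z)"
  proof
    fix z assume z: "z \<in> ?T"
    obtain xs ys where zz: "z = (xs, ys)" by (cases z)
    have len: "length xs = j" "length ys = j" using z by (auto simp: zz lists_of_def)
    show "z \<in> D \<union> (\<Union>z\<in>{..<j} \<times> {..<j}. E z)"
    proof (cases "set xs \<inter> set ys = {}")
      case True
      then show ?thesis using z by (auto simp: zz D_def)
    next
      case False
      then obtain c where "c \<in> set xs" "c \<in> set ys" by auto
      then obtain i i' where "i < j" "i' < j" "xs ! i = c" "ys ! i' = c"
        using len by (auto simp: in_set_conv_nth)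
      then have "z \<in> E (i, i')" "(i, i') \<in> {..<j} \<times> {..<j}" using z by (auto simp: zz E_def)
      then show ?thesis by blast
    qed
  qed
  have "(\<Sum>z\<in>?T. ?F z) \<le> (\<Sum>z\<in>D \<union> (\<Union>z\<in>{..<j} \<times> {..<j}. E z). ?F z)"
    using finT finE pos cover by (intro sum_mono2) (auto simp: D_def intro: finite_subset[of _ ?T])
  also have "\<dots> \<le> (\<Sum>z\<in>D. ?F z) + (\<Sum>z\<in>(\<Union>z\<in>{..<j} \<times> {..<j}. E z). ?F z)"
  proof -
    have fD: "finite D" using finT by (rule rev_finite_subset) (auto simp: D_def)
    have fU: "finite (\<Union>z\<in>{..<j} \<times> {..<j}. E z)" using finE by auto
show ?thesis using fD fU pos by (rule sum_union_le)
  qed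
  also have "(\<Sum>z\<in>(\<Union>z\<in>{..<j} \<times> {..<j}. E z). ?F z) \<le> (\<Sum>w\<in>{..<j} \<times> {..<j}. \<Sum>z\<in>E w. ?F z)"
    by (rule sum_UN_le) (use finE pos in blast)+
  also have "\<dots> \<le> (\<Sum>w\<in>{..<j} \<times> {..<j}. real (card Q) * (\<Sum>z\<in>?U. ?F z))"
  proof (rule sum_mono)
    fix w assume "w \<in> {..<j} \<times> {..<j}"
    then obtain i i' where w: "w = (i, i')" "i < j" "i' < j" by auto
    define g where "g = (\<lambda>(xs, ys). (xs ! i, drop_nth i xs, drop_nth i' ys) :: nat \<times> nat list \<times> nat list)"
    have inj: "inj_on g (E w)"
    proof (rule inj_onI)
      fix a b assume a: "a \<in> E w" and b: "b \<in> E w" and ab: "g a = g b"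
      obtain xs ys xs' ys' where [simp]: "a = (xs, ys)" "b = (xs', ys')" by (cases a, cases b)
      have *: "xs ! i = ys ! i'" "xs' ! i = ys' ! i'" "length xs = j" "length ys = j" "length xs' = j" "length ys' = j"
        using a b unfolding E_def w by (auto simp: lists_of_def)
      have "xs = xs'" using drop_nth_inject[of xs xs' i] * w ab by (simp add: g_def)
      moreover have "ys = ys'" using drop_nth_inject[of ys ys' i'] * w ab by (simp add: g_def)
      ultimately show "a = b" by simp
    qed
    have img: "g ` E w \<subseteq> Q \<times> ?U"
    proof
      fix y assume "y \<in> g ` E w"
      then obtain xs ys where *: "xs \<in> lists_of Q j" "ys \<in> lists_of Q j" "y = (xs ! i, drop_nth i xs, drop_nth i' ys)"
        unfolding E_def w g_def by auto
      have "xs ! i \<in> Q" using * w by (auto simp: lists_of_def)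
      then show "y \<in> Q \<times> ?U" using * w Suc drop_nth_in_lists_of[of xs Q k i] drop_nth_in_lists_of[of ys Q k i'] by auto
    qed
    have "(\<Sum>z\<in>E w. ?F z) = (\<Sum>z\<in>E w. (\<lambda>(c, z). ?F z) (g z))"
    proof (rule sum.cong[OF refl])
      fix z assume "z \<in> E w"
      then obtain xs ys where z: "z = (xs, ys)" "xs \<in> lists_of Q j" "ys \<in> lists_of Q j" "xs ! i = ys ! i'"
        unfolding E_def w by auto
      have "ln_prod xs - ln_prod ys = ln_prod (drop_nth i xs) - ln_prod (drop_nth i' ys)"
        using ln_prod_drop_nth[of i xs] ln_prod_drop_nth[of i' ys] z w Q(2) by (auto simp: lists_of_def subset_eq)
      then show "?F z = (\<lambda>(c, z). ?F z) (g z)" by (simp add: z g_def)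
    qed
    also have "\<dots> = (\<Sum>y\<in>g ` E w. (\<lambda>(c, z). ?F z) y)" using inj by (simp add: sum.reindex)
    also have "\<dots> \<le> (\<Sum>y\<in>Q \<times> ?U. (\<lambda>(c, z). ?F z) y)"
      using img f Q by (intro sum_mono2) (auto simp: finite_lists_of)
    also have "\<dots> = (\<Sum>c\<in>Q. \<Sum>z\<in>?U. ?F z)" unfolding sum.cartesian_product by (simp add: case_prod_unfold)
    finally show "(\<Sum>z\<in>E w. ?F z) \<le> real (card Q) * (\<Sum>z\<in>?U. ?F z)" by simp
  qed
  also have "\<dots> = (real j)\<^sup>2 * real (card Q) * (\<Sum>z\<in>?U. ?F z)" by (simp add: power2_eq_square)
  finally show ?thesis unfolding D_def using Suc by simp
qed

text \<open>
  Rounding to multiples of \<open>g\<close> is injective on \<open>S\<close>.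
\<close>

lemma card_separated_reals:
  fixes S :: "real set"
  assumes "g > 0" "w \<ge> 0" "\<And>s. s \<in> S \<Longrightarrow> \<bar>s - \<alpha>\<bar> \<le> w"
    and sep: "\<And>s s'. s \<in> S \<Longrightarrow> s' \<in> S \<Longrightarrow> s \<noteq> s' \<Longrightarrow> g \<le> \<bar>s - s'\<bar>"
  shows "finite S" "real (card S) \<le> 1 + 2 * w / g"
proof -
  define b where "b = (\<lambda>s. nat \<lfloor>(s - (\<alpha> - w)) / g\<rfloor>)"
  have nn: "(s - (\<alpha> - w)) / g \<ge> 0" if "s \<in> S" for s using assms(1) assms(3)[OF that] by (auto simp: abs_le_iff)
  have inj: "inj_on b S"
  proof (rule inj_onI, rule ccontr)
    fix s s' assume s: "s \<in> S" "s' \<in> S" "b s = b s'" "s \<noteq> s'"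
    have "\<bar>(s - (\<alpha> - w)) / g - (s' - (\<alpha> - w)) / g\<bar> < 1"
      using s(3) nn[OF s(1)] nn[OF s(2)] unfolding b_def by linarith
    moreover have "(s - (\<alpha> - w)) / g - (s' - (\<alpha> - w)) / g = (s - s') / g"
      by (simp add: diff_divide_distrib[symmetric])
    ultimately have "\<bar>s - s'\<bar> / g < 1" using assms(1) by (simp add: abs_divide)
    then have "\<bar>s - s'\<bar> < g" using assms(1) by (simp add: divide_less_eq)
    then show False using sep[OF s(1,2,4)] by simp
  qed
  have img: "b ` S \<subseteq> {..nat \<lfloor>2 * w / g\<rfloor>}"
  proof
    fix y assume "y \<in> b ` S"
    then obtain s where s: "s \<in> S" "y = b s" by auto
    have "(s - (\<alpha> - w)) / g \<le> 2 * w / g" using assms(1) assms(3)[OF s(1)] by (intro divide_right_mono) auto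
    then show "y \<in> {..nat \<lfloor>2 * w / g\<rfloor>}" unfolding s(2) b_def by (simp add: floor_mono nat_mono)
  qed
  show "finite S" using inj img by (rule inj_on_finite) simp
  have "card S \<le> card {..nat \<lfloor>2 * w / g\<rfloor>}" using inj img by (intro card_inj_on_le) auto
  then have "real (card S) \<le> 1 + real (nat \<lfloor>2 * w / g\<rfloor>)" by simp
  also have "real (nat \<lfloor>2 * w / g\<rfloor>) \<le> 2 * w / g" using assms by (intro of_nat_floor) auto
  finally show "real (card S) \<le> 1 + 2 * w / g" by simp
qed

lemma abs_ln_diff_ge:
  fixes A B :: nat
  assumes "A > 0" "B > 0" "A \<noteq> B" "real A \<le> Z" "real B \<le> Z"
  shows "1 / Z \<le> \<bar>ln (real A) - ln (real B)\<bar>"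
proof -
  have *: "1 / Z \<le> ln (real b) - ln (real a)" if "a > 0" "a < b" "real b \<le> Z" for a b :: nat
  proof -
    have "1 / Z \<le> 1 / real b" using that by (intro divide_left_mono) auto
    also have "\<dots> \<le> 1 - real a / real b" using that by (simp add: field_simps)
    also have "\<dots> \<le> - ln (real a / real b)" using that ln_le_minus_one[of "real a / real b"] by simp
    also have "\<dots> = ln (real b) - ln (real a)" using that by (simp add: ln_div)
    finally show ?thesis .
  qed
  show ?thesis using *[of A B] *[of B A] assms by (cases "A < B") (auto simp: abs_if)
qed

lemma card_le_fibres:
  assumes "finite (f ` S)" "\<And>y. y \<in> f ` S \<Longrightarrow> finite {x\<in>S. f x = y} \<and> card {x\<in>S. f x = y} \<le> c"
  shows "card S \<le> c * card (f ` S)"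
proof -
  have "card S = card (\<Union>y\<in>f ` S. {x\<in>S. f x = y})" by (rule arg_cong[of _ _ card]) auto
  also have "\<dots> \<le> (\<Sum>y\<in>f ` S. card {x\<in>S. f x = y})" using assms(1) by (rule card_UN_le)
  also have "\<dots> \<le> (\<Sum>y\<in>f ` S. c)" using assms(2) by (intro sum_mono) auto
  finally show ?thesis by (simp add: mult.commute)
qed

lemma card_prime_lists_same_product:
  fixes Q :: "nat set"
  assumes "finite Q" "\<And>p. p \<in> Q \<Longrightarrow> prime p"
  shows "card {xs\<in>lists_of Q j. prod_list xs = n} \<le> fact j"
proof (cases "{xs\<in>lists_of Q j. prod_list xs = n} = {}")
  case False
  have eq: "mset xs = prime_factorization n" if "xs \<in> lists_of Q j" "prod_list xs = n" for xs
  proof -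
    have "prime_factorization (prod_mset (mset xs)) = mset xs"
      using that(1) assms by (intro prime_factorization_prod_mset_primes) (auto simp: lists_of_def)
    then show ?thesis using that by (simp add: prod_mset_prod_list)
  qed
  then have sub: "{xs\<in>lists_of Q j. prod_list xs = n} \<subseteq> permutations_of_multiset (prime_factorization n)"
    by (auto simp: permutations_of_multiset_def)
  obtain xs where xs: "xs \<in> lists_of Q j" "prod_list xs = n" using False by blast
  have "size (prime_factorization n) = j" using xs(1) by (simp add: eq[OF xs, symmetric] lists_of_def)
  then have "card (permutations_of_multiset (prime_factorization n)) \<le> fact j"
    by (simp add: card_permutations_of_multiset)
  then show ?thesis using card_mono[OF _ sub] by fastforce
next
  case True
  show ?thesis unfolding True by simp
qed

text \<open>
  A product of primes determines its list up to order, and the logarithms of distinct integers up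
  to \<open>Z\<close> are \<open>1/Z\<close> apart.
\<close>

lemma card_prime_lists_near:
  assumes Q: "finite Q" "\<And>p. p \<in> Q \<Longrightarrow> prime p" and Z: "\<And>xs. xs \<in> lists_of Q m \<Longrightarrow> real (prod_list xs) \<le> Z"
    and "Z > 0" "w \<ge> 0"
  shows "real (card {ys\<in>lists_of Q m. \<bar>ln_prod ys - \<beta>\<bar> \<le> w}) \<le> fact m * (1 + 2 * w * Z)"
proof -
  define S where "S = {ys\<in>lists_of Q m. \<bar>ln_prod ys - \<beta>\<bar> \<le> w}"
  have pos: "prod_list ys > 0" if "ys \<in> lists_of Q m" for ys
    using that Q by (intro prod_list_pos_nat) (auto simp: lists_of_def prime_gt_0_nat)
  have finS: "finite S" unfolding S_def using Q by (simp add: finite_lists_of)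
  have "card S \<le> fact m * card (prod_list ` S)"
  proof (rule card_le_fibres)
    fix y
    have "{x\<in>S. prod_list x = y} \<subseteq> {xs\<in>lists_of Q m. prod_list xs = y}" unfolding S_def by auto
    then have "card {x\<in>S. prod_list x = y} \<le> card {xs\<in>lists_of Q m. prod_list xs = y}"
      using Q(1) by (intro card_mono) (auto simp: finite_lists_of)
    then show "finite {x\<in>S. prod_list x = y} \<and> card {x\<in>S. prod_list x = y} \<le> fact m"
      using card_prime_lists_same_product[OF Q, of m y] finS by simp
  qed (use finS in auto)
  also have "card (prod_list ` S) = card ((\<lambda>n. ln (real n)) ` prod_list ` S)"
  proof (rule card_image[symmetric], rule inj_onI)
    fix a b assume "a \<in> prod_list ` S" "b \<in> prod_list ` S" "ln (real a) = ln (real b)"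
    then show "a = b" using pos by (auto simp: S_def)
  qed
  finally have c: "real (card S) \<le> fact m * real (card ((\<lambda>n. ln (real n)) ` prod_list ` S))"
    by (metis of_nat_fact of_nat_le_iff of_nat_mult)
  have "real (card ((\<lambda>n. ln (real n)) ` prod_list ` S)) \<le> 1 + 2 * w / (1 / Z)"
  proof (rule card_separated_reals(2)[where \<alpha> = \<beta>])
    fix s s' assume "s \<in> (\<lambda>n. ln (real n)) ` prod_list ` S" "s' \<in> (\<lambda>n. ln (real n)) ` prod_list ` S" "s \<noteq> s'"
    then show "1 / Z \<le> \<bar>s - s'\<bar>" using pos Z by (auto simp: S_def intro!: abs_ln_diff_ge)
  qed (use assms in \<open>auto simp: S_def ln_prod_def\<close>)
  then have "fact m * real (card ((\<lambda>n. ln (real n)) ` prod_list ` S)) \<le> fact m * (1 + 2 * w * Z)"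
    by (intro mult_left_mono) auto
  with c show ?thesis unfolding S_def by linarith
qed

text \<open>
  Lists of primes without a common entry have coprime products, so the fractions of these products are
  reduced. Distinct pairs of products therefore give distinct fractions, and the logarithms of distinct
  fractions with terms up to \<open>Z\<close> are \<open>1/Z\<^sup>2\<close> apart.
\<close>

lemma card_coprime_prime_list_pairs_near:
  assumes Q: "finite Q" "\<And>p. p \<in> Q \<Longrightarrow> prime p" and Z: "\<And>xs. xs \<in> lists_of Q j \<Longrightarrow> real (prod_list xs) \<le> Z"
    and "Z > 0" "w \<ge> 0"
  shows "real (card {(xs, ys)\<in>lists_of Q j \<times> lists_of Q j. set xs \<inter> set ys = {} \<and> \<bar>ln_prod xs - ln_prod ys - \<beta>\<bar> \<le> w})
    \<le> (fact j)\<^sup>2 * (1 + 2 * w * Z\<^sup>2)"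
proof -
  define S where "S = {(xs, ys)\<in>lists_of Q j \<times> lists_of Q j. set xs \<inter> set ys = {} \<and> \<bar>ln_prod xs - ln_prod ys - \<beta>\<bar> \<le> w}"
  define g where "g = (\<lambda>(xs, ys). (prod_list xs, prod_list ys) :: nat \<times> nat)"
  define L where "L = (\<lambda>(a, b). ln (real a) - ln (real b) :: real)"
  have pos: "prod_list ys > 0" if "ys \<in> lists_of Q j" for ys
    using that Q by (intro prod_list_pos_nat) (auto simp: lists_of_def prime_gt_0_nat)
  have finS: "finite S" 
    by (rule finite_subset[of _ "lists_of Q j \<times> lists_of Q j"]) (use Q in \<open>auto simp: S_def finite_lists_of\<close>)
  have cop: "coprime (prod_list xs) (prod_list ys)" if "set xs \<subseteq> Q" "set ys \<subseteq> Q" "set xs \<inter> set ys = {}" for xs ys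
  proof -
    have c1: "coprime x (prod_list zs)" if "x \<in> Q" "set zs \<subseteq> Q" "x \<notin> set zs" for x zs
      using that(2,3) by (induction zs) (use that(1) Q(2) in \<open>auto simp: primes_coprime\<close>)
    have "coprime (prod_list zs) (prod_list ys)" if zs: "set zs \<subseteq> set xs" for zs
      using zs
    proof (induction zs)
      case (Cons a zs)
      have "coprime a (prod_list ys)"
        using Cons.prems \<open>set xs \<subseteq> Q\<close> \<open>set ys \<subseteq> Q\<close> \<open>set xs \<inter> set ys = {}\<close> by (intro c1) auto
      then show ?case using Cons by simp
    qed simp
    then show ?thesis by blast
  qed
  define A where "A = g ` S"
  have gS: "coprime a b \<and> a > 0 \<and> b > 0 \<and> real a \<le> Z \<and> real b \<le> Z \<and> \<bar>L (a, b) - \<beta>\<bar> \<le> w" if "(a, b) \<in> A" for a b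
    using that cop pos Z unfolding A_def S_def g_def L_def by (auto simp: lists_of_def ln_prod_def)
  have "card S \<le> (fact j)\<^sup>2 * card A"
    unfolding A_def
  proof (rule card_le_fibres)
    fix y :: "nat \<times> nat"
    obtain a b where y: "y = (a, b)" by (cases y)
    let ?A = "{xs\<in>lists_of Q j. prod_list xs = a}" and ?B = "{xs\<in>lists_of Q j. prod_list xs = b}"
    have fin: "finite ?A" "finite ?B" using Q by (auto simp: finite_lists_of)
    have "{x\<in>S. g x = y} \<subseteq> ?A \<times> ?B" unfolding S_def g_def y by auto
    then have "card {x\<in>S. g x = y} \<le> card (?A \<times> ?B)" using fin by (intro card_mono) auto
    also have "\<dots> = card ?A * card ?B" by (rule card_cartesian_product)
    also have "\<dots> \<le> fact j * fact j" by (intro mult_mono card_prime_lists_same_product Q) auto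
    finally show "finite {x\<in>S. g x = y} \<and> card {x\<in>S. g x = y} \<le> (fact j)\<^sup>2"
      using finS by (simp add: power2_eq_square)
  qed (use finS in auto)
  moreover have diff: "a * b' \<noteq> a' * b" if "(a, b) \<in> A" "(a', b') \<in> A" "(a, b) \<noteq> (a', b')" for a b a' b'
  proof
    assume "a * b' = a' * b"
    then have "a = a' \<and> b' = b"
      using coprime_crossproduct_nat[of a b a' b'] gS[OF that(1)] gS[OF that(2)] by (simp add: mult.commute coprime_commute)
    then show False using that(3) by simp
  qed
  have sep: "1 / Z\<^sup>2 \<le> \<bar>L (a, b) - L (a', b')\<bar>" if "(a, b) \<in> A" "(a', b') \<in> A" "(a, b) \<noteq> (a', b')" for a b a' b'
  proof -
    note A = gS[OF that(1)] and B = gS[OF that(2)]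
    have "1 / Z\<^sup>2 \<le> \<bar>ln (real (a * b')) - ln (real (a' * b))\<bar>"
    proof (rule abs_ln_diff_ge)
      show "real (a * b') \<le> Z\<^sup>2" "real (a' * b) \<le> Z\<^sup>2"
        using A B by (auto simp: power2_eq_square intro!: mult_mono)
      show "a * b' \<noteq> a' * b" using diff that by blast
    qed (use A B in auto)
    also have "ln (real (a * b')) - ln (real (a' * b)) = L (a, b) - L (a', b')"
      using A B by (simp add: L_def ln_mult)
    finally show ?thesis .
  qed
  have inj: "inj_on L (A)"
  proof (rule inj_onI, rule ccontr)
    fix p p' assume p: "p \<in> A" "p' \<in> A" "L p = L p'" "p \<noteq> p'"
    obtain a b a' b' where "p = (a, b)" "p' = (a', b')" by (cases p, cases p')
    then have "1 / Z\<^sup>2 \<le> 0" using sep[of a b a' b'] p by simp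
    moreover have "1 / Z\<^sup>2 > 0" using assms(4) by simp
    ultimately show False by linarith
  qed
  have "real (card (L ` A)) \<le> 1 + 2 * w / (1 / Z\<^sup>2)"
  proof (rule card_separated_reals(2)[where \<alpha> = \<beta>])
    show "1 / Z\<^sup>2 > 0" using assms by simp
    show "\<bar>s - \<beta>\<bar> \<le> w" if s: "s \<in> L ` A" for s
    proof -
      obtain p where p: "p \<in> A" "s = L p" using s by blast
      then have "(fst p, snd p) \<in> A" by simp
      from gS[OF this] show ?thesis using p(2) by simp
    qed
    show "1 / Z\<^sup>2 \<le> \<bar>s - s'\<bar>" if s: "s \<in> L ` A" "s' \<in> L ` A" "s \<noteq> s'" for s s'
    proof -
      obtain p p' where p: "p \<in> A" "s = L p" "p' \<in> A" "s' = L p'" using s by blast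
      have "p \<noteq> p'" using s(3) p(2,4) by auto
      then have "(fst p, snd p) \<in> A" "(fst p', snd p') \<in> A" "(fst p, snd p) \<noteq> (fst p', snd p')"
        using p(1,3) by (simp_all add: prod_eq_iff)
      from sep[OF this] show ?thesis using p(2,4) by simp
    qed
  qed (use assms in auto)
  then have "real (card (A)) \<le> 1 + 2 * w * Z\<^sup>2" using card_image[OF inj] by simp
  then have "(fact j)\<^sup>2 * real (card (A)) \<le> (fact j)\<^sup>2 * (1 + 2 * w * Z\<^sup>2)"
    by (intro mult_left_mono) auto
  moreover have "real (card S) \<le> (fact j)\<^sup>2 * real (card (A))"
    using \<open>card S \<le> (fact j)\<^sup>2 * card (A)\<close> by (metis of_nat_fact of_nat_le_iff of_nat_mult of_nat_power)
  ultimately show ?thesis unfolding S_def by linarith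
qed

text \<open>
  Here \<open>exp_sum \<Theta> uminus t\<close> is the sum of \<open>cis (- t * \<tau>)\<close> over the points \<open>\<tau>\<close>.
\<close>

lemma mean_square_weighted_power:
  assumes h: "h > 0" and Q: "finite Q" "\<And>p. p \<in> Q \<Longrightarrow> p > 0"
  shows "(\<integral>t. (norm (exp_sum Q (\<lambda>p. ln (real p)) t ^ j * exp_sum \<Theta> uminus t))\<^sup>2 \<partial>gauss_measure h)
    = (\<Sum>(xs, ys)\<in>lists_of Q j \<times> lists_of Q j. \<Sum>(\<tau>, \<tau>')\<in>\<Theta> \<times> \<Theta>.
         gauss_kernel h (ln_prod xs - ln_prod ys - (\<tau> - \<tau>')))"
proof -
  let ?T = "lists_of Q j"
  have power: "exp_sum Q (\<lambda>p. ln (real p)) t ^ j = exp_sum ?T ln_prod t" for t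
    using Q by (rule exp_sum_power_lists)
  have "(\<integral>t. (norm (exp_sum Q (\<lambda>p. ln (real p)) t ^ j * exp_sum \<Theta> uminus t))\<^sup>2 \<partial>gauss_measure h)
    = (\<Sum>a\<in>?T \<times> \<Theta>. \<Sum>b\<in>?T \<times> \<Theta>. gauss_kernel h ((case a of (xs, \<tau>) \<Rightarrow> ln_prod xs + - \<tau>) - (case b of (ys, \<tau>') \<Rightarrow> ln_prod ys + - \<tau>')))"
    unfolding power exp_sum_times by (rule mean_square_exp_sum[OF h])
  also have "\<dots> = (\<Sum>xs\<in>?T. \<Sum>\<tau>\<in>\<Theta>. \<Sum>ys\<in>?T. \<Sum>\<tau>'\<in>\<Theta>. gauss_kernel h (ln_prod xs - ln_prod ys - (\<tau> - \<tau>')))"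
    by (simp add: sum.cartesian_product' algebra_simps)
  also have "\<dots> = (\<Sum>xs\<in>?T. \<Sum>ys\<in>?T. \<Sum>\<tau>\<in>\<Theta>. \<Sum>\<tau>'\<in>\<Theta>. gauss_kernel h (ln_prod xs - ln_prod ys - (\<tau> - \<tau>')))"
    by (intro sum.cong refl sum.swap)
  finally show ?thesis by (simp add: sum.cartesian_product')
qed

lemma power_le_shift:
  fixes u c :: real
  assumes "u \<ge> 0" "c > 0"
  shows "u ^ k \<le> u ^ Suc k / c + c ^ k"
proof (cases "u \<le> c")
  case True
  then have "u ^ k \<le> c ^ k" using assms by (intro power_mono) auto
  moreover have "u ^ Suc k / c \<ge> 0" using assms by simp
  ultimately show ?thesis by linarith
next
  case False
  then have "u ^ k * 1 \<le> u ^ k * (u / c)" using assms by (intro mult_left_mono) auto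
  moreover have "c ^ k \<ge> 0" using assms by simp
  ultimately show ?thesis by (simp add: mult.commute)
qed

text \<open>
  Cancelling a common prime bounds the moment of order \<open>j\<close> by the contribution \<open>D\<close> of disjoint lists
  and \<open>c/2\<close> times the moment of order \<open>j - 1\<close>, where \<open>c = 2 * j\<^sup>2 * card Q\<close>. The lower moment is not
  estimated by iteration, which would lose a power of \<open>card \<Theta>\<close>, but by \<open>power_le_shift\<close> inside the
  integral: this returns half of the moment of order \<open>j\<close>, to be absorbed, and a multiple of the
  moment of order \<open>0\<close>.
\<close>

lemma weighted_power_moment_recursion:
  fixes Q :: "nat set"
  assumes h: "h > 0" and Q: "finite Q" "\<And>p. p \<in> Q \<Longrightarrow> p > 0" "card Q > 0" and T: "finite \<Theta>"
  defines "M \<equiv> \<lambda>j. (\<integral>t. (norm (exp_sum Q (\<lambda>p. ln (real p)) t ^ j * exp_sum \<Theta> uminus t))\<^sup>2 \<partial>gauss_measure h)"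
  defines "D \<equiv> \<lambda>j. (\<Sum>(xs, ys)\<in>{(xs, ys)\<in>lists_of Q j \<times> lists_of Q j. set xs \<inter> set ys = {}}. \<Sum>(\<tau>, \<tau>')\<in>\<Theta> \<times> \<Theta>.
         gauss_kernel h (ln_prod xs - ln_prod ys - (\<tau> - \<tau>')))"
  shows "M j \<le> 2 * D j + (2 * (real j)\<^sup>2 * real (card Q)) ^ j * M 0"
proof (cases j)
  case 0
  have "D 0 \<ge> 0" unfolding D_def by (intro sum_nonneg) (auto intro!: sum_nonneg gauss_kernel_nonneg)
  then show ?thesis using 0 by simp
next
  case (Suc k)
  \<comment> \<open>Twice the factor of the lower moment, so that exactly half of the moment of order \<open>j\<close> returns.\<close>
  define c where "c = 2 * (real j)\<^sup>2 * real (card Q)"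
  have c: "c > 0" using Q Suc by (simp add: c_def)
  define P where "P = exp_sum Q (\<lambda>p. ln (real p))"
  define G where "G = exp_sum \<Theta> uminus"
  have [measurable]: "P \<in> borel_measurable borel" "G \<in> borel_measurable borel" unfolding P_def G_def by auto
  have int: "integrable (gauss_measure h) (\<lambda>t. (norm (P t ^ i * G t))\<^sup>2)" for i
  proof (rule integrable_gauss_measure_bounded[OF h, of _ "(real (card Q) ^ i * real (card \<Theta>))\<^sup>2"])
    fix t
    have "norm (P t ^ i * G t) \<le> real (card Q) ^ i * real (card \<Theta>)"
      unfolding norm_mult norm_power P_def G_def by (intro mult_mono power_mono norm_exp_sum_le) auto
    then show "norm ((norm (P t ^ i * G t))\<^sup>2) \<le> (real (card Q) ^ i * real (card \<Theta>))\<^sup>2"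
      by (simp add: power_mono)
  qed measurable
  have M_eq: "M i = (\<Sum>(xs, ys)\<in>lists_of Q i \<times> lists_of Q i. \<Sum>(\<tau>, \<tau>')\<in>\<Theta> \<times> \<Theta>.
         gauss_kernel h (ln_prod xs - ln_prod ys - (\<tau> - \<tau>')))" for i
    unfolding M_def using h Q(1,2) by (rule mean_square_weighted_power)
  have "M j \<le> D j + (real j)\<^sup>2 * real (card Q) * M (j - 1)"
    unfolding M_eq D_def
    by (rule sum_pairs_with_common_entry[OF Q(1,2), where f = "\<lambda>u. \<Sum>(\<tau>, \<tau>')\<in>\<Theta> \<times> \<Theta>. gauss_kernel h (u - (\<tau> - \<tau>'))"])
       (auto intro!: sum_nonneg gauss_kernel_nonneg)
  also have "(real j)\<^sup>2 * real (card Q) = c / 2" by (simp add: c_def)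
  also have "M (j - 1) \<le> M j / c + c ^ k * M 0"
  proof -
    have "M k \<le> (\<integral>t. (norm (P t ^ j * G t))\<^sup>2 / c + c ^ k * (norm (P t ^ 0 * G t))\<^sup>2 \<partial>gauss_measure h)"
      unfolding M_def P_def[symmetric] G_def[symmetric]
    proof (rule integral_mono)
      fix t
      have "((norm (P t))\<^sup>2) ^ k * (norm (G t))\<^sup>2 \<le> (((norm (P t))\<^sup>2) ^ Suc k / c + c ^ k) * (norm (G t))\<^sup>2"
        using c by (intro mult_right_mono power_le_shift) auto
      moreover have sq: "(norm (P t ^ i * G t))\<^sup>2 = ((norm (P t))\<^sup>2) ^ i * (norm (G t))\<^sup>2" for i
        by (simp add: norm_mult norm_power power_mult_distrib flip: power_mult) (simp add: mult.commute)
      ultimately show "(norm (P t ^ k * G t))\<^sup>2 \<le> (norm (P t ^ j * G t))\<^sup>2 / c + c ^ k * (norm (P t ^ 0 * G t))\<^sup>2"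
        unfolding sq Suc by (simp add: distrib_right)
    qed (use int[of k] int[of j] int[of 0] in auto)
    also have "\<dots> = M j / c + c ^ k * M 0"
      unfolding M_def P_def[symmetric] G_def[symmetric] using int[of j] int[of 0] by simp
    finally show ?thesis using Suc by simp
  qed
  finally have "M j \<le> D j + c / 2 * (M j / c + c ^ k * M 0)" using c by (simp add: mult_left_mono)
  also have "\<dots> = D j + M j / 2 + c ^ j * M 0 / 2" using c Suc by (simp add: field_simps)
  finally have "M j \<le> 2 * D j + c ^ j * M 0" by simp
  then show ?thesis unfolding c_def .
qed

lemma sum_gauss_kernel_separated:
  fixes \<Theta> :: "real set"
  assumes h: "h > 0" "V \<ge> 0" and T: "finite \<Theta>"
    and sep: "\<And>\<tau> \<tau>'. \<tau> \<in> \<Theta> \<Longrightarrow> \<tau>' \<in> \<Theta> \<Longrightarrow> \<tau> \<noteq> \<tau>' \<Longrightarrow> h * V \<le> \<bar>\<tau> - \<tau>'\<bar>"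
  shows "(\<Sum>(\<tau>, \<tau>')\<in>\<Theta> \<times> \<Theta>. gauss_kernel h (- (\<tau> - \<tau>')))
    \<le> real (card \<Theta>) + (real (card \<Theta>))\<^sup>2 * exp (- (V\<^sup>2 / 2))"
proof -
  have "(\<Sum>(\<tau>, \<tau>')\<in>\<Theta> \<times> \<Theta>. gauss_kernel h (- (\<tau> - \<tau>')))
      = (\<Sum>\<tau>\<in>\<Theta>. \<Sum>\<tau>'\<in>\<Theta>. gauss_kernel h (- (\<tau> - \<tau>')))" by (simp add: sum.cartesian_product)
  also have "\<dots> \<le> (\<Sum>\<tau>\<in>\<Theta>. \<Sum>\<tau>'\<in>\<Theta>. (if \<tau> = \<tau>' then 1 else 0) + exp (- (V\<^sup>2 / 2)))"
  proof (intro sum_mono)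
    fix \<tau> \<tau>' assume t: "\<tau> \<in> \<Theta>" "\<tau>' \<in> \<Theta>"
    show "gauss_kernel h (- (\<tau> - \<tau>')) \<le> (if \<tau> = \<tau>' then 1 else 0) + exp (- (V\<^sup>2 / 2))"
    proof (cases "\<tau> = \<tau>'")
      case True
      then show ?thesis by (simp add: gauss_kernel_def)
    next
      case False
      then show ?thesis using gauss_kernel_le[OF h, of "- (\<tau> - \<tau>')"] sep[OF t False] by (simp add: abs_minus_commute)
    qed
  qed
  also have "\<dots> = real (card \<Theta>) + (real (card \<Theta>))\<^sup>2 * exp (- (V\<^sup>2 / 2))"
    using T by (simp add: sum.distrib distrib_left power2_eq_square)
  finally show ?thesis .
qed

text \<open>
  Disjoint lists are counted by the spacing of reduced fractions, for each pair of points separately.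
  The moment of order \<open>0\<close> is essentially the diagonal, because the points are separated by the width of
  the kernel. The terms with \<open>exp (- (V\<^sup>2 / 2))\<close> come from the tail of the Gaussian beyond \<open>V\<close> standard
  deviations.
\<close>

theorem weighted_prime_power_moment:
  fixes Q :: "nat set" and \<Theta> :: "real set"
  assumes h: "h > 0" "V \<ge> 0" and Q: "finite Q" "\<And>p. p \<in> Q \<Longrightarrow> prime p" "card Q > 0" and T: "finite \<Theta>"
    and Z: "Z > 0" "\<And>xs. xs \<in> lists_of Q j \<Longrightarrow> real (prod_list xs) \<le> Z"
    and sep: "\<And>\<tau> \<tau>'. \<tau> \<in> \<Theta> \<Longrightarrow> \<tau>' \<in> \<Theta> \<Longrightarrow> \<tau> \<noteq> \<tau>' \<Longrightarrow> h * V \<le> \<bar>\<tau> - \<tau>'\<bar>"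
  defines "R \<equiv> real (card \<Theta>)" and "e \<equiv> exp (- (V\<^sup>2 / 2))"
  shows "(\<integral>t. (norm (exp_sum Q (\<lambda>p. ln (real p)) t ^ j * exp_sum \<Theta> uminus t))\<^sup>2 \<partial>gauss_measure h)
    \<le> 2 * R\<^sup>2 * ((fact j)\<^sup>2 * (1 + 2 * (h * V) * Z\<^sup>2) + real (card Q) ^ (2 * j) * e)
      + (2 * (real j)\<^sup>2 * real (card Q)) ^ j * (R + R\<^sup>2 * e)"
proof -
  have pos: "p > 0" if "p \<in> Q" for p using Q(2)[OF that] by (rule prime_gt_0_nat)
  let ?U = "{(xs, ys)\<in>lists_of Q j \<times> lists_of Q j. set xs \<inter> set ys = {}}"
  have finU: "finite ?U"
    by (rule finite_subset[of _ "lists_of Q j \<times> lists_of Q j"]) (use Q in \<open>auto simp: finite_lists_of\<close>)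
  have cardU: "real (card ?U) \<le> real (card Q) ^ (2 * j)"
  proof -
    have "card ?U \<le> card (lists_of Q j \<times> lists_of Q j)"
      by (rule card_mono) (use Q in \<open>auto simp: finite_lists_of\<close>)
    also have "\<dots> = card Q ^ (2 * j)" using Q by (simp add: card_cartesian_product card_lists_of power_add[symmetric] mult_2)
    finally show ?thesis by (simp only: of_nat_power[symmetric] of_nat_le_iff)
  qed
  have inner: "(\<Sum>(xs, ys)\<in>?U. gauss_kernel h (ln_prod xs - ln_prod ys - \<beta>))
      \<le> (fact j)\<^sup>2 * (1 + 2 * (h * V) * Z\<^sup>2) + real (card Q) ^ (2 * j) * e" for \<beta>
  proof -
    have "(\<Sum>(xs, ys)\<in>?U. gauss_kernel h (ln_prod xs - ln_prod ys - \<beta>))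
       \<le> (\<Sum>(xs, ys)\<in>?U. (if \<bar>ln_prod xs - ln_prod ys - \<beta>\<bar> \<le> h * V then 1 else 0) + e)"
    proof (rule sum_mono)
      fix p
      show "(case p of (xs, ys) \<Rightarrow> gauss_kernel h (ln_prod xs - ln_prod ys - \<beta>))
        \<le> (case p of (xs, ys) \<Rightarrow> (if \<bar>ln_prod xs - ln_prod ys - \<beta>\<bar> \<le> h * V then 1 else 0) + e)"
        unfolding e_def by (cases p) (simp only: prod.case gauss_kernel_le_indicator[OF h])
    qed
    also have "\<dots> = (\<Sum>p\<in>?U. (if (\<lambda>(xs, ys). \<bar>ln_prod xs - ln_prod ys - \<beta>\<bar> \<le> h * V) p then 1 else 0) + e)"
      by (rule sum.cong) auto
    also have "\<dots> = real (card {p\<in>?U. (\<lambda>(xs, ys). \<bar>ln_prod xs - ln_prod ys - \<beta>\<bar> \<le> h * V) p}) + real (card ?U) * e"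
      using finU by (simp add: sum.distrib flip: sum.inter_filter)
    also have "{p\<in>?U. (\<lambda>(xs, ys). \<bar>ln_prod xs - ln_prod ys - \<beta>\<bar> \<le> h * V) p}
      = {(xs, ys)\<in>lists_of Q j \<times> lists_of Q j. set xs \<inter> set ys = {} \<and> \<bar>ln_prod xs - ln_prod ys - \<beta>\<bar> \<le> h * V}"
      by auto
    also have "real (card \<dots>) + real (card ?U) * e \<le> (fact j)\<^sup>2 * (1 + 2 * (h * V) * Z\<^sup>2) + real (card Q) ^ (2 * j) * e"
    proof (rule add_mono)
      show "real (card ?U) * e \<le> real (card Q) ^ (2 * j) * e"
        using cardU by (rule mult_right_mono) (simp add: e_def)
      show "real (card {(xs, ys)\<in>lists_of Q j \<times> lists_of Q j. set xs \<inter> set ys = {} \<and> \<bar>ln_prod xs - ln_prod ys - \<beta>\<bar> \<le> h * V})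
        \<le> (fact j)\<^sup>2 * (1 + 2 * (h * V) * Z\<^sup>2)"
        by (rule card_coprime_prime_list_pairs_near[OF Q(1,2) Z(2,1)]) (use h in auto)
    qed
    finally show ?thesis .
  qed
  have "(\<Sum>(xs, ys)\<in>?U. \<Sum>(\<tau>, \<tau>')\<in>\<Theta> \<times> \<Theta>. gauss_kernel h (ln_prod xs - ln_prod ys - (\<tau> - \<tau>')))
      = (\<Sum>(\<tau>, \<tau>')\<in>\<Theta> \<times> \<Theta>. \<Sum>(xs, ys)\<in>?U. gauss_kernel h (ln_prod xs - ln_prod ys - (\<tau> - \<tau>')))"
    unfolding case_prod_unfold by (rule sum.swap)
  also have "\<dots> \<le> (\<Sum>z\<in>\<Theta> \<times> \<Theta>. (fact j)\<^sup>2 * (1 + 2 * (h * V) * Z\<^sup>2) + real (card Q) ^ (2 * j) * e)"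
  proof (rule sum_mono)
    fix z
    show "(case z of (\<tau>, \<tau>') \<Rightarrow> \<Sum>(xs, ys)\<in>?U. gauss_kernel h (ln_prod xs - ln_prod ys - (\<tau> - \<tau>')))
      \<le> (fact j)\<^sup>2 * (1 + 2 * (h * V) * Z\<^sup>2) + real (card Q) ^ (2 * j) * e"
      by (cases z) (simp only: prod.case inner)
  qed
  also have "\<dots> = R\<^sup>2 * ((fact j)\<^sup>2 * (1 + 2 * (h * V) * Z\<^sup>2) + real (card Q) ^ (2 * j) * e)"
    by (simp add: R_def card_cartesian_product power2_eq_square)
  finally have D: "(\<Sum>(xs, ys)\<in>?U. \<Sum>(\<tau>, \<tau>')\<in>\<Theta> \<times> \<Theta>. gauss_kernel h (ln_prod xs - ln_prod ys - (\<tau> - \<tau>')))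
     \<le> R\<^sup>2 * ((fact j)\<^sup>2 * (1 + 2 * (h * V) * Z\<^sup>2) + real (card Q) ^ (2 * j) * e)" .
  have M0: "(\<integral>t. (norm (exp_sum Q (\<lambda>p. ln (real p)) t ^ 0 * exp_sum \<Theta> uminus t))\<^sup>2 \<partial>gauss_measure h) \<le> R + R\<^sup>2 * e"
    using sum_gauss_kernel_separated[OF h T sep] mean_square_weighted_power[OF h(1) Q(1) pos, of 0 \<Theta>]
    unfolding R_def e_def by (simp add: ln_prod_def)
  show ?thesis
    by (rule order_trans[OF weighted_power_moment_recursion[OF h(1) Q(1) pos Q(3) T]])
       (use D M0 in \<open>auto intro!: add_mono mult_left_mono\<close>)
qed

lemma prime_power_moment:
  fixes Q :: "nat set"
  assumes h: "h > 0" "V \<ge> 0" and Q: "finite Q" "\<And>p. p \<in> Q \<Longrightarrow> prime p"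
    and Z: "Z > 0" "\<And>xs. xs \<in> lists_of Q m \<Longrightarrow> real (prod_list xs) \<le> Z"
  shows "(\<integral>t. (norm (exp_sum Q (\<lambda>p. ln (real p)) t ^ m))\<^sup>2 \<partial>gauss_measure h)
    \<le> real (card Q) ^ m * (fact m * (1 + 2 * (h * V) * Z) + real (card Q) ^ m * exp (- (V\<^sup>2 / 2)))"
proof -
  have pos: "p > 0" if "p \<in> Q" for p using Q(2)[OF that] by (rule prime_gt_0_nat)
  let ?T = "lists_of Q m"
  have fin: "finite ?T" using Q by (simp add: finite_lists_of)
  have power: "exp_sum Q (\<lambda>p. ln (real p)) t ^ m = exp_sum ?T ln_prod t" for t
    using Q(1) pos by (rule exp_sum_power_lists)
  have "(\<integral>t. (norm (exp_sum Q (\<lambda>p. ln (real p)) t ^ m))\<^sup>2 \<partial>gauss_measure h)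
     = (\<Sum>xs\<in>?T. \<Sum>ys\<in>?T. gauss_kernel h (ln_prod xs - ln_prod ys))"
    unfolding power by (rule mean_square_exp_sum[OF h(1)])
  also have "\<dots> \<le> (\<Sum>xs\<in>?T. fact m * (1 + 2 * (h * V) * Z) + real (card Q) ^ m * exp (- (V\<^sup>2 / 2)))"
  proof (rule sum_mono)
    fix xs assume "xs \<in> ?T"
    have "(\<Sum>ys\<in>?T. gauss_kernel h (ln_prod xs - ln_prod ys))
       \<le> (\<Sum>ys\<in>?T. (if \<bar>ln_prod ys - ln_prod xs\<bar> \<le> h * V then 1 else 0) + exp (- (V\<^sup>2 / 2)))"
    proof (rule sum_mono)
      fix ys
      show "gauss_kernel h (ln_prod xs - ln_prod ys)
          \<le> (if \<bar>ln_prod ys - ln_prod xs\<bar> \<le> h * V then 1 else 0) + exp (- (V\<^sup>2 / 2))"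
        using gauss_kernel_le_indicator[OF h, of "ln_prod xs - ln_prod ys"] by (simp add: abs_minus_commute)
    qed
    also have "\<dots> = real (card {ys\<in>?T. \<bar>ln_prod ys - ln_prod xs\<bar> \<le> h * V}) + real (card Q) ^ m * exp (- (V\<^sup>2 / 2))"
      using fin Q by (simp add: sum.distrib sum.If_cases Int_def card_lists_of)
    also have "\<dots> \<le> fact m * (1 + 2 * (h * V) * Z) + real (card Q) ^ m * exp (- (V\<^sup>2 / 2))"
      using h Q Z by (intro add_mono card_prime_lists_near) auto
    finally show "(\<Sum>ys\<in>?T. gauss_kernel h (ln_prod xs - ln_prod ys))
       \<le> fact m * (1 + 2 * (h * V) * Z) + real (card Q) ^ m * exp (- (V\<^sup>2 / 2))" .
  qed
  also have "\<dots> = real (card Q) ^ m * (fact m * (1 + 2 * (h * V) * Z) + real (card Q) ^ m * exp (- (V\<^sup>2 / 2)))"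
    using Q by (simp add: card_lists_of)
  finally show ?thesis .
qed

section \<open>Comparison of two smoothed counts\<close>

text \<open>
  The left-hand side is a lower bound for the count with the wide kernel, scaled by \<open>h / H\<close>; the
  first term on the right bounds the count with the narrow kernel. In the remaining integral the sum over
  \<open>l\<close> is replaced by its supremum, except for a term \<open>W * t\<^sup>2\<close> that takes care of very large \<open>t\<close>, where
  no cancellation in the sum over \<open>l\<close> is known.
\<close>

theorem detection_inequality:
  fixes Q :: "nat set" and \<Theta> :: "real set" and a C m j :: nat
  assumes h: "0 < h" "h \<le> H" and V: "V \<ge> 0" and Q: "finite Q" "\<And>p. p \<in> Q \<Longrightarrow> p > 0" and T: "finite \<Theta>" and a: "a \<ge> 1"
  and far: "\<And>l xs ys \<tau>. l \<in> {a..<C * a} \<Longrightarrow> xs \<in> lists_of Q m \<Longrightarrow> ys \<in> lists_of Q j \<Longrightarrow> \<tau> \<in> \<Theta> \<Longrightarrow>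
     h * V \<le> \<bar>ln (real l) + ln_prod xs + ln_prod ys - \<tau>\<bar>"
  and near: "\<And>xs ys \<tau>. xs \<in> lists_of Q m \<Longrightarrow> ys \<in> lists_of Q j \<Longrightarrow> \<tau> \<in> \<Theta> \<Longrightarrow>
     real a * H \<le> real (card {l\<in>{a..<C * a}. \<bar>ln (real l) + ln_prod xs + ln_prod ys - \<tau>\<bar> \<le> H})"
  and S: "\<And>t. (1 - exp (- ((H\<^sup>2 - h\<^sup>2) * t\<^sup>2 / 2))) * norm (\<Sum>l\<in>{a..<C * a}. cis (t * ln (real l))) \<le> S + W * t\<^sup>2" "S \<ge> 0" "W \<ge> 0"
  and A: "(\<integral>t. (norm (exp_sum Q (\<lambda>p. ln (real p)) t ^ m))\<^sup>2 \<partial>gauss_measure h) \<le> A" "A > 0"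
  and B: "(\<integral>t. (norm (exp_sum Q (\<lambda>p. ln (real p)) t ^ j * exp_sum \<Theta> uminus t))\<^sup>2 \<partial>gauss_measure h) \<le> B" "B > 0"
  defines "q \<equiv> real (card Q)" and "R \<equiv> real (card \<Theta>)"
  shows "h * q ^ (m + j) * R * real a / 2 \<le>
    real C * real a * q ^ (m + j) * R * exp (- (V\<^sup>2 / 2)) + S * sqrt (A * B) + W / h\<^sup>2 * (q ^ (m + j) * R)"
proof -
  let ?L = "{a..<C * a}" and ?M = "lists_of Q m" and ?J = "lists_of Q j"
  define J where "J = ?M \<times> (?J \<times> \<Theta>)"
  define I where "I = ?L \<times> J"
  define \<eta> where "\<eta> = (\<lambda>(xs, ys, \<tau>). ln_prod xs + (ln_prod ys + - \<tau>))"
  define \<phi> where "\<phi> = (\<lambda>(l, z). ln (real l) + \<eta> z)"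
  have fin: "finite J" "finite I" unfolding I_def J_def using Q T by (auto simp: finite_lists_of)
  have cardJ: "real (card J) = q ^ (m + j) * R"
    unfolding J_def q_def R_def using Q by (simp add: card_cartesian_product card_lists_of power_add)
  have H: "H > 0" using h by simp
  define P where "P = exp_sum Q (\<lambda>p. ln (real p))"
  define G where "G = exp_sum \<Theta> uminus"
  define E where "E = exp_sum ?L (\<lambda>l. ln (real l))"
  have [measurable]: "P \<in> borel_measurable borel" "G \<in> borel_measurable borel" "E \<in> borel_measurable borel"
    unfolding P_def G_def E_def by auto
  have power: "P t ^ i = exp_sum (lists_of Q i) ln_prod t" for t i
    unfolding P_def using Q by (rule exp_sum_power_lists)
  have factor: "exp_sum I \<phi> t = E t * (P t ^ m * (P t ^ j * G t))" for t
    unfolding power E_def G_def exp_sum_times I_def J_def \<phi>_def \<eta>_def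
    by (simp add: exp_sum_def case_prod_unfold)
  have main: "h * (q ^ (m + j) * R) * real a / 2 \<le> (\<Sum>i\<in>I. h / H * gauss_kernel H (\<phi> i))"
  proof -
    have one: "h * real a / 2 \<le> (\<Sum>l\<in>?L. h / H * gauss_kernel H (\<phi> (l, z)))" if z: "z \<in> J" for z
    proof -
      obtain xs ys \<tau> where zz: "z = (xs, ys, \<tau>)" "xs \<in> ?M" "ys \<in> ?J" "\<tau> \<in> \<Theta>" using z unfolding J_def by auto
      let ?N = "{l\<in>?L. \<bar>ln (real l) + ln_prod xs + ln_prod ys - \<tau>\<bar> \<le> H}"
      have half: "(1/2 :: real) \<le> exp (- (1/2))" using exp_ge_add_one_self[of "- (1/2) :: real"] by simp
      have "h * real a / 2 = h / H * (1/2) * (real a * H)" using H by simp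
      also have "\<dots> \<le> h / H * (1/2) * real (card ?N)"
        using near[OF zz(2-4)] h H by (intro mult_left_mono) auto
      also have "\<dots> = (\<Sum>l\<in>?N. h / H * (1/2))" by simp
      also have "\<dots> \<le> (\<Sum>l\<in>?N. h / H * gauss_kernel H (\<phi> (l, z)))"
      proof (intro sum_mono mult_left_mono)
        fix l assume l: "l \<in> ?N"
        define u where "u = ln (real l) + ln_prod xs + ln_prod ys - \<tau>"
        have "\<bar>u / H\<bar> \<le> 1" using l H by (simp add: u_def)
        then have "(u / H)\<^sup>2 \<le> 1" by (simp add: abs_square_le_1)
        then have "exp (- (1/2)) \<le> gauss_kernel H u" by (simp add: gauss_kernel_def)
        moreover have "\<phi> (l, z) = u" by (simp add: \<phi>_def \<eta>_def zz u_def)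
        ultimately show "1 / 2 \<le> gauss_kernel H (\<phi> (l, z))" using half by simp
      qed (use h H in auto)
      also have "\<dots> \<le> (\<Sum>l\<in>?L. h / H * gauss_kernel H (\<phi> (l, z)))"
        using h H by (intro sum_mono2) (auto simp: gauss_kernel_nonneg)
      finally show ?thesis .
    qed
    have "h * (q ^ (m + j) * R) * real a / 2 = (\<Sum>z\<in>J. h * real a / 2)" by (simp add: cardJ)
    also have "\<dots> \<le> (\<Sum>z\<in>J. \<Sum>l\<in>?L. h / H * gauss_kernel H (\<phi> (l, z)))" using one by (rule sum_mono)
    also have "\<dots> = (\<Sum>l\<in>?L. \<Sum>z\<in>J. h / H * gauss_kernel H (\<phi> (l, z)))" by (rule sum.swap)
    also have "\<dots> = (\<Sum>i\<in>I. h / H * gauss_kernel H (\<phi> i))" unfolding I_def by (simp add: sum.cartesian_product')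
    finally show ?thesis .
  qed
  have "(\<Sum>i\<in>I. gauss_kernel h (\<phi> i)) \<le> (\<Sum>i\<in>I. exp (- (V\<^sup>2 / 2)))"
  proof (rule sum_mono)
    fix i assume "i \<in> I"
    then obtain l xs ys \<tau> where i: "i = (l, xs, ys, \<tau>)" "l \<in> ?L" "xs \<in> ?M" "ys \<in> ?J" "\<tau> \<in> \<Theta>"
      unfolding I_def J_def by auto
    have "\<phi> i = ln (real l) + ln_prod xs + ln_prod ys - \<tau>" by (simp add: i(1) \<phi>_def \<eta>_def)
    then show "gauss_kernel h (\<phi> i) \<le> exp (- (V\<^sup>2 / 2))"
      using far[OF i(2-5)] h V by (intro gauss_kernel_le) auto
  qed
  also have "\<dots> = real (card ?L) * (q ^ (m + j) * R) * exp (- (V\<^sup>2 / 2))"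
    by (simp add: I_def card_cartesian_product cardJ)
  also have "\<dots> \<le> (real C * real a) * (q ^ (m + j) * R) * exp (- (V\<^sup>2 / 2))"
  proof (intro mult_right_mono)
    have "card ?L \<le> C * a" by simp
    then show "real (card ?L) \<le> real C * real a" by (simp only: of_nat_le_iff flip: of_nat_mult)
  qed (auto simp: q_def R_def)
  finally have tail: "(\<Sum>i\<in>I. gauss_kernel h (\<phi> i)) \<le> (real C * real a) * (q ^ (m + j) * R) * exp (- (V\<^sup>2 / 2))" .
  define \<psi> where "\<psi> = (\<lambda>t::real. 1 - exp (- ((H\<^sup>2 - h\<^sup>2) * t\<^sup>2 / 2)))"
  have [measurable]: "\<psi> \<in> borel_measurable borel" unfolding \<psi>_def by measurable
  have HH: "H\<^sup>2 - h\<^sup>2 \<ge> 0" using h by (simp add: power_mono)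
  have psi: "0 \<le> \<psi> t" "\<psi> t \<le> 1" for t using HH by (auto simp: \<psi>_def)
  define f where "f = (\<lambda>t. norm (P t ^ m))"
  define g where "g = (\<lambda>t. norm (P t ^ j * G t))"
  have [measurable]: "f \<in> borel_measurable borel" "g \<in> borel_measurable borel" unfolding f_def g_def by auto
  have fb: "\<bar>f t\<bar> \<le> q ^ m" for t
    unfolding f_def q_def P_def norm_power power_abs abs_norm_cancel by (intro power_mono) (auto simp: norm_exp_sum_le)
  have gb: "\<bar>g t\<bar> \<le> q ^ j * R" for t
    unfolding g_def q_def P_def G_def R_def norm_mult norm_power abs_mult power_abs abs_norm_cancel
    by (intro mult_mono power_mono) (auto simp: norm_exp_sum_le)
  have f0: "f t \<ge> 0" and g0: "g t \<ge> 0" for t by (simp_all add: f_def g_def)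
  have fg: "f t * g t \<le> q ^ (m + j) * R" "\<bar>f t * g t\<bar> \<le> q ^ (m + j) * R" for t
    using mult_mono[OF fb[of t] gb[of t]] f0[of t] g0[of t] by (simp_all add: power_add mult.assoc q_def)
  have intfg: "integrable (gauss_measure h) (\<lambda>t. f t * g t)"
    using fg h by (intro integrable_gauss_measure_bounded[of _ _ "q ^ (m + j) * R"]) auto
  note sq = square_integral_gauss_measure[OF h(1)]
  have "(\<integral>t. \<psi> t * norm (exp_sum I \<phi> t) \<partial>gauss_measure h)
      \<le> (\<integral>t. S * (f t * g t) + W * (q ^ (m + j) * R) * t\<^sup>2 \<partial>gauss_measure h)"
  proof (rule integral_mono)
    have "norm (\<psi> t * norm (exp_sum I \<phi> t)) \<le> 1 * real (card I)" for t
      unfolding norm_mult using psi[of t] norm_exp_sum_le[of I \<phi> t] by (intro mult_mono) auto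
    then show "integrable (gauss_measure h) (\<lambda>t. \<psi> t * norm (exp_sum I \<phi> t))"
      using h by (intro integrable_gauss_measure_bounded[of _ _ "1 * real (card I)"]) auto
    show "integrable (gauss_measure h) (\<lambda>t. S * (f t * g t) + W * (q ^ (m + j) * R) * t\<^sup>2)"
      using intfg sq(1) by auto
    fix t
    have "\<psi> t * norm (exp_sum I \<phi> t) = (\<psi> t * norm (E t)) * (f t * g t)"
      unfolding factor f_def g_def norm_mult by simp
    also have "\<dots> \<le> (S + W * t\<^sup>2) * (f t * g t)"
      using S(1)[of t] f0 g0 by (intro mult_right_mono) (auto simp: \<psi>_def E_def exp_sum_def)
    also have "\<dots> \<le> S * (f t * g t) + W * t\<^sup>2 * (q ^ (m + j) * R)"
      unfolding distrib_right using fg[of t] S by (intro add_left_mono mult_left_mono) auto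
    finally show "\<psi> t * norm (exp_sum I \<phi> t) \<le> S * (f t * g t) + W * (q ^ (m + j) * R) * t\<^sup>2"
      by (simp add: mult_ac)
  qed
  also have "\<dots> = S * (\<integral>t. f t * g t \<partial>gauss_measure h) + W * (q ^ (m + j) * R) * (1 / h\<^sup>2)"
    using intfg sq by simp
  also have "\<dots> \<le> S * sqrt (A * B) + W * (q ^ (m + j) * R) * (1 / h\<^sup>2)"
  proof (intro add_right_mono mult_left_mono S)
    show "(\<integral>t. f t * g t \<partial>gauss_measure h) \<le> sqrt (A * B)"
    proof (rule integral_product_le_sqrt[where B = "max (q ^ m) (q ^ j * R)"])
      show "(\<integral>t. (f t)\<^sup>2 \<partial>gauss_measure h) \<le> A" using A unfolding f_def P_def by simp
      show "(\<integral>t. (g t)\<^sup>2 \<partial>gauss_measure h) \<le> B" using B unfolding g_def P_def G_def by simp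
    qed (use h A B fb gb in \<open>auto simp: le_max_iff_disj\<close>)
  qed
  finally have osc: "(\<integral>t. \<psi> t * norm (exp_sum I \<phi> t) \<partial>gauss_measure h)
     \<le> S * sqrt (A * B) + W * (q ^ (m + j) * R) * (1 / h\<^sup>2)" .
  have "h * (q ^ (m + j) * R) * real a / 2 \<le> real C * real a * (q ^ (m + j) * R) * exp (- (V\<^sup>2 / 2))
      + (S * sqrt (A * B) + W * (q ^ (m + j) * R) * (1 / h\<^sup>2))"
    using main tail osc kernel_comparison[OF h fin(2), of \<phi>] unfolding \<psi>_def by linarith
  then show ?thesis by (simp add: mult_ac)
qed

text \<open>
  Insertion of the two moment bounds into the detection inequality. Without the factor \<open>s\<close>, the saving
  in the sum over \<open>l\<close>, both sides would have the same order up to constants and powers of \<open>V\<close> and \<open>\<rho>\<close>.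
  The part \<open>R * h\<close> of the second moment can then be absorbed, and the part \<open>1 / q ^ j\<close> remains.
\<close>

lemma moment_inequality_consequence:
  fixes h V q R e P2 \<rho> a C S W s F :: real and m j K :: nat
  assumes pos: "h > 0" "V \<ge> 1" "q \<ge> 1" "R > 0" "e \<ge> 0" "a > 0" "C \<ge> 0" "S \<ge> 0" "s \<ge> 0" "\<rho> \<ge> 1"
    and mj: "m \<le> K" "j \<le> K" "K \<ge> 1"
    and P2: "q \<le> P2" "P2 \<le> \<rho> * q" "1 \<le> h * P2 ^ m" "1 \<le> h * P2 ^ (2 * j)"
    and e: "e \<le> h" "R * e \<le> 1" "C * e \<le> h / 8" "W / h\<^sup>2 \<le> h * a / 8"
    and S: "S \<le> C * a * s"
  defines "A \<equiv> q ^ m * (fact m * (1 + 2 * (h * V) * P2 ^ m) + q ^ m * e)"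
  defines "B \<equiv> 2 * R\<^sup>2 * ((fact j)\<^sup>2 * (1 + 2 * (h * V) * (P2 ^ j)\<^sup>2) + q ^ (2 * j) * e)
      + (2 * (real j)\<^sup>2 * q) ^ j * (R + R\<^sup>2 * e)"
  defines "F \<equiv> 8 * (fact K)\<^sup>2 + 2 * (2 * (real K)\<^sup>2) ^ K"
  assumes det: "h * q ^ (m + j) * R * a / 2 \<le> C * a * q ^ (m + j) * R * e + S * sqrt (A * B) + W / h\<^sup>2 * (q ^ (m + j) * R)"
    and small: "16 * C\<^sup>2 * s\<^sup>2 * F\<^sup>2 * V\<^sup>2 * \<rho> ^ (3 * K) \<le> 1 / 2"
  shows "R * h * q ^ j \<le> 1"
proof -
  have P20: "P2 > 0" using P2 pos by simp
  have fK: "(fact K :: real) \<ge> 1" "(fact K :: real)\<^sup>2 \<ge> fact K" "(fact K :: real)\<^sup>2 \<ge> 1"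
    using fact_ge_1[of K, where 'a = real] by (auto simp: power2_eq_square intro: mult_ge1_I)
  have F0: "F \<ge> 8 * (fact K)\<^sup>2" "F \<ge> 2 * (2 * (real K)\<^sup>2) ^ K" by (simp_all add: F_def)
  have F1: "F > 0" using F0 fK by linarith
  have F4: "4 * fact K \<le> F" using F0(1) fK by linarith
  have fm: "(fact m :: real) \<le> fact K" "(fact j :: real) \<le> fact K" using mj by (auto intro: fact_mono)
  have rK: "\<rho> ^ m \<le> \<rho> ^ K" "\<rho> ^ (2 * j) \<le> \<rho> ^ (2 * K)" using mj pos by (auto intro!: power_increasing)
  define X where "X = h * V * P2 ^ m"
  have X1: "1 \<le> X"
  proof -
    have "1 * 1 \<le> (h * P2 ^ m) * V" using P2 pos by (intro mult_mono) auto
    then show ?thesis by (simp add: X_def mult_ac)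
  qed
  have qmX: "q ^ m * e \<le> X"
  proof -
    have "q ^ m * e \<le> P2 ^ m * h" using P2 pos e by (intro mult_mono power_mono) auto
    also have "\<dots> = P2 ^ m * h * 1" by simp
    also have "\<dots> \<le> P2 ^ m * h * V" using P20 pos by (intro mult_left_mono) auto
    finally show ?thesis by (simp add: X_def mult_ac)
  qed
  have A: "A \<le> F * V * \<rho> ^ K * h * q ^ (2 * m)"
  proof -
    have "fact m * (1 + 2 * (h * V) * P2 ^ m) + q ^ m * e \<le> fact K * (X + 2 * X) + fact K * X"
    proof (rule add_mono)
      have "1 + 2 * (h * V) * P2 ^ m \<le> X + 2 * X" using X1 by (simp add: X_def mult_ac)
      then show "fact m * (1 + 2 * (h * V) * P2 ^ m) \<le> fact K * (X + 2 * X)"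
        using pos P20 fm by (intro mult_mono) auto
      have "1 * X \<le> fact K * X" using fK X1 by (intro mult_right_mono) auto
      then show "q ^ m * e \<le> fact K * X" using qmX by simp
    qed
    also have "\<dots> = 4 * fact K * X" by simp
    also have "\<dots> \<le> F * X" using F4 X1 by (intro mult_right_mono) auto
    finally have "A \<le> q ^ m * (F * X)" unfolding A_def using pos by (intro mult_left_mono) auto
    also have "X \<le> h * V * (\<rho> ^ K * q ^ m)"
    proof -
      have "P2 ^ m \<le> (\<rho> * q) ^ m" using P2 P20 by (intro power_mono) auto
      also have "\<dots> \<le> \<rho> ^ K * q ^ m" unfolding power_mult_distrib using rK pos by (intro mult_right_mono) auto
      finally show ?thesis unfolding X_def using pos by (intro mult_left_mono) auto
    qed
    finally have "A \<le> q ^ m * (F * (h * V * (\<rho> ^ K * q ^ m)))" using pos F1 by simp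
    moreover have "q ^ (2 * m) = q ^ m * q ^ m" by (simp only: mult_2 power_add)
    ultimately show ?thesis by (simp only: mult_ac)
  qed
  define Z where "Z = h * V * P2 ^ (2 * j)"
  have Z1: "1 \<le> Z"
  proof -
    have "1 * 1 \<le> (h * P2 ^ (2 * j)) * V" using P2 pos by (intro mult_mono) auto
    then show ?thesis by (simp add: Z_def mult_ac)
  qed
  have qjZ: "q ^ (2 * j) * e \<le> Z"
  proof -
    have "q ^ (2 * j) * e \<le> P2 ^ (2 * j) * h" using P2 pos e by (intro mult_mono power_mono) auto
    also have "\<dots> = P2 ^ (2 * j) * h * 1" by simp
    also have "\<dots> \<le> P2 ^ (2 * j) * h * V" using P20 pos by (intro mult_left_mono) auto
    finally show ?thesis by (simp add: Z_def mult_ac)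
  qed
  have B: "B \<le> F * V * \<rho> ^ (2 * K) * (q ^ (2 * j) * (R * (R * h + 1 / q ^ j)))"
  proof -
    have "(fact j)\<^sup>2 * (1 + 2 * (h * V) * (P2 ^ j)\<^sup>2) + q ^ (2 * j) * e \<le> (fact K)\<^sup>2 * (Z + 2 * Z) + (fact K)\<^sup>2 * Z"
    proof (rule add_mono)
      have "(P2 ^ j)\<^sup>2 = P2 ^ (2 * j)" by (simp add: power_mult[symmetric] mult.commute)
      then have "1 + 2 * (h * V) * (P2 ^ j)\<^sup>2 \<le> Z + 2 * Z" using Z1 by (simp add: Z_def mult_ac)
      then show "(fact j)\<^sup>2 * (1 + 2 * (h * V) * (P2 ^ j)\<^sup>2) \<le> (fact K)\<^sup>2 * (Z + 2 * Z)"
        using pos P20 fm by (intro mult_mono power_mono) auto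
      have "1 * Z \<le> (fact K)\<^sup>2 * Z" using fK Z1 by (intro mult_right_mono) auto
      then show "q ^ (2 * j) * e \<le> (fact K)\<^sup>2 * Z" using qjZ by simp
    qed
    also have "\<dots> = 4 * (fact K)\<^sup>2 * Z" by simp
    finally have "2 * R\<^sup>2 * ((fact j)\<^sup>2 * (1 + 2 * (h * V) * (P2 ^ j)\<^sup>2) + q ^ (2 * j) * e) \<le> 2 * R\<^sup>2 * (4 * (fact K)\<^sup>2 * Z)"
      by (intro mult_left_mono) auto
    also have "\<dots> = 8 * (fact K)\<^sup>2 * (R\<^sup>2 * Z)" by simp
    also have "\<dots> \<le> F * (R\<^sup>2 * Z)" using F0(1) Z1 by (intro mult_right_mono) auto
    also have "\<dots> \<le> F * (R\<^sup>2 * (h * V * (\<rho> ^ (2 * K) * q ^ (2 * j))))"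
    proof (intro mult_left_mono)
      have "P2 ^ (2 * j) \<le> (\<rho> * q) ^ (2 * j)" using P2 P20 by (intro power_mono) auto
      also have "\<dots> \<le> \<rho> ^ (2 * K) * q ^ (2 * j)" unfolding power_mult_distrib using rK pos by (intro mult_right_mono) auto
      finally show "Z \<le> h * V * (\<rho> ^ (2 * K) * q ^ (2 * j))" unfolding Z_def using pos by (intro mult_left_mono) auto
    qed (use F1 in auto)
    finally have 1: "2 * R\<^sup>2 * ((fact j)\<^sup>2 * (1 + 2 * (h * V) * (P2 ^ j)\<^sup>2) + q ^ (2 * j) * e)
       \<le> F * (R\<^sup>2 * (h * V * (\<rho> ^ (2 * K) * q ^ (2 * j))))" .
    have "(2 * (real j)\<^sup>2 * q) ^ j * (R + R\<^sup>2 * e) \<le> ((2 * (real K)\<^sup>2) ^ K * q ^ j) * (R + R)"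
    proof (intro mult_mono add_left_mono)
      have "1\<^sup>2 \<le> (real K)\<^sup>2" using mj by (intro power_mono) auto
      then have K1: "1 \<le> 2 * (real K)\<^sup>2" by simp
      have "(2 * (real j)\<^sup>2) ^ j \<le> (2 * (real K)\<^sup>2) ^ j" using mj by (intro power_mono mult_left_mono) auto
      also have "\<dots> \<le> (2 * (real K)\<^sup>2) ^ K" using mj K1 by (intro power_increasing) auto
      finally show "(2 * (real j)\<^sup>2 * q) ^ j \<le> (2 * (real K)\<^sup>2) ^ K * q ^ j"
        unfolding power_mult_distrib[of _ q] using pos by (intro mult_right_mono) auto
      have "R * (R * e) \<le> R * 1" using e pos by (intro mult_left_mono) auto
      then show "R\<^sup>2 * e \<le> R" by (simp add: power2_eq_square mult_ac)
    qed (use pos in auto)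
    also have "\<dots> = 2 * (2 * (real K)\<^sup>2) ^ K * (q ^ j * R)" by simp
    also have "\<dots> \<le> F * (q ^ j * R)" using F0(2) pos by (intro mult_right_mono) auto
    also have "\<dots> = F * (q ^ j * R) * 1" by simp
    also have "\<dots> \<le> F * (q ^ j * R) * (V * \<rho> ^ (2 * K))"
      using F1 pos by (intro mult_left_mono mult_ge1_I one_le_power) auto
    finally have 2: "(2 * (real j)\<^sup>2 * q) ^ j * (R + R\<^sup>2 * e) \<le> F * (q ^ j * R) * (V * \<rho> ^ (2 * K))" .
    have "B \<le> F * (R\<^sup>2 * (h * V * (\<rho> ^ (2 * K) * q ^ (2 * j)))) + F * (q ^ j * R) * (V * \<rho> ^ (2 * K))"
      unfolding B_def using 1 2 by (rule add_mono)
    also have "\<dots> = F * V * \<rho> ^ (2 * K) * (q ^ (2 * j) * (R * (R * h)) + q ^ j * R)"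
      by (simp add: power2_eq_square algebra_simps)
    also have "q ^ j * R = q ^ (2 * j) * (R * (1 / q ^ j))"
      using pos by (simp add: mult_2 power_add)
    finally show ?thesis by (simp add: distrib_left)
  qed
  have A0: "A \<ge> 0" unfolding A_def using pos P20 by (intro mult_nonneg_nonneg add_nonneg_nonneg) auto
  have B0: "B \<ge> 0" unfolding B_def using pos P20 by (intro mult_nonneg_nonneg add_nonneg_nonneg zero_le_power) auto
  define Q where "Q = q ^ (m + j)"
  have Q0: "Q > 0" using pos by (simp add: Q_def)
  have AB: "A * B \<le> F\<^sup>2 * V\<^sup>2 * \<rho> ^ (3 * K) * (h * Q\<^sup>2 * (R * (R * h + 1 / q ^ j)))"
  proof -
    have "A * B \<le> (F * V * \<rho> ^ K * h * q ^ (2 * m)) * (F * V * \<rho> ^ (2 * K) * (q ^ (2 * j) * (R * (R * h + 1 / q ^ j))))"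
      using A B B0 pos F1 by (intro mult_mono) auto
    also have "\<dots> = F\<^sup>2 * V\<^sup>2 * (\<rho> ^ K * \<rho> ^ (2 * K)) * (h * (q ^ (2 * m) * q ^ (2 * j)) * (R * (R * h + 1 / q ^ j)))"
      by (simp add: power2_eq_square mult_ac)
    also have "\<rho> ^ K * \<rho> ^ (2 * K) = \<rho> ^ (3 * K)" by (simp add: power_add[symmetric])
    also have "q ^ (2 * m) * q ^ (2 * j) = Q\<^sup>2" by (simp add: Q_def power_add[symmetric] power_mult[symmetric] algebra_simps)
    finally show ?thesis .
  qed
  have "C * a * q ^ (m + j) * R * e = (C * e) * (a * Q * R)" by (simp add: Q_def mult_ac)
  also have "\<dots> \<le> (h / 8) * (a * Q * R)" using e pos Q0 by (intro mult_right_mono) auto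
  finally have t1: "C * a * q ^ (m + j) * R * e \<le> h * Q * R * a / 8" by (simp add: mult_ac)
  have "W / h\<^sup>2 * (q ^ (m + j) * R) \<le> (h * a / 8) * (Q * R)"
    unfolding Q_def using e pos by (intro mult_right_mono) auto
  then have t2: "W / h\<^sup>2 * (q ^ (m + j) * R) \<le> h * Q * R * a / 8" by (simp add: mult_ac)
  have "h * Q * R * a / 4 \<le> S * sqrt (A * B)" using det t1 t2 unfolding Q_def[symmetric] by linarith
  also have "\<dots> \<le> (C * a * s) * sqrt (A * B)" using S A0 B0 by (intro mult_right_mono) auto
  finally have "(h * Q * R * a / 4)\<^sup>2 \<le> ((C * a * s) * sqrt (A * B))\<^sup>2"
    using pos Q0 by (intro power_mono) auto
  also have "\<dots> = (C * a * s)\<^sup>2 * (A * B)" using A0 B0 by (simp add: power_mult_distrib)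
  also have "\<dots> \<le> (C * a * s)\<^sup>2 * (F\<^sup>2 * V\<^sup>2 * \<rho> ^ (3 * K) * (h * Q\<^sup>2 * (R * (R * h + 1 / q ^ j))))"
    using AB by (intro mult_left_mono) auto
  also have "\<dots> = (16 * C\<^sup>2 * s\<^sup>2 * F\<^sup>2 * V\<^sup>2 * \<rho> ^ (3 * K)) * (a\<^sup>2 * h * Q\<^sup>2 * R * (R * h + 1 / q ^ j)) / 16"
    by (simp add: power_mult_distrib mult_ac)
  also have "\<dots> \<le> (1 / 2) * (a\<^sup>2 * h * Q\<^sup>2 * R * (R * h + 1 / q ^ j)) / 16"
    using small pos Q0 by (intro divide_right_mono mult_right_mono) auto
  finally have "(a\<^sup>2 * h * Q\<^sup>2 * R / 16) * (R * h) \<le> (a\<^sup>2 * h * Q\<^sup>2 * R / 16) * ((R * h + 1 / q ^ j) / 2)"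
    by (simp add: power_mult_distrib power_divide power2_eq_square mult_ac)
  then have "R * h \<le> (R * h + 1 / q ^ j) / 2"
    using pos Q0 by (subst (asm) mult_le_cancel_left_pos) auto
  then have "R * h \<le> 1 / q ^ j" by simp
  then show ?thesis using pos by (simp add: field_simps)
qed

section \<open>Points far from all smooth numbers\<close>

lemma powr_dominates_polylog:
  fixes B c :: real
  assumes "c > 0"
  shows "\<forall>\<^sub>F x in at_top. B * ln x ^ n \<le> x powr c"
proof -
  have "((\<lambda>x. ln x powr real n / x powr c) \<longlongrightarrow> 0) at_top"
    using assms by real_asymp
  then have "((\<lambda>x. \<bar>B\<bar> * (ln x powr real n / x powr c)) \<longlongrightarrow> \<bar>B\<bar> * 0) at_top"
    by (intro tendsto_mult_left)
  then have "\<forall>\<^sub>F x in at_top. \<bar>B\<bar> * (ln x powr real n / x powr c) < 1"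
    by (intro order_tendstoD) auto
  then show ?thesis using eventually_gt_at_top[of 1]
  proof eventually_elim
    case (elim x)
    have "B * ln x ^ n \<le> \<bar>B\<bar> * ln x ^ n" using elim by (intro mult_right_mono) auto
    also have "\<dots> \<le> x powr c" using elim by (simp add: powr_realpow field_simps)
    finally show ?case .
  qed
qed

lemma ex_power_just_below:
  fixes P z :: real
  assumes "P > 1" "z \<ge> 1"
  shows "\<exists>j. P ^ j \<le> z \<and> z < P ^ Suc j"
proof -
  obtain n where n: "z < P ^ n" using real_arch_pow[OF assms(1)] by blast
  define n0 where "n0 = (LEAST n. z < P ^ n)"
  have n0: "z < P ^ n0" unfolding n0_def by (rule LeastI) (rule n)
  then have "n0 \<noteq> 0" using assms by (intro notI) simp
  then obtain j where j: "n0 = Suc j" by (cases n0) auto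
  have "\<not> z < P ^ j" using not_less_Least[of j "\<lambda>n. z < P ^ n"] j unfolding n0_def by simp
  then show ?thesis using n0 j by (intro exI[of _ j]) auto
qed

text \<open>
  The integers between \<open>w\<close> and \<open>w * (1 + H)\<close> suffice. There are at least \<open>w * H - 1\<close> of them, which is at
  least \<open>a * H\<close> because \<open>w \<ge> 2 * a\<close> and \<open>a * H \<ge> 1\<close>.
\<close>

lemma many_integers_near_in_log_scale:
  fixes w H :: real and a C :: nat
  assumes "H > 0" "a \<ge> 1" "2 * real a \<le> w" "w * (1 + H) < real C * real a" "1 \<le> real a * H"
  shows "real a * H \<le> real (card {l\<in>{a..<C * a}. \<bar>ln (real l) - ln w\<bar> \<le> H})"
proof -
  have w0: "w > 0" using assms by linarith
  define N where "N = {nat \<lceil>w\<rceil>..nat \<lfloor>w * (1 + H)\<rfloor>}"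
  have wH: "2 * (real a * H) \<le> w * H" using assms by simp
  have le: "w \<le> w * (1 + H)" using assms w0 by simp
  have "N \<subseteq> {l\<in>{a..<C * a}. \<bar>ln (real l) - ln w\<bar> \<le> H}"
  proof
    fix l assume "l \<in> N"
    then have l: "w \<le> real l" "real l \<le> w * (1 + H)"
      unfolding N_def using le w0 by (auto simp: nat_ceiling_le_eq le_nat_floor) linarith+
    have "real l < real (C * a)" using l(2) assms(4) by simp
    then have "l < C * a" by (simp only: of_nat_less_iff)
    moreover have "a \<le> l" using l(1) assms(2,3) by simp
    moreover have "ln w \<le> ln (real l)" using l w0 by simp
    moreover have "ln (real l) \<le> ln w + H"
    proof -
      have "ln (real l) \<le> ln (w * (1 + H))" using l w0 by simp
      also have "\<dots> = ln w + ln (1 + H)" using w0 assms by (simp add: ln_mult)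
      also have "ln (1 + H) \<le> H" using assms by (intro ln_add_one_self_le_self) auto
      finally show ?thesis by simp
    qed
    ultimately show "l \<in> {l\<in>{a..<C * a}. \<bar>ln (real l) - ln w\<bar> \<le> H}" by (auto simp: abs_le_iff)
  qed
  then have "card N \<le> card {l\<in>{a..<C * a}. \<bar>ln (real l) - ln w\<bar> \<le> H}" by (intro card_mono) auto
  moreover have "real a * H \<le> real (card N)"
  proof -
    have "w * (1 + H) = w + w * H" by (simp add: algebra_simps)
    then have "w + 2 * (real a * H) \<le> w * (1 + H)" using wH by simp
    moreover have "real (nat \<lceil>w\<rceil>) < w + 1" using w0 by linarith
    moreover have "w * (1 + H) < real (nat \<lfloor>w * (1 + H)\<rfloor>) + 1" by linarith
    ultimately have "real (nat \<lceil>w\<rceil>) + 2 * (real a * H) - 2 < real (nat \<lfloor>w * (1 + H)\<rfloor>)" by linarith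
    moreover have "real (card N) \<ge> real (nat \<lfloor>w * (1 + H)\<rfloor>) + 1 - real (nat \<lceil>w\<rceil>)"
      unfolding N_def by (simp add: of_nat_diff)
    ultimately show ?thesis using assms(5) by linarith
  qed
  ultimately show ?thesis by linarith
qed

lemma prod_list_bounds:
  fixes P :: real
  assumes "P \<ge> 0" "\<And>p. p \<in> Q \<Longrightarrow> P \<le> real p \<and> real p \<le> 2 * P" "xs \<in> lists_of Q j"
  shows "P ^ j \<le> real (prod_list xs)" "real (prod_list xs) \<le> (2 * P) ^ j"
proof -
  have "P ^ length xs \<le> real (prod_list xs) \<and> real (prod_list xs) \<le> (2 * P) ^ length xs"
    if "set xs \<subseteq> Q" for xs
    using that
  proof (induction xs)
    case (Cons p xs)
    then have IH: "P ^ length xs \<le> real (prod_list xs)" "real (prod_list xs) \<le> (2 * P) ^ length xs" by auto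
    have p: "P \<le> real p" "real p \<le> 2 * P" using assms(2)[of p] Cons.prems by auto
    have "P * P ^ length xs \<le> real p * real (prod_list xs)" using p IH assms(1) by (intro mult_mono) auto
    moreover have "real p * real (prod_list xs) \<le> (2 * P) * (2 * P) ^ length xs"
      using p IH assms(1) by (intro mult_mono) auto
    ultimately show ?case by simp
  qed simp
  then show "P ^ j \<le> real (prod_list xs)" "real (prod_list xs) \<le> (2 * P) ^ j"
    using assms(3) by (auto simp: lists_of_def)
qed

text \<open>
  Three ranges of \<open>t\<close>: for \<open>\<bar>t\<bar> \<le> a powr (1/8)\<close> the damping factor is at most \<open>H\<^sup>2 * t\<^sup>2 \<le> a powr (-3/4)\<close>; up to
  \<open>a powr A\<close> the sum itself has a power saving; beyond \<open>T\<close> the trivial bound is at most the second term.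
\<close>

lemma damped_zeta_sum_bound:
  fixes h H T \<delta> A :: real and a C :: nat
  assumes a: "a \<ge> 1" and C: "C \<ge> 1" and h: "0 < h" "h \<le> H" and H: "H = real a powr (-1/2)"
  and d: "\<delta> \<le> 3/4" and T: "T > 0" "T \<le> real a powr A"
  and saving: "\<And>t. real a powr (1/8) \<le> \<bar>t\<bar> \<Longrightarrow> \<bar>t\<bar> \<le> real a powr A \<Longrightarrow>
     norm (\<Sum>n\<in>{a..<C * a}. cis (t * ln (real n))) \<le> real a powr (1 - \<delta>)"
  shows "(1 - exp (- ((H\<^sup>2 - h\<^sup>2) * t\<^sup>2 / 2))) * norm (\<Sum>l\<in>{a..<C * a}. cis (t * ln (real l)))
     \<le> real C * real a * real a powr (-\<delta>) + real C * real a / T\<^sup>2 * t\<^sup>2"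
proof -
  let ?psi = "1 - exp (- ((H\<^sup>2 - h\<^sup>2) * t\<^sup>2 / 2))" and ?L = "norm (\<Sum>l\<in>{a..<C * a}. cis (t * ln (real l)))"
  have HH: "H\<^sup>2 - h\<^sup>2 \<ge> 0" using h by (simp add: power_mono)
  have psi: "0 \<le> ?psi" "?psi \<le> 1" using HH by auto
  have psi2: "?psi \<le> H\<^sup>2 * t\<^sup>2"
  proof -
    have "?psi \<le> (H\<^sup>2 - h\<^sup>2) * t\<^sup>2 / 2"
      using exp_ge_add_one_self[of "- ((H\<^sup>2 - h\<^sup>2) * t\<^sup>2 / 2)"] by linarith
    also have "\<dots> \<le> (H\<^sup>2 - h\<^sup>2) * t\<^sup>2" using HH by simp
    also have "\<dots> \<le> H\<^sup>2 * t\<^sup>2" by (intro mult_right_mono) auto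
    finally show ?thesis .
  qed
  have Ltriv: "?L \<le> real C * real a"
  proof -
    have "?L \<le> (\<Sum>l\<in>{a..<C * a}. norm (cis (t * ln (real l))))" by (rule norm_sum)
    also have "\<dots> = real (C * a - a)" by simp
    also have "\<dots> \<le> real (C * a)" by (simp only: of_nat_le_iff diff_le_self)
    finally show ?thesis by simp
  qed
  have a0: "real a > 0" using a by simp
  have aa: "real a * real a powr v = real a powr (1 + v)" for v using a0 by (simp add: powr_add)
  consider "\<bar>t\<bar> \<le> real a powr (1/8)" | "real a powr (1/8) \<le> \<bar>t\<bar>" "\<bar>t\<bar> \<le> real a powr A" | "T < \<bar>t\<bar>"
    using T by linarith
  then show ?thesis
  proof cases
    case 1
    have "?psi * ?L \<le> (H\<^sup>2 * t\<^sup>2) * (real C * real a)" using psi psi2 Ltriv by (intro mult_mono) auto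
    also have "\<dots> = real C * real a * (H\<^sup>2 * \<bar>t\<bar>\<^sup>2)" by simp
    also have "\<dots> \<le> real C * real a * (H\<^sup>2 * (real a powr (1/8))\<^sup>2)"
      using 1 by (intro mult_left_mono power_mono) auto
    also have "H\<^sup>2 * (real a powr (1/8))\<^sup>2 = real a powr (-3/4)"
    proof -
      have "H\<^sup>2 * (real a powr (1/8))\<^sup>2 = real a powr ((-1/2 + -1/2) + (1/8 + 1/8))"
        unfolding H power2_eq_square by (simp only: powr_add)
      then show ?thesis by simp
    qed
    also have "real a powr (-3/4) \<le> real a powr (-\<delta>)" using a d by (intro powr_mono) auto
    finally have "?psi * ?L \<le> real C * real a * real a powr (-\<delta>)" by (simp add: mult_left_mono)
    moreover have "0 \<le> real C * real a / T\<^sup>2 * t\<^sup>2" by simp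
    ultimately show ?thesis by linarith
  next
    case 2
    have "?psi * ?L \<le> 1 * real a powr (1 - \<delta>)" using psi saving[OF 2] by (intro mult_mono) auto
    also have "\<dots> = 1 * (real a * real a powr (-\<delta>))" unfolding aa by simp
    also have "\<dots> \<le> real C * (real a * real a powr (-\<delta>))" using C by (intro mult_right_mono) auto
    also have "\<dots> = real C * real a * real a powr (-\<delta>)" by simp
    finally have "?psi * ?L \<le> real C * real a * real a powr (-\<delta>)" .
    moreover have "0 \<le> real C * real a / T\<^sup>2 * t\<^sup>2" by simp
    ultimately show ?thesis by linarith
  next
    case 3
    have "?psi * ?L \<le> 1 * (real C * real a)" using psi Ltriv by (intro mult_mono) auto
    also have "\<dots> \<le> real C * real a * (\<bar>t\<bar>\<^sup>2 / T\<^sup>2)"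
    proof -
      have "T\<^sup>2 \<le> \<bar>t\<bar>\<^sup>2" using 3 T by (intro power_mono) auto
      then have "1 \<le> \<bar>t\<bar>\<^sup>2 / T\<^sup>2" using T by simp
      then have "real C * real a * 1 \<le> real C * real a * (\<bar>t\<bar>\<^sup>2 / T\<^sup>2)" by (intro mult_left_mono) auto
      then show ?thesis by simp
    qed
    also have "\<dots> = real C * real a / T\<^sup>2 * t\<^sup>2" by simp
    finally show ?thesis by (simp add: add_increasing)
  qed
qed

lemma smooth_mult: "smooth y a \<Longrightarrow> smooth y b \<Longrightarrow> smooth y (a * b)"
  unfolding smooth_def by (auto simp: prime_dvd_mult_iff)

lemma smooth_self: "l > 0 \<Longrightarrow> real l \<le> y \<Longrightarrow> smooth y l"
  unfolding smooth_def by (meson dvd_imp_le of_nat_mono order_trans)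

lemma smooth_prod_list_primes:
  assumes "\<And>p. p \<in> set xs \<Longrightarrow> prime p \<and> real p \<le> y"
  shows "smooth y (prod_list xs)"
  using assms
proof (induction xs)
  case Nil
  then show ?case by (auto simp: smooth_def)
next
  case (Cons p xs)
  have "prime p" "real p \<le> y" using Cons.prems by auto
  then have "smooth y p" by (intro smooth_self) (auto simp: prime_gt_0_nat)
  then show ?case using Cons by (auto intro: smooth_mult)
qed

text \<open>
  The numerical core, for a single \<open>x\<close>. The integer \<open>l\<close> and the primes are at most \<open>y\<^sup>2\<close> up to a constant,
  with \<open>y = x powr \<kappa>\<close> and \<open>\<kappa>\<close> small compared with \<open>\<epsilon>\<close>. The assumptions \<open>p1\<close> to \<open>p9\<close> hold for all
  large \<open>x\<close>: they say that powers of \<open>V = ln x\<close> and constants are dominated by small powers of \<open>x\<close>,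
  and small powers of \<open>y\<close> by \<open>x powr \<epsilon>\<close>.
\<close>

lemma separated_points_far_from_smooth_at_scale:
  fixes x X D \<epsilon> \<kappa> \<delta> V y P :: real and K C N0 :: nat and \<Theta> :: "real set"
  assumes kap: "\<kappa> > 0" "\<kappa> \<le> 1" and K: "2 / \<kappa> \<le> real K" "K \<ge> 1" and C: "C = 2 ^ (K + 6)"
    and del: "\<delta> > 0" "\<delta> \<le> 3/4"
    and saving: "\<And>a t. a \<ge> N0 \<Longrightarrow> real a powr (1/8) \<le> \<bar>t\<bar> \<Longrightarrow> \<bar>t\<bar> \<le> real a powr (4 / \<kappa>) \<Longrightarrow>
       norm (\<Sum>n\<in>{a..<C * a}. cis (t * ln (real n))) \<le> real a powr (1 - \<delta>)"
    and Vx: "V = ln x" and V: "V \<ge> 1" "x \<ge> 1" and y: "y = x powr \<kappa>"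
    and P: "P \<ge> 1" "2 * P \<le> y" "y / (8 * (ln y)\<^sup>2) \<le> real (card {p. prime p \<and> P < real p \<and> real p \<le> 2 * P})"
    and p1: "2 ^ (K + 2) \<le> x powr (\<kappa> / 2)" and p2: "real N0 \<le> x powr (\<kappa> / 2)"
    and p3: "16 * V\<^sup>2 \<le> x powr (\<kappa> / 2)" and p4: "exp (- (V\<^sup>2 / 2)) \<le> 1 / (8 * real C * x\<^sup>2)"
    and p5: "4096 * V ^ 3 * y ^ 9 \<le> x powr (3 * \<epsilon>)"
    and p6: "16 * (real C)\<^sup>2 * x powr (- \<kappa> * \<delta>) * (8 * (fact K)\<^sup>2 + 2 * (2 * (real K)\<^sup>2) ^ K)\<^sup>2 * V\<^sup>2 * (8 * V\<^sup>2) ^ (3 * K) \<le> 1 / 2"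
    and p7: "(8 * V\<^sup>2) ^ K * V\<^sup>2 * y ^ 5 \<le> x powr (\<epsilon> / 2)"
    and p8: "real C * y\<^sup>2 \<le> x powr \<epsilon>" and p9: "8 * real C \<le> x"
    and X: "1 \<le> X" "X \<le> x" and D: "0 < D" "D \<le> 1" "x powr (3 * \<epsilon>) / 4096 \<le> X\<^sup>2 * D ^ 3"
    and T: "finite \<Theta>" "real (card \<Theta>) \<le> x\<^sup>2" and TX: "\<And>\<tau>. \<tau> \<in> \<Theta> \<Longrightarrow> ln X \<le> \<tau> \<and> \<tau> \<le> ln (4 * X)"
    and sep: "\<And>\<tau> \<tau>'. \<tau> \<in> \<Theta> \<Longrightarrow> \<tau>' \<in> \<Theta> \<Longrightarrow> \<tau> \<noteq> \<tau>' \<Longrightarrow> D \<le> \<bar>\<tau> - \<tau>'\<bar>"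
    and far: "\<And>\<tau> n. \<tau> \<in> \<Theta> \<Longrightarrow> smooth (x powr \<epsilon>) n \<Longrightarrow> D \<le> \<bar>ln (real n) - \<tau>\<bar>"
  shows "real (card \<Theta>) * (X * D\<^sup>2) \<le> x powr (\<epsilon> / 2)"
proof (cases "\<Theta> = {}")
  case True
  then show ?thesis by simp
next
  case False
  define R where "R = real (card \<Theta>)"
  have R1: "R > 0" using False T by (simp add: R_def card_gt_0_iff)
  have x0: "x > 0" "x > 1" using V Vx by (auto simp: order.strict_iff_order)
  have V8: "1 \<le> 8 * V\<^sup>2"
  proof -
    have "1 \<le> V\<^sup>2" using V by (intro one_le_power) auto
    then show ?thesis by simp
  qed
  have C1: "real C \<ge> 1" "C \<ge> 1" unfolding C by auto
  have y1: "y \<ge> 1" unfolding y using V kap by (intro ge_one_powr_ge_zero) auto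
  have yx: "x powr (\<kappa> / 2) * x powr (\<kappa> / 2) = y" unfolding y by (simp flip: powr_add)
  have xk: "x powr (\<kappa> / 2) \<le> y" "1 \<le> x powr (\<kappa> / 2)"
    unfolding y using V kap by (auto intro!: powr_mono ge_one_powr_ge_zero)
  define Q where "Q = {p. prime p \<and> P < real p \<and> real p \<le> 2 * P}"
  have Qsub: "Q \<subseteq> {1..nat \<lfloor>2 * P\<rfloor>}" unfolding Q_def using prime_gt_0_nat by (auto simp: le_nat_floor Suc_le_eq)
  then have finQ: "finite Q" by (rule finite_subset) simp
  define q where "q = real (card Q)"
  have q2P: "q \<le> 2 * P"
  proof -
    have "card Q \<le> card {1..nat \<lfloor>2 * P\<rfloor>}" using Qsub by (intro card_mono) auto
    then have "q \<le> real (nat \<lfloor>2 * P\<rfloor>)" unfolding q_def by simp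
    also have "\<dots> \<le> 2 * P" using P by (intro of_nat_floor) auto
    finally show ?thesis .
  qed
  have yq: "y \<le> 8 * V\<^sup>2 * q"
  proof -
    have lny: "ln y = \<kappa> * V" unfolding y Vx using x0 by (simp add: ln_powr)
    have "ln y \<le> V" unfolding lny using kap V by (simp add: mult_left_le_one_le)
    moreover have "0 < ln y" unfolding lny using kap V(1) by (intro mult_pos_pos) auto
    ultimately have "(ln y)\<^sup>2 \<le> V\<^sup>2" "(ln y)\<^sup>2 > 0" by (auto intro: power_mono)
    then have "y / (8 * V\<^sup>2) \<le> y / (8 * (ln y)\<^sup>2)" using y1 V(1) by (intro divide_left_mono mult_pos_pos) auto
    also have "\<dots> \<le> q" using P(3) unfolding q_def Q_def .
    finally show ?thesis using V by (simp add: field_simps)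
  qed
  have q1: "q \<ge> 1"
  proof -
    have "q \<noteq> 0" using yq y1 by auto
    then show ?thesis unfolding q_def by (simp add: Suc_le_eq card_gt_0_iff)
  qed
  have primeQ: "prime p" if "p \<in> Q" for p using that by (simp add: Q_def)
  have boundQ: "P \<le> real p \<and> real p \<le> 2 * P" if "p \<in> Q" for p using that by (simp add: Q_def)
  have Plarge: "x powr (\<kappa> / 2) \<le> P"
  proof -
    have "x powr (\<kappa> / 2) * (16 * V\<^sup>2) \<le> x powr (\<kappa> / 2) * x powr (\<kappa> / 2)"
      using p3 by (intro mult_left_mono) auto
    also have "\<dots> \<le> 8 * V\<^sup>2 * q" unfolding yx by (rule yq)
    also have "\<dots> \<le> 8 * V\<^sup>2 * (2 * P)" using q2P by (intro mult_left_mono) auto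
    finally have "(16 * V\<^sup>2) * x powr (\<kappa> / 2) \<le> (16 * V\<^sup>2) * P" by (simp add: mult_ac)
    then show ?thesis using V by (subst (asm) mult_le_cancel_left_pos) auto
  qed
  have P1: "P > 1"
  proof -
    have "(2::real) ^ (K + 2) > 1" by (intro one_less_power) auto
    then show ?thesis using p1 Plarge by linarith
  qed
  have Py: "P \<le> y" using P by simp
  \<comment> \<open>The comparison of widths needs \<open>h \<le> H\<close>, and \<open>H\<close> will be at least \<open>1 / y\<close>. Reducing \<open>D\<close> to at most \<open>1 / y\<close> costs
    at most a factor \<open>y\<close>, since \<open>D \<le> 1\<close>.\<close>
  define D' where "D' = min D (1 / y)"
  have D': "0 < D'" "D' \<le> D" "D' \<le> 1 / y" "D \<le> D' * y"
  proof -
    show "0 < D'" "D' \<le> D" "D' \<le> 1 / y" using D y1 by (auto simp: D'_def)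
    have "D \<le> D * y" using D y1 by simp
    moreover have "D \<le> 1 / y * y" using D y1 by simp
    ultimately show "D \<le> D' * y" unfolding D'_def min_def by simp
  qed
  define h where "h = D' / V"
  have h0: "h > 0" using D' V by (simp add: h_def)
  have hV: "h * V = D'" using V by (simp add: h_def)
  have hD': "h \<le> D'" using D' V by (simp add: h_def field_simps)
  have h1: "h \<le> 1 / y" using hD' D' by simp
  have h1': "h \<le> 1" using h1 y1 by (meson dual_order.trans divide_le_eq_1 zero_less_one less_le_trans)
  have Xh: "y ^ 6 \<le> X\<^sup>2 * h ^ 3"
  proof -
    have "x powr (3 * \<epsilon>) / 4096 \<le> X\<^sup>2 * D ^ 3" by (fact D)
    also have "\<dots> \<le> X\<^sup>2 * (D' * y) ^ 3" using D' D by (intro mult_left_mono power_mono) auto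
    finally have "x powr (3 * \<epsilon>) / 4096 \<le> X\<^sup>2 * D' ^ 3 * y ^ 3" by (simp add: power_mult_distrib mult_ac)
    then have "V ^ 3 * y ^ 9 \<le> X\<^sup>2 * D' ^ 3 * y ^ 3" using p5 by simp
    also have "D' ^ 3 = h ^ 3 * V ^ 3" unfolding hV[symmetric] by (simp add: power_mult_distrib)
    finally have "(V ^ 3 * y ^ 3) * y ^ 6 \<le> (V ^ 3 * y ^ 3) * (X\<^sup>2 * h ^ 3)"
      by (simp add: mult_ac flip: power_add)
    moreover have "V ^ 3 * y ^ 3 > 0" using V y1 by simp
    ultimately show ?thesis by (subst (asm) mult_le_cancel_left_pos) auto
  qed
  have h32: "h ^ 3 \<le> h\<^sup>2" using h0 h1' by (intro power_decreasing) auto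
  have hX: "y ^ 3 \<le> h * X"
  proof -
    have "(y ^ 3)\<^sup>2 = y ^ 6" by (simp flip: power_mult)
    also have "\<dots> \<le> X\<^sup>2 * h ^ 3" by (rule Xh)
    also have "\<dots> \<le> X\<^sup>2 * h\<^sup>2" using h32 by (intro mult_left_mono) auto
    also have "\<dots> = (h * X)\<^sup>2" by (simp add: power_mult_distrib)
    finally show ?thesis by (rule power2_le_imp_le) (use h0 X in auto)
  qed
  have xh3: "1 \<le> x\<^sup>2 * h ^ 3"
  proof -
    have "1 \<le> y ^ 6" using y1 by simp
    also have "\<dots> \<le> X\<^sup>2 * h ^ 3" by (rule Xh)
    also have "\<dots> \<le> x\<^sup>2 * h ^ 3" using X h0 by (intro mult_right_mono power_mono) auto
    finally show ?thesis .
  qed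
  have hx: "1 / x \<le> h"
  proof -
    have "1 \<le> h * X" using hX one_le_power[OF y1, of 3] by linarith
    also have "\<dots> \<le> h * x" using X h0 by (intro mult_left_mono) auto
    finally show ?thesis using x0 by (simp add: field_simps)
  qed
  \<comment> \<open>At a length between \<open>1/h\<close> and \<open>P/h\<close> the diagonal and the other terms of the mean square of the first power
    balance, up to a factor \<open>P\<close>.\<close>
  have "\<exists>i. P ^ i \<le> 1 / h \<and> 1 / h < P ^ Suc i" using P1 h0 h1' by (intro ex_power_just_below) auto
  then obtain i where i: "P ^ i \<le> 1 / h" "1 / h < P ^ Suc i" by blast
  define m where "m = Suc i"
  have m: "1 / h < P ^ m" "P ^ m \<le> P / h" using i P1 by (auto simp: m_def mult_left_mono[of _ "1/h" P, simplified])
  have Pm0: "P ^ m > 0" using P1 by simp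
  \<comment> \<open>The second power takes up the rest of the size \<open>X\<close>, except for a factor between \<open>y\<close> and \<open>y * P\<close> that is left for \<open>l\<close>.\<close>
  have "1 \<le> X / (y * P ^ m)"
  proof -
    have "y * P ^ m \<le> y * (P / h)" using m y1 by (intro mult_left_mono) auto
    also have "\<dots> \<le> y * (y / h)" using Py y1 h0 by (intro mult_left_mono divide_right_mono) auto
    also have "\<dots> = y\<^sup>2 / h" by (simp add: power2_eq_square)
    also have "\<dots> \<le> X"
    proof -
      have "y\<^sup>2 \<le> y ^ 3" using y1 by (intro power_increasing) auto
      then have "y\<^sup>2 \<le> X * h" using hX by (simp add: mult.commute)
      then show ?thesis using h0 by (simp add: pos_divide_le_eq)
    qed
    finally show ?thesis using y1 Pm0 by (simp add: field_simps)
  qed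
  then have "\<exists>j. P ^ j \<le> X / (y * P ^ m) \<and> X / (y * P ^ m) < P ^ Suc j" using P1 by (intro ex_power_just_below) auto
  then obtain j where j: "P ^ j \<le> X / (y * P ^ m)" "X / (y * P ^ m) < P ^ Suc j" by blast
  define Y where "Y = X / P ^ (m + j)"
  have Pmj0: "P ^ (m + j) > 0" using P1 by simp
  have Yy: "y \<le> Y" using j(1) y1 Pm0 P1 unfolding Y_def by (simp add: power_add field_simps)
  have YyP: "Y \<le> y * P" using j(2) y1 Pm0 P1 unfolding Y_def by (simp add: power_add field_simps)
  have mjK: "m + j \<le> K"
  proof -
    have "(x powr (\<kappa> / 2)) ^ (m + j) \<le> P ^ (m + j)" using Plarge by (intro power_mono) auto
    also have "\<dots> \<le> X / y" using Yy Pmj0 y1 unfolding Y_def by (simp add: field_simps)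
    also have "\<dots> \<le> X / 1" using y1 X by (intro divide_left_mono) auto
    also have "\<dots> \<le> x powr 1" using X x0 by simp
    also have "(x powr (\<kappa> / 2)) ^ (m + j) = x powr (\<kappa> / 2 * real (m + j))"
      using x0 by (simp add: powr_power mult.commute)
    finally have "\<kappa> / 2 * real (m + j) \<le> 1" using x0 by (subst (asm) powr_le_cancel_iff) auto
    then have "real (m + j) \<le> 2 / \<kappa>" using kap by (simp add: field_simps)
    then show ?thesis using K by linarith
  qed
  have Pj: "X * h \<le> P ^ j * y ^ 3"
  proof -
    have "X \<le> P ^ Suc j * (y * P ^ m)" using j(2) y1 Pm0 by (simp add: field_simps)
    also have "\<dots> \<le> P ^ Suc j * (y * (P / h))" using m y1 P1 by (intro mult_left_mono) auto
    also have "\<dots> = P ^ j * (y * P * P) / h" by simp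
    also have "\<dots> \<le> P ^ j * (y * y * y) / h"
      using Py P1 y1 h0 by (intro divide_right_mono mult_left_mono mult_mono) auto
    finally show ?thesis using h0 by (simp add: field_simps power3_eq_cube)
  qed
  \<comment> \<open>A product of \<open>m + j \<le> K\<close> primes from the dyadic interval is known up to a factor \<open>2 ^ K\<close>, and \<open>exp \<tau>\<close> up to a
    factor \<open>4\<close>. The interval from \<open>a\<close> to \<open>C * a\<close> with \<open>C = 2 ^ (K + 6)\<close> contains all values of \<open>l\<close> that this allows.\<close>
  define a where "a = nat \<lfloor>Y / 2 ^ (K + 1)\<rfloor>"
  have ale: "real a \<le> Y / 2 ^ (K + 1)" unfolding a_def using Yy y1 by (intro of_nat_floor) auto
  have age: "Y / 2 ^ (K + 2) \<le> real a"
  proof -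
    have "2 ^ (K + 2) \<le> Y" using p1 xk Yy by linarith
    then have "1 \<le> Y / 2 ^ (K + 2)" by simp
    moreover have "Y / 2 ^ (K + 1) = Y / 2 ^ (K + 2) + Y / 2 ^ (K + 2)" by simp
    moreover have "Y / 2 ^ (K + 1) < real a + 1" unfolding a_def by linarith
    ultimately show ?thesis by linarith
  qed
  have aY: "real a \<le> Y"
  proof -
    have "(1::real) \<le> 2 ^ (K + 1)" by (rule one_le_power) simp
    then have "Y / 2 ^ (K + 1) \<le> Y / 1" using Yy y1 by (intro divide_left_mono) auto
    then show ?thesis using ale by simp
  qed
  have Yy2: "Y \<le> y\<^sup>2"
  proof -
    have "y * P \<le> y * y" using Py y1 by (intro mult_left_mono) auto
    then show ?thesis using YyP by (simp add: power2_eq_square)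
  qed
  have ax: "x powr (\<kappa> / 2) \<le> real a"
  proof -
    have "x powr (\<kappa> / 2) * 2 ^ (K + 2) \<le> x powr (\<kappa> / 2) * x powr (\<kappa> / 2)" using p1 by (intro mult_left_mono) auto
    also have "\<dots> \<le> Y" unfolding yx by (rule Yy)
    finally have "x powr (\<kappa> / 2) \<le> Y / 2 ^ (K + 2)" by (simp add: field_simps)
    then show ?thesis using age by linarith
  qed
  have a1: "real a \<ge> 1" "a \<ge> 1" using ax xk by linarith+
  have aN: "a \<ge> N0" using ax p2 by linarith
  define H where "H = real a powr (-1/2)"
  have H0: "H > 0" using a1 by (simp add: H_def)
  have H1: "H \<le> 1" unfolding H_def using a1 powr_mono[of "-1/2" 0 "real a"] by simp
  have aH: "1 \<le> real a * H"
  proof -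
    have "real a * H = real a powr (1/2)" unfolding H_def using a1 powr_add[of "real a" 1 "-1/2"] by simp
    then show ?thesis using a1 by (simp add: ge_one_powr_ge_zero)
  qed
  have hH: "h \<le> H"
  proof -
    have "(y\<^sup>2) powr (-1/2) \<le> H" unfolding H_def using a1 y1 aY Yy2 by (intro powr_mono2') auto
    moreover have "(y\<^sup>2) powr (-1/2) = 1 / y"
    proof -
      have "y\<^sup>2 = y powr 2" using y1 by (simp add: powr_numeral)
      then have "(y\<^sup>2) powr (-1/2) = (y powr 2) powr (-1/2)" by (simp only:)
      also have "\<dots> = y powr (-1)" unfolding powr_powr by simp
      also have "\<dots> = 1 / y" using y1 by (subst powr_minus_divide) simp
      finally show ?thesis .
    qed
    ultimately show ?thesis using h1 by simp
  qed
  have Sm: "smooth (x powr \<epsilon>) (l * prod_list xs * prod_list ys)"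
    if l: "l \<in> {a..<C * a}" and xs: "xs \<in> lists_of Q m" and ys: "ys \<in> lists_of Q j" for l xs ys
  proof -
    have ye: "y \<le> x powr \<epsilon>"
    proof -
      have "y \<le> y\<^sup>2" using y1 by (simp add: self_le_power)
      also have "\<dots> \<le> real C * y\<^sup>2" using C1 by (simp add: mult_le_cancel_right1)
      finally show ?thesis using p8 by simp
    qed
    have "real l \<le> real C * real a" using l by (simp flip: of_nat_mult)
    also have "\<dots> \<le> real C * y\<^sup>2" using aY Yy2 by (intro mult_left_mono) auto
    finally have "real l \<le> x powr \<epsilon>" using p8 by simp
    then have "smooth (x powr \<epsilon>) l" using l a1 by (intro smooth_self) auto
    moreover have "smooth (x powr \<epsilon>) (prod_list zs)" if "set zs \<subseteq> Q" for zs
      by (rule smooth_prod_list_primes) (use that P(2) ye in \<open>force simp: Q_def\<close>)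
    ultimately show ?thesis using xs ys by (intro smooth_mult) (auto simp: lists_of_def)
  qed
  have pos: "prod_list xs > 0" if "xs \<in> lists_of Q k" for xs k
    using that primeQ by (intro prod_list_pos_nat) (auto simp: lists_of_def prime_gt_0_nat)
  have far': "h * V \<le> \<bar>ln (real l) + ln_prod xs + ln_prod ys - \<tau>\<bar>"
    if l: "l \<in> {a..<C * a}" and xs: "xs \<in> lists_of Q m" and ys: "ys \<in> lists_of Q j" and t: "\<tau> \<in> \<Theta>" for l xs ys \<tau>
  proof -
    have "D \<le> \<bar>ln (real (l * prod_list xs * prod_list ys)) - \<tau>\<bar>" using t Sm[OF l xs ys] by (rule far)
    also have "ln (real (l * prod_list xs * prod_list ys)) = ln (real l) + ln_prod xs + ln_prod ys"
      using pos[OF xs] pos[OF ys] l a1 by (simp add: ln_prod_def ln_mult)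
    finally show ?thesis using D' hV by simp
  qed
  have near: "real a * H \<le> real (card {l\<in>{a..<C * a}. \<bar>ln (real l) + ln_prod xs + ln_prod ys - \<tau>\<bar> \<le> H})"
    if xs: "xs \<in> lists_of Q m" and ys: "ys \<in> lists_of Q j" and t: "\<tau> \<in> \<Theta>" for xs ys \<tau>
  proof -
    define N where "N = real (prod_list xs) * real (prod_list ys)"
    define w where "w = exp \<tau> / N"
    have N0: "N > 0" unfolding N_def using pos[OF xs] pos[OF ys] by simp
    have bx: "P ^ m \<le> real (prod_list xs)" "real (prod_list xs) \<le> (2 * P) ^ m"
      using prod_list_bounds[of P Q xs m] P boundQ xs by auto
    have bys: "P ^ j \<le> real (prod_list ys)" "real (prod_list ys) \<le> (2 * P) ^ j"
      using prod_list_bounds[of P Q ys j] P boundQ ys by auto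
    have N1: "P ^ (m + j) \<le> N" unfolding N_def power_add using bx bys P1 by (intro mult_mono) auto
    have N2: "N \<le> 2 ^ K * P ^ (m + j)"
    proof -
      have "N \<le> (2 * P) ^ m * (2 * P) ^ j" unfolding N_def using bx bys P1 by (intro mult_mono) auto
      also have "\<dots> = 2 ^ (m + j) * P ^ (m + j)" by (simp add: power_add power_mult_distrib)
      also have "\<dots> \<le> 2 ^ K * P ^ (m + j)" using mjK Pmj0 by (intro mult_right_mono power_increasing) auto
      finally show ?thesis .
    qed
    have tX: "X \<le> exp \<tau>" "exp \<tau> \<le> 4 * X"
    proof -
      have "exp (ln X) \<le> exp \<tau>" "exp \<tau> \<le> exp (ln (4 * X))"
        using TX[OF t] by (simp_all only: exp_le_cancel_iff)
      then show "X \<le> exp \<tau>" "exp \<tau> \<le> 4 * X" using X by simp_all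
    qed
    have eq: "ln (real l) + ln_prod xs + ln_prod ys - \<tau> = ln (real l) - ln w" for l
      unfolding w_def ln_prod_def N_def using pos[OF xs] pos[OF ys] by (simp add: ln_div ln_mult)
    show ?thesis unfolding eq
    proof (rule many_integers_near_in_log_scale[OF H0 a1(2) _ _ aH])
      have "2 * real a \<le> Y / 2 ^ K" using ale by simp
      also have "\<dots> = X / (2 ^ K * P ^ (m + j))" unfolding Y_def by simp
      also have "\<dots> \<le> w" unfolding w_def using tX N2 N0 X by (intro frac_le) auto
      finally show "2 * real a \<le> w" .
      have "w \<le> 4 * X / P ^ (m + j)" unfolding w_def using tX N1 Pmj0 X by (intro frac_le) auto
      then have "w \<le> 4 * Y" unfolding Y_def by simp
      then have "w * (1 + H) \<le> 4 * Y * 2" using H1 H0 Yy y1 by (intro mult_mono) auto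
      also have "\<dots> < 16 * Y" using Yy y1 by simp
      also have "\<dots> = real C * (Y / 2 ^ (K + 2))" unfolding C by (simp add: power_add)
      also have "\<dots> \<le> real C * real a" using age by (intro mult_left_mono) auto
      finally show "w * (1 + H) < real C * real a" .
    qed
  qed
  define e where "e = exp (- (V\<^sup>2 / 2))"
  define s where "s = real a powr (-\<delta>)"
  define S where "S = real C * real a * s"
  \<comment> \<open>The bound for large \<open>t\<close> takes over at \<open>T = x\<^sup>2\<close>, far beyond \<open>1/h \<le> x\<close>.\<close>
  define W where "W = real C * real a / (x\<^sup>2)\<^sup>2"
  define A where "A = q ^ m * (fact m * (1 + 2 * (h * V) * (2 * P) ^ m) + q ^ m * e)"
  define B where "B = 2 * R\<^sup>2 * ((fact j)\<^sup>2 * (1 + 2 * (h * V) * ((2 * P) ^ j)\<^sup>2) + q ^ (2 * j) * e)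
      + (2 * (real j)\<^sup>2 * q) ^ j * (R + R\<^sup>2 * e)"
  have e0: "e > 0" by (simp add: e_def)
  have Abound: "(\<integral>t. (norm (exp_sum Q (\<lambda>p. ln (real p)) t ^ m))\<^sup>2 \<partial>gauss_measure h) \<le> A"
    unfolding A_def q_def e_def
  proof (rule prime_power_moment[OF h0 _ finQ primeQ])
    show "real (prod_list xs) \<le> (2 * P) ^ m" if "xs \<in> lists_of Q m" for xs
      using prod_list_bounds(2)[of P Q xs m] P boundQ that by auto
  qed (use V P1 in auto)
  have sep': "h * V \<le> \<bar>\<tau> - \<tau>'\<bar>" if "\<tau> \<in> \<Theta>" "\<tau>' \<in> \<Theta>" "\<tau> \<noteq> \<tau>'" for \<tau> \<tau>'
    using sep[OF that] D' hV by simp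
  have Bbound: "(\<integral>t. (norm (exp_sum Q (\<lambda>p. ln (real p)) t ^ j * exp_sum \<Theta> uminus t))\<^sup>2 \<partial>gauss_measure h) \<le> B"
    unfolding B_def q_def e_def R_def
  proof (rule weighted_prime_power_moment[OF h0 _ finQ primeQ _ T(1) _ _ sep'])
    show "real (prod_list xs) \<le> (2 * P) ^ j" if "xs \<in> lists_of Q j" for xs
      using prod_list_bounds(2)[of P Q xs j] P boundQ that by auto
    show "card Q > 0" using q1 unfolding q_def by linarith
  qed (use V P1 in auto)
  have A0: "A > 0" unfolding A_def using q1 h0 V P1 e0
    by (intro mult_pos_pos add_pos_nonneg) (auto intro!: add_pos_nonneg mult_nonneg_nonneg)
  have B0: "B > 0" unfolding B_def using q1 h0 V P1 e0 R1
    by (intro add_pos_nonneg mult_pos_pos) (auto intro!: add_pos_nonneg mult_nonneg_nonneg add_nonneg_nonneg)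
  have xA: "x\<^sup>2 \<le> real a powr (4 / \<kappa>)"
  proof -
    have "x\<^sup>2 = (x powr (\<kappa> / 2)) powr (4 / \<kappa>)" using x0 kap by (simp add: powr_powr powr_numeral)
    also have "\<dots> \<le> real a powr (4 / \<kappa>)" using ax kap by (intro powr_mono2) auto
    finally show ?thesis .
  qed
  have det: "h * q ^ (m + j) * R * real a / 2 \<le>
    real C * real a * q ^ (m + j) * R * e + S * sqrt (A * B) + W / h\<^sup>2 * (q ^ (m + j) * R)"
    unfolding q_def R_def e_def
  proof (rule detection_inequality[OF h0 hH _ finQ _ T(1) a1(2) far' near _ _ _ Abound A0 Bbound B0])
    show "(1 - exp (- ((H\<^sup>2 - h\<^sup>2) * t\<^sup>2 / 2))) * norm (\<Sum>l\<in>{a..<C * a}. cis (t * ln (real l))) \<le> S + W * t\<^sup>2" for t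
      unfolding S_def W_def s_def
      by (rule damped_zeta_sum_bound[OF a1(2) C1(2) h0 hH H_def del(2) _ xA saving[OF aN]]) (use x0 in auto)
  qed (use V primeQ prime_gt_0_nat C1 in \<open>auto simp: S_def W_def s_def\<close>)
  have x1: "1 / (8 * real C * x\<^sup>2) \<le> h / (8 * real C)"
  proof -
    have "1 / x\<^sup>2 \<le> 1 / x" using V by (intro divide_left_mono) (auto simp: power2_eq_square)
    then have "1 / x\<^sup>2 \<le> h" using hx by simp
    then have "(1 / x\<^sup>2) / (8 * real C) \<le> h / (8 * real C)" using C1 by (intro divide_right_mono) auto
    then show ?thesis by (simp add: mult_ac)
  qed
  have eh: "e \<le> h / (8 * real C)" using p4 x1 unfolding e_def by simp
  have "R * h * q ^ j \<le> 1"
  proof (rule moment_inequality_consequence[where V = V and e = e and m = m and K = K and ?P2.0 = "2 * P"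
      and \<rho> = "8 * V\<^sup>2" and a = "real a" and C = "real C" and S = S and W = W and s = s])
    show "1 \<le> 8 * V\<^sup>2" by (rule V8)
    show "2 * P \<le> 8 * V\<^sup>2 * q" using P(2) yq by linarith
    have "1 \<le> h * P ^ m" using m h0 by (simp add: field_simps)
    also have "\<dots> \<le> h * (2 * P) ^ m" using h0 P1 by (intro mult_left_mono power_mono) auto
    finally show "1 \<le> h * (2 * P) ^ m" .
    have "y ^ 6 * 1 \<le> (X * h)\<^sup>2 * h" using Xh by (simp add: power2_eq_square power3_eq_cube mult_ac)
    also have "\<dots> \<le> (P ^ j * y ^ 3)\<^sup>2 * h" using Pj X h0 by (intro mult_right_mono power_mono) auto
    also have "\<dots> = y ^ 6 * (h * P ^ (2 * j))" by (simp add: power_mult_distrib mult_ac flip: power_mult)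
    finally have "1 \<le> h * P ^ (2 * j)" using y1 by (subst (asm) mult_le_cancel_left_pos) auto
    also have "\<dots> \<le> h * (2 * P) ^ (2 * j)" using h0 P1 by (intro mult_left_mono power_mono) auto
    finally show "1 \<le> h * (2 * P) ^ (2 * j)" .
    have "h / (8 * real C) \<le> h / 1" using h0 C1 by (intro divide_left_mono) auto
    then show "e \<le> h" using eh by simp
    have "R * e \<le> x\<^sup>2 * (1 / (8 * real C * x\<^sup>2))"
      using T p4 R1 unfolding R_def e_def by (intro mult_mono) auto
    also have "\<dots> = 1 / (8 * real C)" using x0 by simp
    also have "\<dots> \<le> 1" using C1 by simp
    finally show "R * e \<le> 1" .
    have "real C * e \<le> real C * (h / (8 * real C))" using eh by (intro mult_left_mono) auto
    also have "\<dots> = h / 8" using C1 by simp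
    finally show "real C * e \<le> h / 8" .
    show "W / h\<^sup>2 \<le> h * real a / 8"
    proof -
      have "8 * real C \<le> x * 1" using p9 by simp
      also have "\<dots> \<le> x * x" using V by (intro mult_left_mono) auto
      also have "\<dots> = x\<^sup>2 * 1" by (simp add: power2_eq_square)
      also have "\<dots> \<le> x\<^sup>2 * (x\<^sup>2 * h ^ 3)" using xh3 by (intro mult_left_mono) auto
      finally have "8 * real C \<le> (x\<^sup>2)\<^sup>2 * h ^ 3" by (simp add: power2_eq_square mult_ac)
      then have "real a * (8 * real C) \<le> real a * ((x\<^sup>2)\<^sup>2 * h ^ 3)" by (intro mult_left_mono) auto
      then show ?thesis using h0 x0 unfolding W_def by (simp add: field_simps power2_eq_square power3_eq_cube)
    qed
    have "s\<^sup>2 \<le> x powr (- \<kappa> * \<delta>)"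
    proof -
      have "s\<^sup>2 = real a powr (- (2 * \<delta>))" unfolding s_def power2_eq_square by (simp flip: powr_add)
      also have "\<dots> \<le> (x powr (\<kappa> / 2)) powr (- (2 * \<delta>))" using ax x0 del by (intro powr_mono2') auto
      also have "\<dots> = x powr (- \<kappa> * \<delta>)" by (simp add: powr_powr)
      finally show ?thesis .
    qed
    then have "16 * (real C)\<^sup>2 * s\<^sup>2 * (8 * (fact K)\<^sup>2 + 2 * (2 * (real K)\<^sup>2) ^ K)\<^sup>2 * V\<^sup>2 * (8 * V\<^sup>2) ^ (3 * K)
      \<le> 16 * (real C)\<^sup>2 * x powr (- \<kappa> * \<delta>) * (8 * (fact K)\<^sup>2 + 2 * (2 * (real K)\<^sup>2) ^ K)\<^sup>2 * V\<^sup>2 * (8 * V\<^sup>2) ^ (3 * K)"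
      by (intro mult_right_mono mult_left_mono) auto
    then show "16 * (real C)\<^sup>2 * s\<^sup>2 * (8 * (fact K)\<^sup>2 + 2 * (2 * (real K)\<^sup>2) ^ K)\<^sup>2 * V\<^sup>2 * (8 * V\<^sup>2) ^ (3 * K) \<le> 1 / 2"
      using p6 by linarith
    show "h * q ^ (m + j) * R * real a / 2 \<le> real C * real a * q ^ (m + j) * R * e
       + S * sqrt (q ^ m * (fact m * (1 + 2 * (h * V) * (2 * P) ^ m) + q ^ m * e) *
         (2 * R\<^sup>2 * ((fact j)\<^sup>2 * (1 + 2 * (h * V) * ((2 * P) ^ j)\<^sup>2) + q ^ (2 * j) * e)
          + (2 * (real j)\<^sup>2 * q) ^ j * (R + R\<^sup>2 * e))) + W / h\<^sup>2 * (q ^ (m + j) * R)"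
      using det unfolding A_def B_def .
  qed (use h0 V q1 R1 e0 a1 C1 K mjK q2P in \<open>auto simp: S_def s_def\<close>)
  then have Rhq: "R * h * q ^ j \<le> 1" .
  have "R * X * h\<^sup>2 = R * h * (X * h)" by (simp add: power2_eq_square)
  also have "\<dots> \<le> R * h * (P ^ j * y ^ 3)" using Pj R1 h0 by (intro mult_left_mono) auto
  also have "\<dots> \<le> R * h * (((8 * V\<^sup>2) ^ K * q ^ j) * y ^ 3)"
  proof (intro mult_left_mono mult_right_mono)
    have "P \<le> 8 * V\<^sup>2 * q" using P1 P(2) yq by linarith
    then have "P ^ j \<le> (8 * V\<^sup>2 * q) ^ j" using P1 by (intro power_mono) auto
    also have "\<dots> = (8 * V\<^sup>2) ^ j * q ^ j" by (rule power_mult_distrib)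
    also have "\<dots> \<le> (8 * V\<^sup>2) ^ K * q ^ j"
    proof (intro mult_right_mono power_increasing)
      show "1 \<le> 8 * V\<^sup>2" by (rule V8)
    qed (use mjK q1 in auto)
    finally show "P ^ j \<le> (8 * V\<^sup>2) ^ K * q ^ j" .
  qed (use R1 h0 y1 in auto)
  also have "\<dots> = (8 * V\<^sup>2) ^ K * y ^ 3 * (R * h * q ^ j)" by simp
  also have "\<dots> \<le> (8 * V\<^sup>2) ^ K * y ^ 3 * 1" using Rhq y1 by (intro mult_left_mono) auto
  finally have RX: "R * X * h\<^sup>2 \<le> (8 * V\<^sup>2) ^ K * y ^ 3" by simp
  have "R * (X * D\<^sup>2) \<le> R * (X * (D' * y)\<^sup>2)" using D' D R1 X by (intro mult_left_mono power_mono) auto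
  also have "\<dots> = (R * X * h\<^sup>2) * (V\<^sup>2 * y\<^sup>2)" unfolding hV[symmetric] by (simp add: power_mult_distrib)
  also have "\<dots> \<le> ((8 * V\<^sup>2) ^ K * y ^ 3) * (V\<^sup>2 * y\<^sup>2)" using RX by (intro mult_right_mono) auto
  also have "\<dots> = (8 * V\<^sup>2) ^ K * V\<^sup>2 * y ^ 5" by (simp flip: power_add)
  also have "\<dots> \<le> x powr (\<epsilon> / 2)" by (fact p7)
  finally show ?thesis unfolding R_def .
qed

text \<open>
  With \<open>\<kappa> \<le> \<epsilon>/20\<close> the powers of \<open>y\<close> up to \<open>y ^ 9\<close> that the argument loses fit into \<open>x powr (\<epsilon>/2)\<close>; the
  number of factors \<open>K\<close>, and hence all constants, depend only on \<open>\<kappa>\<close>.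
\<close>

theorem separated_points_far_from_smooth:
  fixes \<epsilon> :: real
  assumes eps: "\<epsilon> > 0"
  shows "\<forall>\<^sub>F x in at_top. \<forall>X D. \<forall>\<Theta> :: real set. 1 \<le> X \<longrightarrow> X \<le> x \<longrightarrow> 0 < D \<longrightarrow> D \<le> 1 \<longrightarrow>
    x powr (3 * \<epsilon>) / 4096 \<le> X\<^sup>2 * D ^ 3 \<longrightarrow> finite \<Theta> \<longrightarrow> real (card \<Theta>) \<le> x\<^sup>2 \<longrightarrow>
    (\<forall>\<tau>\<in>\<Theta>. ln X \<le> \<tau> \<and> \<tau> \<le> ln (4 * X)) \<longrightarrow>
    (\<forall>\<tau>\<in>\<Theta>. \<forall>\<tau>'\<in>\<Theta>. \<tau> \<noteq> \<tau>' \<longrightarrow> D \<le> \<bar>\<tau> - \<tau>'\<bar>) \<longrightarrow>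
    (\<forall>\<tau>\<in>\<Theta>. \<forall>n. smooth (x powr \<epsilon>) n \<longrightarrow> D \<le> \<bar>ln (real n) - \<tau>\<bar>) \<longrightarrow>
    real (card \<Theta>) * (X * D\<^sup>2) \<le> x powr (\<epsilon> / 2)"
proof -
  define \<kappa> where "\<kappa> = min \<epsilon> 1 / 20"
  have kap: "\<kappa> > 0" "\<kappa> \<le> 1" "\<kappa> \<le> \<epsilon> / 20" using eps by (auto simp: \<kappa>_def)
  define K where "K = nat \<lceil>2 / \<kappa>\<rceil>"
  have K: "2 / \<kappa> \<le> real K" "K \<ge> 1"
  proof -
    show "2 / \<kappa> \<le> real K" unfolding K_def by linarith
    moreover have "2 / \<kappa> > 0" using kap by simp
    ultimately show "K \<ge> 1" by (cases K) auto
  qed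
  define C :: nat where "C = 2 ^ (K + 6)"
  have C0: "real C > 0" by (simp add: C_def)
  have "C \<ge> 1" by (simp add: C_def)
  from sum_cis_log_power_saving[OF this, of "4 / \<kappa>"] obtain \<delta>0 N0 where d0: "\<delta>0 > 0"
    and sav: "\<And>a t. a \<ge> N0 \<Longrightarrow> real a powr (1/8) \<le> \<bar>t\<bar> \<Longrightarrow> \<bar>t\<bar> \<le> real a powr (4 / \<kappa>) \<Longrightarrow>
       norm (\<Sum>n\<in>{a..<C * a}. cis (t * ln (real n))) \<le> real a powr (1 - \<delta>0)"
    unfolding eventually_sequentially by blast
  define \<delta> where "\<delta> = min \<delta>0 (3/4)"
  have del: "\<delta> > 0" "\<delta> \<le> 3/4" using d0 by (auto simp: \<delta>_def)
  have saving: "norm (\<Sum>n\<in>{a..<C * a}. cis (t * ln (real n))) \<le> real a powr (1 - \<delta>)"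
    if "a \<ge> max N0 1" "real a powr (1/8) \<le> \<bar>t\<bar>" "\<bar>t\<bar> \<le> real a powr (4 / \<kappa>)" for a t
  proof -
    have "real a powr (1 - \<delta>0) \<le> real a powr (1 - \<delta>)"
      using that(1) by (intro powr_mono) (auto simp: \<delta>_def)
    then show ?thesis using sav[of a t] that by simp
  qed
  define F :: real where "F = 8 * (fact K)\<^sup>2 + 2 * (2 * (real K)\<^sup>2) ^ K"
  have "\<forall>\<^sub>F x :: real in at_top. \<exists>P\<ge>1. 2 * P \<le> x powr \<kappa> \<and>
     x powr \<kappa> / (8 * (ln (x powr \<kappa>))\<^sup>2) \<le> real (card {p. prime p \<and> P < real p \<and> real p \<le> 2 * P})"
  proof -
    have "filterlim (\<lambda>x :: real. x powr \<kappa>) at_top at_top" using kap by real_asymp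
    from eventually_compose_filterlim[OF dyadic_interval_with_many_primes this] show ?thesis .
  qed
  moreover have "\<forall>\<^sub>F x in at_top. 2 ^ (K + 2) * ln x ^ 0 \<le> x powr (\<kappa> / 2)"
    using kap by (intro powr_dominates_polylog) auto
  moreover have "\<forall>\<^sub>F x in at_top. real (max N0 1) * ln x ^ 0 \<le> x powr (\<kappa> / 2)"
    using kap by (intro powr_dominates_polylog) auto
  moreover have "\<forall>\<^sub>F x in at_top. 16 * ln x ^ 2 \<le> x powr (\<kappa> / 2)"
    using kap by (intro powr_dominates_polylog) auto
  moreover have "\<forall>\<^sub>F x :: real in at_top. exp (- ((ln x)\<^sup>2 / 2)) \<le> 1 / (8 * real C * x\<^sup>2)"
    using C0 by real_asymp
  moreover have "\<forall>\<^sub>F x in at_top. 4096 * ln x ^ 3 \<le> x powr \<epsilon>"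
    using eps by (intro powr_dominates_polylog) auto
  moreover have "\<forall>\<^sub>F x in at_top. (32 * (real C)\<^sup>2 * F\<^sup>2 * 8 ^ (3 * K)) * ln x ^ (2 + 6 * K) \<le> x powr (\<kappa> * \<delta>)"
    using kap del by (intro powr_dominates_polylog) auto
  moreover have "\<forall>\<^sub>F x in at_top. 8 ^ K * ln x ^ (2 * K + 2) \<le> x powr (\<epsilon> / 5)"
    using eps by (intro powr_dominates_polylog) auto
  moreover have "\<forall>\<^sub>F x in at_top. real C * ln x ^ 0 \<le> x powr (\<epsilon> / 2)"
    using eps by (intro powr_dominates_polylog) auto
  moreover have "\<forall>\<^sub>F x in at_top. 8 * real C \<le> x" by (rule eventually_ge_at_top)
  moreover have "\<forall>\<^sub>F x in at_top. exp 1 \<le> (x :: real)" by (rule eventually_ge_at_top)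
  ultimately show ?thesis
  proof eventually_elim
    case (elim x)
    then obtain P where P: "P \<ge> 1" "2 * P \<le> x powr \<kappa>"
      "x powr \<kappa> / (8 * (ln (x powr \<kappa>))\<^sup>2) \<le> real (card {p. prime p \<and> P < real p \<and> real p \<le> 2 * P})" by blast
    have x1: "x \<ge> 1" using elim(11) exp_ge_add_one_self[of 1] by linarith
    then have x0: "x > 0" by simp
    have V1: "ln x \<ge> 1" using elim(11) x0 by (simp add: ln_ge_iff)
    have ypow: "(x powr \<kappa>) ^ i = x powr (real i * \<kappa>)" for i using x0 by (simp add: powr_power)
    have up: "x powr u \<le> x powr v" if "u \<le> v" for u v using that x1 by (rule powr_mono)
    have p5: "4096 * ln x ^ 3 * (x powr \<kappa>) ^ 9 \<le> x powr (3 * \<epsilon>)"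
    proof -
      have "4096 * ln x ^ 3 * (x powr \<kappa>) ^ 9 \<le> x powr \<epsilon> * x powr (9 * \<kappa>)"
        unfolding ypow using elim(6) by (intro mult_mono) auto
      also have "\<dots> = x powr (\<epsilon> + 9 * \<kappa>)" by (rule powr_add[symmetric])
      also have "\<dots> \<le> x powr (3 * \<epsilon>)" using kap eps by (intro up) auto
      finally show ?thesis .
    qed
    have p6: "16 * (real C)\<^sup>2 * x powr (- \<kappa> * \<delta>) * (8 * (fact K)\<^sup>2 + 2 * (2 * (real K)\<^sup>2) ^ K)\<^sup>2 * (ln x)\<^sup>2 * (8 * (ln x)\<^sup>2) ^ (3 * K) \<le> 1 / 2"
    proof -
      have e: "(ln x)\<^sup>2 * (8 * (ln x)\<^sup>2) ^ (3 * K) = 8 ^ (3 * K) * ln x ^ (2 + 6 * K)"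
      proof -
        have "(8 * (ln x)\<^sup>2) ^ (3 * K) = 8 ^ (3 * K) * ln x ^ (2 * (3 * K))" by (simp only: power_mult_distrib power_mult)
        moreover have "ln x ^ (2 + 6 * K) = (ln x)\<^sup>2 * ln x ^ (2 * (3 * K))" by (simp only: power_add[symmetric]) simp
        ultimately show ?thesis by (simp only: mult_ac)
      qed
      have "16 * (real C)\<^sup>2 * x powr (- \<kappa> * \<delta>) * F\<^sup>2 * (ln x)\<^sup>2 * (8 * (ln x)\<^sup>2) ^ (3 * K)
         = 16 * (real C)\<^sup>2 * x powr (- \<kappa> * \<delta>) * F\<^sup>2 * ((ln x)\<^sup>2 * (8 * (ln x)\<^sup>2) ^ (3 * K))" by (simp only: mult.assoc)
      also have "\<dots> = ((32 * (real C)\<^sup>2 * F\<^sup>2 * 8 ^ (3 * K)) * ln x ^ (2 + 6 * K)) * x powr (- \<kappa> * \<delta>) / 2"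
        unfolding e by (simp add: mult_ac)
      also have "\<dots> \<le> x powr (\<kappa> * \<delta>) * x powr (- \<kappa> * \<delta>) / 2"
        using elim(7) by (intro divide_right_mono mult_right_mono) auto
      also have "\<dots> = 1 / 2" using x0 by (simp flip: powr_add)
      finally show ?thesis unfolding F_def .
    qed
    have p7: "(8 * (ln x)\<^sup>2) ^ K * (ln x)\<^sup>2 * (x powr \<kappa>) ^ 5 \<le> x powr (\<epsilon> / 2)"
    proof -
      have "(8 * (ln x)\<^sup>2) ^ K = 8 ^ K * ln x ^ (2 * K)" by (simp only: power_mult_distrib power_mult)
      then have eq: "(8 * (ln x)\<^sup>2) ^ K * (ln x)\<^sup>2 = 8 ^ K * ln x ^ (2 * K + 2)" by (simp only: power_add mult.assoc)
      have "(8 * (ln x)\<^sup>2) ^ K * (ln x)\<^sup>2 * (x powr \<kappa>) ^ 5 \<le> x powr (\<epsilon> / 5) * x powr (5 * \<kappa>)"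
        unfolding eq ypow using x0 by (intro mult_mono elim(8)) auto
      also have "\<dots> = x powr (\<epsilon> / 5 + 5 * \<kappa>)" by (rule powr_add[symmetric])
      also have "\<dots> \<le> x powr (\<epsilon> / 2)" using kap eps by (intro up) auto
      finally show ?thesis .
    qed
    have p8: "real C * (x powr \<kappa>)\<^sup>2 \<le> x powr \<epsilon>"
    proof -
      have "real C * (x powr \<kappa>)\<^sup>2 \<le> x powr (\<epsilon> / 2) * x powr (2 * \<kappa>)"
        unfolding ypow using elim(9) by (intro mult_mono) auto
      also have "\<dots> = x powr (\<epsilon> / 2 + 2 * \<kappa>)" by (rule powr_add[symmetric])
      also have "\<dots> \<le> x powr \<epsilon>" using kap eps by (intro up) auto
      finally show ?thesis .
    qed
    show ?case
    proof (intro allI impI)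
      fix X D :: real and \<Theta> :: "real set"
      assume H: "1 \<le> X" "X \<le> x" "0 < D" "D \<le> 1" "x powr (3 * \<epsilon>) / 4096 \<le> X\<^sup>2 * D ^ 3" "finite \<Theta>"
        "real (card \<Theta>) \<le> x\<^sup>2" "\<forall>\<tau>\<in>\<Theta>. ln X \<le> \<tau> \<and> \<tau> \<le> ln (4 * X)"
        "\<forall>\<tau>\<in>\<Theta>. \<forall>\<tau>'\<in>\<Theta>. \<tau> \<noteq> \<tau>' \<longrightarrow> D \<le> \<bar>\<tau> - \<tau>'\<bar>"
        "\<forall>\<tau>\<in>\<Theta>. \<forall>n. smooth (x powr \<epsilon>) n \<longrightarrow> D \<le> \<bar>ln (real n) - \<tau>\<bar>"
      show "real (card \<Theta>) * (X * D\<^sup>2) \<le> x powr (\<epsilon> / 2)"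
        by (rule separated_points_far_from_smooth_at_scale[OF kap(1,2) K C_def del saving refl V1 x1 refl P
              _ _ _ _ p5 p6 p7 p8])
           (use elim H in auto)
    qed
  qed
qed

section \<open>Gaps between smooth numbers\<close>

text \<open>
  Doubling preserves smoothness. Hence a gap is never longer than the number at which it starts.
\<close>

lemma next_smooth_le_double:
  assumes "y \<ge> 2"
  shows "smooth_seq y (Suc n) \<le> 2 * smooth_seq y n"
proof -
  have sm: "smooth y (smooth_seq y n)" using range_smooth_seq[OF assms] by blast
  then have pos: "smooth_seq y n > 0" by (simp add: smooth_def)
  have "smooth y (2 * smooth_seq y n)" by (rule smooth_mult[OF smooth_self sm]) (use assms in auto)
  then obtain k where k: "2 * smooth_seq y n = smooth_seq y k" using range_smooth_seq[OF assms] by blast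
  have "smooth_seq y n < smooth_seq y k" using k pos by simp
  then have "n < k" using strict_mono_less[OF strict_mono_smooth_seq[OF assms]] by blast
  then have "smooth_seq y (Suc n) \<le> smooth_seq y k"
    using strict_mono_less_eq[OF strict_mono_smooth_seq[OF assms]] by simp
  then show ?thesis using k by simp
qed

lemma smooth_not_in_gap:
  assumes "y \<ge> 2" "smooth y s"
  shows "s \<le> smooth_seq y n \<or> smooth_seq y (Suc n) \<le> s"
proof -
  obtain k where k: "s = smooth_seq y k" using range_smooth_seq[OF assms(1)] assms(2) by blast
  show ?thesis unfolding k
    using strict_mono_less_eq[OF strict_mono_smooth_seq[OF assms(1)]] by (cases "k \<le> n") auto
qed

lemma ln_diff_ge:
  fixes a b :: real
  assumes "0 < a" "a \<le> b"
  shows "(b - a) / b \<le> ln b - ln a"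
proof -
  have "ln (a / b) \<le> a / b - 1" using assms by (intro ln_le_minus_one) auto
  then show ?thesis using assms by (simp add: ln_div diff_divide_distrib)
qed

text \<open>
  The right endpoint is nearer to the midpoint on the logarithmic scale than the left one, so it
  decides. The first part also separates the midpoints of distinct gaps, as the endpoint lies between them.
\<close>

lemma ln_midpoint_far_from_smooth:
  fixes n :: nat
  assumes y: "y \<ge> 2"
  defines "a \<equiv> real (smooth_seq y n)" and "b \<equiv> real (smooth_seq y (Suc n))"
  shows "(b - a) / (2 * b) \<le> ln b - ln ((a + b) / 2)"
    and "smooth y s \<Longrightarrow> (b - a) / (2 * b) \<le> \<bar>ln (real s) - ln ((a + b) / 2)\<bar>"
proof -
  have "smooth y (smooth_seq y n)" using range_smooth_seq[OF y] by blast
  then have a0: "a > 0" by (simp add: smooth_def a_def)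
  have ab: "a < b" unfolding a_def b_def using strict_mono_smooth_seq[OF y] by (simp add: strict_mono_less)
  define c where "c = (a + b) / 2"
  have c: "a < c" "c < b" "c > 0" using a0 ab by (auto simp: c_def)
  have "(b - a) / (2 * b) = (b - c) / b" by (simp add: c_def field_simps)
  also have "\<dots> \<le> ln b - ln c" using c by (intro ln_diff_ge) auto
  finally have 1: "(b - a) / (2 * b) \<le> ln b - ln c" .
  then show "(b - a) / (2 * b) \<le> ln b - ln ((a + b) / 2)" by (simp add: c_def)
  assume s: "smooth y s"
  then have s0: "real s > 0" by (simp add: smooth_def)
  consider "real s \<le> a" | "b \<le> real s"
    using smooth_not_in_gap[OF y s, of n] unfolding a_def b_def by auto
  then have "(b - a) / (2 * b) \<le> \<bar>ln (real s) - ln c\<bar>"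
  proof cases
    case 1
    have "(b - a) / (2 * b) \<le> (b - a) / (2 * c)" using c ab by (intro divide_left_mono) auto
    also have "\<dots> = (c - a) / c" using c by (simp add: c_def field_simps)
    also have "\<dots> \<le> ln c - ln a" using c a0 by (intro ln_diff_ge) auto
    also have "\<dots> \<le> ln c - ln (real s)" using 1 s0 a0 by simp
    finally show ?thesis by simp
  next
    case 2
    have "ln b \<le> ln (real s)" using 2 c s0 by simp
    then show ?thesis using 1 by linarith
  qed
  then show "(b - a) / (2 * b) \<le> \<bar>ln (real s) - ln ((a + b) / 2)\<bar>" by (simp add: c_def)
qed

lemma ex_dyadic_block:
  assumes "m \<ge> (1::nat)" "real m \<le> x"
  shows "\<exists>i \<le> nat \<lfloor>log 2 x\<rfloor>. 2 ^ i \<le> m \<and> m < 2 * 2 ^ i"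
proof -
  obtain i where i: "(2::real) ^ i \<le> real m" "real m < 2 ^ Suc i"
    using ex_power_just_below[of 2 "real m"] assms by auto
  have "real i \<le> log 2 x"
  proof -
    have "2 powr real i = 2 ^ i" by (simp add: powr_realpow)
    then have "2 powr real i \<le> x" using i(1) assms by linarith
    then show ?thesis using assms by (subst le_log_iff) auto
  qed
  then have "i \<le> nat \<lfloor>log 2 x\<rfloor>" by (simp add: le_nat_floor)
  moreover have "2 ^ i \<le> m" using i(1) by (metis of_nat_le_iff of_nat_numeral of_nat_power)
  moreover have "m < 2 * 2 ^ i" using i(2) by (metis of_nat_less_iff of_nat_numeral of_nat_power power_Suc)
  ultimately show ?thesis by blast
qed

theorem theorem1:
  fixes \<epsilon> :: real
  assumes "\<epsilon> > 0"
  shows "\<exists>C > 0. \<exists>x0. \<forall>x \<ge> x0.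
    \<bar>\<Sum>n | real (smooth_seq (x powr \<epsilon>) n) \<le> x \<and>
           real (smooth_seq (x powr \<epsilon>) (Suc n)) - real (smooth_seq (x powr \<epsilon>) n) \<ge> x powr (1/3 + \<epsilon>).
       (real (smooth_seq (x powr \<epsilon>) (Suc n)) - real (smooth_seq (x powr \<epsilon>) n))\<^sup>2\<bar>
    \<le> C * x powr (1 + \<epsilon>)"
proof -
  have "\<forall>\<^sub>F x in at_top. 2 * ln x ^ 0 \<le> x powr \<epsilon>"
    using assms by (intro powr_dominates_polylog) auto
  \<comment> \<open>Each of the at most \<open>(3 * ln x)\<^sup>2\<close> dyadic cells contributes at most \<open>256 * x powr (1 + \<epsilon> / 2)\<close>.\<close>
  moreover have "\<forall>\<^sub>F x in at_top. 2304 * ln x ^ 2 \<le> x powr (\<epsilon> / 2)"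
    using assms by (intro powr_dominates_polylog) auto
  moreover have "\<forall>\<^sub>F x in at_top. (3::real) \<le> x" by (rule eventually_ge_at_top)
  ultimately have "\<forall>\<^sub>F x in at_top.
    \<bar>\<Sum>n | real (smooth_seq (x powr \<epsilon>) n) \<le> x \<and>
           real (smooth_seq (x powr \<epsilon>) (Suc n)) - real (smooth_seq (x powr \<epsilon>) n) \<ge> x powr (1/3 + \<epsilon>).
       (real (smooth_seq (x powr \<epsilon>) (Suc n)) - real (smooth_seq (x powr \<epsilon>) n))\<^sup>2\<bar>
    \<le> 1 * x powr (1 + \<epsilon>)"
    using separated_points_far_from_smooth[OF assms]
  proof eventually_elim
    case (elim x)
    have y2: "x powr \<epsilon> \<ge> 2" using elim(1) by simp
    have x3: "x \<ge> 3" by (fact elim)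
    define u where "u = smooth_seq (x powr \<epsilon>)"
    have mono: "strict_mono u" unfolding u_def by (rule strict_mono_smooth_seq[OF y2])
    have u1: "u n \<ge> 1" for n
      using range_smooth_seq[OF y2] unfolding u_def by (metis One_nat_def Suc_leI mem_Collect_eq rangeI smooth_def)
    have up: "u n < u (Suc n)" for n using mono by (simp add: strict_mono_less)
    define g where "g = (\<lambda>n. u (Suc n) - u n)"
    have g: "real (g n) = real (u (Suc n)) - real (u n)" for n unfolding g_def using up[of n] by (simp add: of_nat_diff)
    have g1: "g n \<ge> 1" "g n \<le> u n" for n
      unfolding g_def using up[of n] next_smooth_le_double[OF y2, of n] by (auto simp: u_def)
    define S where "S = {n. real (u n) \<le> x \<and> x powr (1/3 + \<epsilon>) \<le> real (g n)}"
    define I where "I = nat \<lfloor>log 2 x\<rfloor>"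
    have nu: "n \<le> u n" for n using mono by (rule strict_mono_imp_increasing)
    have Ssub: "S \<subseteq> {..nat \<lfloor>x\<rfloor>}"
    proof
      fix n assume "n \<in> S"
      then have "real n \<le> x" using nu[of n] unfolding S_def by (smt (verit) mem_Collect_eq of_nat_mono)
      then show "n \<in> {..nat \<lfloor>x\<rfloor>}" by (simp add: le_nat_floor)
    qed
    have finS: "finite S" using Ssub by (rule finite_subset) simp
    have cardS: "real (card S) \<le> x\<^sup>2"
    proof -
      have "card S \<le> nat \<lfloor>x\<rfloor> + 1" using card_mono[OF _ Ssub] by simp
      then have "real (card S) \<le> x + 1" using x3 by linarith
      also have "\<dots> \<le> 3 * x" using x3 by simp
      also have "\<dots> \<le> x\<^sup>2" unfolding power2_eq_square using x3 by (intro mult_right_mono) auto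
      finally show ?thesis .
    qed
    define B where "B = (\<lambda>(i, k). {n\<in>S. 2 ^ i \<le> u n \<and> u n < 2 * 2 ^ i \<and> 2 ^ k \<le> g n \<and> g n < 2 * 2 ^ k})"
    have cover: "S \<subseteq> (\<Union>w\<in>{..I} \<times> {..I}. B w)"
    proof
      fix n assume n: "n \<in> S"
      then have ux: "real (u n) \<le> x" by (simp add: S_def)
      have "real (g n) \<le> real (u n)" using g1(2)[of n] by simp
      then have gx: "real (g n) \<le> x" using ux by simp
      obtain i k where "i \<le> I" "2 ^ i \<le> u n" "u n < 2 * 2 ^ i" "k \<le> I" "2 ^ k \<le> g n" "g n < 2 * 2 ^ k"
        using ex_dyadic_block[OF u1 ux] ex_dyadic_block[OF g1(1) gx] unfolding I_def by blast
      then show "n \<in> (\<Union>w\<in>{..I} \<times> {..I}. B w)" using n by (auto simp: B_def)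
    qed
    have cell: "(\<Sum>n\<in>B w. (real (g n))\<^sup>2) \<le> 256 * x powr (1 + \<epsilon> / 2)" for w
    proof -
      obtain i k where w: "w = (i, k)" by (cases w)
      have BS: "B w \<subseteq> S" unfolding w B_def by auto
      have finB: "finite (B w)" using BS finS by (rule finite_subset)
      have Bn: "2 ^ i \<le> real (u n)" "real (u n) < 2 * 2 ^ i" "2 ^ k \<le> real (g n)" "real (g n) < 2 * 2 ^ k"
          "real (u n) \<le> x" "x powr (1/3 + \<epsilon>) \<le> real (g n)" if "n \<in> B w" for n
      proof -
        have n: "2 ^ i \<le> u n" "u n < 2 * 2 ^ i" "2 ^ k \<le> g n" "g n < 2 * 2 ^ k"
          using that unfolding w B_def by auto
        have "real (2 ^ i) \<le> real (u n)" "real (u n) < real (2 * 2 ^ i)"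
          "real (2 ^ k) \<le> real (g n)" "real (g n) < real (2 * 2 ^ k)"
          using n by (simp_all only: of_nat_le_iff of_nat_less_iff)
        then show "2 ^ i \<le> real (u n)" "real (u n) < 2 * 2 ^ i" "2 ^ k \<le> real (g n)" "real (g n) < 2 * 2 ^ k"
          by simp_all
        show "real (u n) \<le> x" "x powr (1/3 + \<epsilon>) \<le> real (g n)"
          using that BS unfolding S_def by auto
      qed
      show ?thesis
      proof (cases "B w = {}")
        case True
        then show ?thesis by simp
      next
        case False
        then obtain n0 where n0: "n0 \<in> B w" by blast
        define X :: real where "X = 2 ^ i"
        define \<Delta> :: real where "\<Delta> = 2 ^ k"
        \<comment> \<open>Half of a gap of length at least \<open>\<Delta>\<close>, relative to its right endpoint, which is at most \<open>4 * X\<close>.\<close>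
        define D where "D = \<Delta> / (8 * X)"
        have X0: "X > 0" "X \<ge> 1" by (simp_all add: X_def)
        have De0: "\<Delta> > 0" by (simp add: \<Delta>_def)
        have Xx: "X \<le> x" using Bn[OF n0] unfolding X_def by linarith
        have gu: "real (g n) \<le> real (u n)" for n using g1(2)[of n] by simp
        have De: "\<Delta> \<le> 2 * X" using Bn[OF n0] gu[of n0] unfolding X_def \<Delta>_def by linarith
        have De2: "x powr (1/3 + \<epsilon>) \<le> 2 * \<Delta>" using Bn[OF n0] unfolding \<Delta>_def by linarith
        have D0: "D > 0" "D \<le> 1" using De De0 X0 by (auto simp: D_def field_simps)
        have big: "x powr (3 * \<epsilon>) / 4096 \<le> X\<^sup>2 * D ^ 3"
        proof -
          have "x powr (3 * \<epsilon>) * x = (x powr (1/3 + \<epsilon>)) ^ 3"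
          proof -
            have "(x powr (1/3 + \<epsilon>)) ^ 3 = x powr (3 * \<epsilon> + 1)" using x3 by (simp add: powr_power algebra_simps)
            also have "\<dots> = x powr (3 * \<epsilon>) * x" using x3 by (simp add: powr_add)
            finally show ?thesis by simp
          qed
          also have "\<dots> \<le> (2 * \<Delta>) ^ 3" using De2 by (intro power_mono) auto
          also have "\<dots> = 8 * \<Delta> ^ 3" by (simp add: power_mult_distrib)
          finally have "x powr (3 * \<epsilon>) * X \<le> 8 * \<Delta> ^ 3" using Xx by (smt (verit) mult_left_mono powr_ge_zero)
          then have "x powr (3 * \<epsilon>) / 4096 \<le> \<Delta> ^ 3 / (512 * X)" using X0 by (simp add: field_simps)
          also have "\<dots> = X\<^sup>2 * D ^ 3"
            unfolding D_def using X0 by (simp add: field_simps power2_eq_square power3_eq_cube)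
          finally show ?thesis .
        qed
        define \<tau> where "\<tau> = (\<lambda>n. ln ((real (u n) + real (u (Suc n))) / 2))"
        have bd: "D \<le> (real (u (Suc n)) - real (u n)) / (2 * real (u (Suc n)))" if n: "n \<in> B w" for n
        proof -
          have "real (u (Suc n)) \<le> 4 * X" using g[of n] gu[of n] Bn[OF n] unfolding X_def by linarith
          moreover have "real (u (Suc n)) > 0" using u1[of "Suc n"] by simp
          moreover have "\<Delta> \<le> real (g n)" using Bn[OF n] unfolding \<Delta>_def by simp
          ultimately have "\<Delta> / (2 * (4 * X)) \<le> real (g n) / (2 * real (u (Suc n)))"
            using De0 X0 by (intro frac_le) auto
          then show ?thesis unfolding D_def g by simp
        qed
        have far: "D \<le> \<bar>ln (real s) - \<tau> n\<bar>" if "n \<in> B w" "smooth (x powr \<epsilon>) s" for n s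
          using bd[OF that(1)] ln_midpoint_far_from_smooth(2)[OF y2 that(2), of n] unfolding \<tau>_def u_def by linarith
        have order: "D \<le> \<tau> n' - \<tau> n" if n: "n \<in> B w" "n' \<in> B w" "n < n'" for n n'
        proof -
          have "D \<le> ln (real (u (Suc n))) - \<tau> n"
            using bd[OF n(1)] ln_midpoint_far_from_smooth(1)[OF y2, of n] unfolding \<tau>_def u_def by linarith
          moreover have "ln (real (u (Suc n))) \<le> \<tau> n'"
          proof -
            have "u (Suc n) \<le> u n'" using n(3) mono by (simp add: strict_mono_less_eq)
            then have "real (u (Suc n)) \<le> (real (u n') + real (u (Suc n'))) / 2" using up[of n'] by simp
            then show ?thesis unfolding \<tau>_def using u1[of "Suc n"] by (subst ln_le_cancel_iff) auto
          qed
          ultimately show ?thesis by linarith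
        qed
        have sep: "D \<le> \<bar>\<tau> n - \<tau> n'\<bar>" if "n \<in> B w" "n' \<in> B w" "n \<noteq> n'" for n n'
          using order[of n n'] order[of n' n] that by (cases "n < n'") auto
        have inj: "inj_on \<tau> (B w)"
          using sep D0 by (intro inj_onI) (metis abs_zero cancel_comm_monoid_add_class.diff_cancel not_le)
        have "real (card (\<tau> ` B w)) * (X * D\<^sup>2) \<le> x powr (\<epsilon> / 2)"
        proof (rule elim(4)[rule_format, OF X0(2) Xx D0 big])
          show "finite (\<tau> ` B w)" using finB by simp
          have "card (\<tau> ` B w) \<le> card S" using card_image_le[OF finB, of \<tau>] card_mono[OF finS BS] by linarith
          then show "real (card (\<tau> ` B w)) \<le> x\<^sup>2" using cardS by linarith
          show "ln X \<le> t \<and> t \<le> ln (4 * X)" if t: "t \<in> \<tau> ` B w" for t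
          proof -
            obtain n where n: "n \<in> B w" "t = \<tau> n" using t by blast
            have uX: "X \<le> real (u n)" "real (u n) < 2 * X" using Bn[OF n(1)] unfolding X_def by simp_all
            have "real (u n) \<le> real (u (Suc n))" using up[of n] by simp
            then have "X \<le> (real (u n) + real (u (Suc n))) / 2" using uX(1) by argo
            moreover have "real (u (Suc n)) \<le> 2 * real (u n)" using g[of n] gu[of n] by linarith
            then have "(real (u n) + real (u (Suc n))) / 2 \<le> 4 * X" using uX(2) X0(1) by argo
            ultimately have "X \<le> (real (u n) + real (u (Suc n))) / 2" "(real (u n) + real (u (Suc n))) / 2 \<le> 4 * X"
              by blast+
            then show ?thesis unfolding n(2) \<tau>_def using X0 by simp
          qed
          show "D \<le> \<bar>t - t'\<bar>" if "t \<in> \<tau> ` B w" "t' \<in> \<tau> ` B w" "t \<noteq> t'" for t t'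
            using that sep by blast
          show "D \<le> \<bar>ln (real s) - t\<bar>" if "t \<in> \<tau> ` B w" "smooth (x powr \<epsilon>) s" for t s
            using that far by blast
        qed
        then have "real (card (B w)) * (X * D\<^sup>2) \<le> x powr (\<epsilon> / 2)" using card_image[OF inj] by simp
        moreover have "X * D\<^sup>2 = \<Delta>\<^sup>2 / (64 * X)" unfolding D_def using X0 by (simp add: field_simps power2_eq_square)
        ultimately have c: "real (card (B w)) * \<Delta>\<^sup>2 \<le> 64 * X * x powr (\<epsilon> / 2)"
          using X0 by (simp add: field_simps)
        have "(\<Sum>n\<in>B w. (real (g n))\<^sup>2) \<le> (\<Sum>n\<in>B w. (2 * \<Delta>)\<^sup>2)"
          using Bn(4) unfolding \<Delta>_def by (intro sum_mono power_mono) (auto intro: less_imp_le)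
        also have "\<dots> = 4 * (real (card (B w)) * \<Delta>\<^sup>2)" by (simp add: power_mult_distrib)
        also have "\<dots> \<le> 4 * (64 * X * x powr (\<epsilon> / 2))" using c by simp
        also have "\<dots> \<le> 4 * (64 * x * x powr (\<epsilon> / 2))" using Xx by (intro mult_left_mono mult_right_mono) auto
        also have "\<dots> = 256 * x powr (1 + \<epsilon> / 2)" using x3 by (simp add: powr_add)
        finally show ?thesis .
      qed
    qed
    have "(\<Sum>n\<in>S. (real (g n))\<^sup>2) \<le> (\<Sum>n\<in>(\<Union>w\<in>{..I} \<times> {..I}. B w). (real (g n))\<^sup>2)"
    proof (rule sum_mono2)
      show "finite (\<Union>w\<in>{..I} \<times> {..I}. B w)"
        using finS by (intro finite_UN_I) (auto simp: B_def)
    qed (use cover in auto)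
    also have "\<dots> \<le> (\<Sum>w\<in>{..I} \<times> {..I}. \<Sum>n\<in>B w. (real (g n))\<^sup>2)"
      using finS by (intro sum_UN_le) (auto simp: B_def)
    also have "\<dots> \<le> (\<Sum>w\<in>{..I} \<times> {..I}. 256 * x powr (1 + \<epsilon> / 2))" using cell by (rule sum_mono)
    also have "\<dots> = (real I + 1)\<^sup>2 * (256 * x powr (1 + \<epsilon> / 2))"
      by (simp add: card_cartesian_product power2_eq_square algebra_simps)
    also have "\<dots> \<le> (3 * ln x)\<^sup>2 * (256 * x powr (1 + \<epsilon> / 2))"
    proof (intro mult_right_mono power_mono)
      have lnx: "ln x \<ge> 1"
      proof -
        have "exp 1 \<le> x" using exp_le x3 by linarith
        then show ?thesis using x3 by (simp add: ln_ge_iff)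
      qed
      have "real I \<le> log 2 x" unfolding I_def using x3 by (intro of_nat_floor) auto
      also have "\<dots> = ln x / ln 2" by (simp add: log_def)
      also have "\<dots> \<le> ln x / (1/2)" using ln2_ge_two_thirds lnx by (intro divide_left_mono) auto
      finally show "real I + 1 \<le> 3 * ln x" using lnx by simp
    qed auto
    also have "\<dots> = 2304 * ln x ^ 2 * x powr (1 + \<epsilon> / 2)" by (simp add: power_mult_distrib)
    also have "\<dots> \<le> x powr (\<epsilon> / 2) * x powr (1 + \<epsilon> / 2)" using elim(2) by (intro mult_right_mono) auto
    also have "\<dots> = x powr (1 + \<epsilon>)" by (simp add: add.commute flip: powr_add)
    finally have "(\<Sum>n\<in>S. (real (g n))\<^sup>2) \<le> x powr (1 + \<epsilon>)" .
    moreover have "0 \<le> (\<Sum>n\<in>S. (real (g n))\<^sup>2)" by (intro sum_nonneg) auto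
    ultimately have "\<bar>\<Sum>n\<in>S. (real (g n))\<^sup>2\<bar> \<le> 1 * x powr (1 + \<epsilon>)" by simp
    then show ?case unfolding S_def g u_def .
  qed
  then obtain x0 where "\<forall>x\<ge>x0.
    \<bar>\<Sum>n | real (smooth_seq (x powr \<epsilon>) n) \<le> x \<and>
           real (smooth_seq (x powr \<epsilon>) (Suc n)) - real (smooth_seq (x powr \<epsilon>) n) \<ge> x powr (1/3 + \<epsilon>).
       (real (smooth_seq (x powr \<epsilon>) (Suc n)) - real (smooth_seq (x powr \<epsilon>) n))\<^sup>2\<bar>
    \<le> 1 * x powr (1 + \<epsilon>)"
    unfolding eventually_at_top_linorder by blast
  then show ?thesis by (intro exI[of _ 1] conjI exI[of _ x0]) auto
qed

end
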